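(* (Harmony) Let $P \in \mathcal{P}$. Then: (1) for all $P'$, $P \to P'$ (reduction semantics) if and only if there exists $P''$ with $P \xrightarrow{\tau} P''$ (labeled semantics) and $P'' \equiv P'$; (2) $P \to \sigma$ for some rate distribution $\sigma$ if and only if $P \xrightarrow{\lambda,id} P'$ for some $\lambda$, $id$ and $P'$. Moreover, when both hold, for every $P' \in \mathcal{P}$, $$\sum_{(\lambda,[P']_\equiv)\in\sigma} \lambda\cdot \mu_\sigma(\lambda,[P']_\equiv) \;=\; \sum_{P \xrightarrow{\lambda,id} P'',\ P''\equiv P'} \lambda ,$$ where $\mu_\sigma(e)$ is the multiplicity of $e$ in $\sigma$, the left sum ranges over distinct pairs in $\sigma$ whose second component is $[P']_\equiv$, and the right sum ranges over distinct labeled Markovian transitions (distinct pairs of label $(\lambda,id)$ and target $P''$) with $P''\equiv P'$.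
   Context: Let $\mathcal{X}$ be a set of channel names $x,y,z,w,\dots$ and let $\lambda$ range over $\mathbb{R}^+$ (rates). Terms of $\mathcal{P}$ are generated by $P ::= M \mid P \,|\, P' \mid (\nu x)P \mid A(x_1,\dots,x_n)$, $M ::= \mathbf{0} \mid \alpha.P \mid M + M'$, $\alpha ::= \overline{x}\langle y\rangle \mid x(y) \mid \tau \mid (\lambda)$, where constants are given by a fixed set of definitions $A(\tilde{x}) \stackrel{def}{=} P$ which are weakly guarded: starting from the defining term and performing finitely many successive substitutions of constants by their defining terms, one reaches a term in which every constant occurs in the scope of a prefix. Labeled semantics on $\mathcal{P}$ (early $\pi$-calculus plus identified Markovian transitions). Standard labels $\mu$ are $\tau$, $\overline{x}y$, $xw$, $\overline{x}(y)$ with the usual $n$, $fn$, $bn$; $\eta$ ranges over standard labels and Markovian labels $(\lambda,id)$, where $id$ is a string over $\{+_0,+_1,|_0,|_1\}$ and $n(\lambda,id)=\emptyset$. Rules (plus symmetric versions of the sum, parallel and communication rules for standard labels): $\tau.P\xrightarrow{\tau}P$; $\overline{x}\langle y\rangle.P\xrightarrow{\overline{x}y}P$; $x(y).P\xrightarrow{xw}P\{w/y\}$; if $P\xrightarrow{\mu}P'$ then $P+Q\xrightarrow{\mu}P'$; if $P\xrightarrow{\mu}P'$ and $bn(\mu)\cap fn(Q)=\emptyset$ then $P|Q\xrightarrow{\mu}P'|Q$; if $P\xrightarrow{\overline{x}y}P'$ and $Q\xrightarrow{xy}Q'$ then $P|Q\xrightarrow{\tau}P'|Q'$; if $P\xrightarrow{\overline{x}(y)}P'$,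 $Q\xrightarrow{xy}Q'$ and $y\notin fn(Q)$ then $P|Q\xrightarrow{\tau}(\nu y)(P'|Q')$; if $P\xrightarrow{\eta}P'$ and $x\notin n(\eta)$ then $(\nu x)P\xrightarrow{\eta}(\nu x)P'$; if $P\xrightarrow{\overline{x}y}P'$ and $y\neq x$ then $(\nu y)P\xrightarrow{\overline{x}(y)}P'$; if $P\{\tilde y/\tilde x\}\xrightarrow{\eta}P'$ and $A(\tilde x)\stackrel{def}{=}P$ then $A(\tilde y)\xrightarrow{\eta}P'$. Markovian rules: $(\lambda).P\xrightarrow{\lambda,\varepsilon}P$ ($\varepsilon$ the empty string); if $P\xrightarrow{\lambda,id}P'$ then $P+Q\xrightarrow{\lambda,+_0 id}P'$ and $Q+P\xrightarrow{\lambda,+_1 id}P'$; if $P\xrightarrow{\lambda,id}P'$ then $P|Q\xrightarrow{\lambda,|_0 id}P'|Q$; if $Q\xrightarrow{\lambda,id}Q'$ then $P|Q\xrightarrow{\lambda,|_1 id}P|Q'$. Reduction semantics. Let $\mathcal{QN}$ be a set of stochastic names $q,q',\dots$ disjoint from $\mathcal{X}$, and let $\theta$ range over $\mathcal{X}\cup\mathcal{QN}$. The extended set $\mathcal{P}_{ext}$ is generated by the same grammar with, additionally, terms $(\nu q \rightarrow \lambda)P$ (a stochastic binder binding $q$ and assigning it rate $\lambda$) and prefixes $\alpha ::= (q)$. One writes $(\nu x \rightarrow \varepsilon)$ for $(\nu x)$, and $(\nu \theta \rightarrow \hat\lambda)$ for an arbitrary binder with $\hat\lambda \in \mathbb{R}^+\cup\{\varepsilon\}$.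 Structural congruence $\equiv$ on $\mathcal{P}_{ext}$ is the smallest congruence including alpha-renaming of bound names and the laws: $(\nu\theta\rightarrow\hat\lambda)P \,|\, Q \equiv (\nu\theta\rightarrow\hat\lambda)(P\,|\,Q)$ if $\theta\notin fn(Q)$; $(\nu\theta\rightarrow\hat\lambda)(\nu\theta'\rightarrow\hat\lambda')P \equiv (\nu\theta'\rightarrow\hat\lambda')(\nu\theta\rightarrow\hat\lambda)P$ if $\theta\neq\theta'$; $(\nu\theta\rightarrow\hat\lambda)\mathbf{0}\equiv\mathbf{0}$; $(M_1+M_2)+M_3 \equiv M_1+(M_2+M_3)$; $M+N\equiv N+M$; $M+\mathbf{0}\equiv M$; $(P_1|P_2)|P_3\equiv P_1|(P_2|P_3)$; $P|Q\equiv Q|P$; $P|\mathbf{0}\equiv P$; $A(\tilde y)\equiv P\{\tilde y/\tilde x\}$ if $A(\tilde x)\stackrel{def}{=}P$; and $(\lambda).P + M \equiv (\nu q\rightarrow\lambda)((q).P+M)$ if $q\notin fn(M,P)$. Transitions $P \xrightarrow{\hat q} P'$ with $\hat q \in \mathcal{QN}\cup\{\varepsilon\}$ (an $\varepsilon$-label is written $P\to P'$, a standard reduction) are the smallest relation on $\mathcal{P}_{ext}$ closed under: $(q).P+M \xrightarrow{q} P$; $\tau.P+M \to P$; $x(z).P+M \,|\, \overline{x}\langle y\rangle.Q+N \to P\{y/z\}\,|\,Q$; if $P\xrightarrow{\hat q}P'$ then $P|Q\xrightarrow{\hat q}P'|Q$; if $P\xrightarrow{\hat q}P'$ and $\theta\neq\hat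 q$ then $(\nu\theta\rightarrow\hat\lambda)P \xrightarrow{\hat q} (\nu\theta\rightarrow\hat\lambda)P'$; if $P\equiv Q$, $Q\xrightarrow{\hat q}Q'$, $Q'\equiv P'$ then $P\xrightarrow{\hat q}P'$. A rate distribution is a non-empty finite multiset of pairs $(\lambda, e)$ with $\lambda\in\mathbb{R}^+$ and $e \in \mathcal{P}_{ext}/\!\equiv$. For a rate distribution $\sigma$, $(\nu q\rightarrow\lambda)\sigma$ denotes the multiset $\{\!|\,(\lambda',[(\nu q\rightarrow\lambda)P]_\equiv) \mid (\lambda',[P]_\equiv)\in\sigma\,|\!\}$; $\cup$ is multiset union. Stochastic transitions $P\to\sigma$ are the least relation (well-defined by stratification) closed under: (Sto1) if $P\to\sigma$ and $P\xrightarrow{q}P'$ then $(\nu q\rightarrow\lambda)P \to (\nu q\rightarrow\lambda)\sigma \cup \{\!|(\lambda,[(\nu q\rightarrow\lambda)P']_\equiv)|\!\}$; (Sto2) if there is no $\sigma$ with $P\to\sigma$, and $P\xrightarrow{q}P'$, then $(\nu q\rightarrow\lambda)P\to\{\!|(\lambda,[(\nu q\rightarrow\lambda)P']_\equiv)|\!\}$; (StoCong) if $P\equiv Q$ and $Q\to\sigma$ then $P\to\sigma$. *)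

theory Defs
  imports
    Complex_Main
    "HOL-Library.Multiset"
    "HOL-Library.Infinite_Typeclass"
    "HOL-Combinatorics.Transposition"
begin

section \<open>Syntax\<close>

typedef rate = "{r :: real. 0 < r}" morphisms rate_val Rate
  by (rule exI[of _ 1]) simp

text \<open>
  Channel names, stochastic names and constants have separate types \<open>'x\<close>, \<open>'q\<close>, \<open>'k\<close>.
  Terms are raw (bound names are visible); \<open>proc\<close> is the extended set of terms, and \<open>summ\<close> is the
  syntactic category of sums \<open>M\<close>.  \<open>Nu (BChan x)\<close> is \<open>(\<nu>x) = (\<nu>x \<rightarrow> \<epsilon>)\<close> and
  \<open>Nu (BStoch q \<lambda>)\<close> is \<open>(\<nu>q \<rightarrow> \<lambda>)\<close>.
\<close>

datatype ('x, 'q) prefix =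
    Out 'x 'x
  | In 'x 'x  \<comment> \<open>\<open>In x y\<close> binds \<open>y\<close> in the continuation\<close>
  | Tau
  | Delay rate
  | Stoch 'q

datatype ('x, 'q) nu_binder = BChan 'x | BStoch 'q rate

datatype (proc_chans: 'x, proc_stochs: 'q, proc_consts: 'k) proc =
    Sum "('x, 'q, 'k) summ"
  | Par "('x, 'q, 'k) proc" "('x, 'q, 'k) proc"
  | Nu "('x, 'q) nu_binder" "('x, 'q, 'k) proc"
  | Const 'k "'x list"
and (summ_chans: 'x, summ_stochs: 'q, summ_consts: 'k) summ =
    Zero
  | Pre "('x, 'q) prefix" "('x, 'q, 'k) proc"
  | Plus "('x, 'q, 'k) summ" "('x, 'q, 'k) summ"

text \<open>
  \<open>proc_stochs\<close> collects all stochastic names, free, bound or binding, so its emptiness says that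
  neither a stochastic binder nor a prefix \<open>(q)\<close> occurs.
\<close>

definition core :: "('x, 'q, 'k) proc set" where
  "core = {P. proc_stochs P = {}}"

text \<open>\<open>D A = (xs, B)\<close> is the definition of the constant \<open>A\<close> with parameters \<open>xs\<close> and body \<open>B\<close>.\<close>

type_synonym ('x, 'q, 'k) defs = "'k \<Rightarrow> 'x list \<times> ('x, 'q, 'k) proc"

fun bname :: "('x, 'q) nu_binder \<Rightarrow> 'x + 'q" where
  "bname (BChan x) = Inl x"
| "bname (BStoch q l) = Inr q"

primrec fn :: "('x, 'q, 'k) proc \<Rightarrow> ('x + 'q) set"
  and fn_summ :: "('x, 'q, 'k) summ \<Rightarrow> ('x + 'q) set" where
  "fn (Sum M) = fn_summ M"
| "fn (Par P Q) = fn P \<union> fn Q"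
| "fn (Nu b P) = fn P - {bname b}"
| "fn (Const A ys) = Inl ` set ys"
| "fn_summ Zero = {}"
| "fn_summ (Pre a P) =
    (case a of
       Out x y \<Rightarrow> {Inl x, Inl y} \<union> fn P
     | In x y \<Rightarrow> {Inl x} \<union> (fn P - {Inl y})
     | Tau \<Rightarrow> fn P
     | Delay l \<Rightarrow> fn P
     | Stoch q \<Rightarrow> {Inr q} \<union> fn P)"
| "fn_summ (Plus M N) = fn_summ M \<union> fn_summ N"

text \<open>
  Capture-avoiding simultaneous substitution of channel names.  A bound channel is kept unless it
  would capture, that is, unless it lies in the set of images of the other free channels of its
  scope.  Stochastic binders cannot capture channels.
\<close>

definition avoid :: "'x \<Rightarrow> 'x set \<Rightarrow> 'x" where
  "avoid x S = (if x \<notin> S then x else (SOME z. z \<notin> S))"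

definition new_bound :: "('x \<Rightarrow> 'x) \<Rightarrow> 'x \<Rightarrow> ('x, 'q, 'k) proc \<Rightarrow> 'x" where
  "new_bound s x P = avoid x (s ` {y. Inl y \<in> fn P \<and> y \<noteq> x})"

primrec subst :: "('x \<Rightarrow> 'x) \<Rightarrow> ('x, 'q, 'k) proc \<Rightarrow> ('x, 'q, 'k) proc"
  and subst_summ :: "('x \<Rightarrow> 'x) \<Rightarrow> ('x, 'q, 'k) summ \<Rightarrow> ('x, 'q, 'k) summ" where
  "subst s (Sum M) = Sum (subst_summ s M)"
| "subst s (Par P Q) = Par (subst s P) (subst s Q)"
| "subst s (Nu b P) =
    (case b of
       BChan x \<Rightarrow> (let z = new_bound s x P in Nu (BChan z) (subst (s(x := z)) P))
     | BStoch q l \<Rightarrow> Nu (BStoch q l) (subst s P))"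
| "subst s (Const A ys) = Const A (map s ys)"
| "subst_summ s Zero = Zero"
| "subst_summ s (Pre a P) =
    (case a of
       Out x y \<Rightarrow> Pre (Out (s x) (s y)) (subst s P)
     | In x y \<Rightarrow> (let z = new_bound s y P in Pre (In (s x) z) (subst (s(y := z)) P))
     | Tau \<Rightarrow> Pre Tau (subst s P)
     | Delay l \<Rightarrow> Pre (Delay l) (subst s P)
     | Stoch q \<Rightarrow> Pre (Stoch q) (subst s P))"
| "subst_summ s (Plus M N) = Plus (subst_summ s M) (subst_summ s N)"

definition subst1 :: "'x \<Rightarrow> 'x \<Rightarrow> ('x, 'q, 'k) proc \<Rightarrow> ('x, 'q, 'k) proc" where
  "subst1 y w P = subst (id(y := w)) P"  \<comment> \<open>\<open>P{w/y}\<close>\<close>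

definition instantiate :: "'x list \<Rightarrow> 'x list \<Rightarrow> ('x, 'q, 'k) proc \<Rightarrow> ('x, 'q, 'k) proc" where
  "instantiate xs ys P =
    subst (\<lambda>z. case map_of (zip xs ys) z of Some w \<Rightarrow> w | None \<Rightarrow> z) P"

text \<open>
  \<open>unfolds D A ys B\<close>: the constant \<open>A(ys)\<close> stands for \<open>B\<close>.  A constant applied to the wrong number
  of arguments stands for nothing and is inert.
\<close>

definition unfolds ::
  "('x, 'q, 'k) defs \<Rightarrow> 'k \<Rightarrow> 'x list \<Rightarrow> ('x, 'q, 'k) proc \<Rightarrow> bool" where
  "unfolds D A ys B \<longleftrightarrow>
    (\<exists>xs B0. D A = (xs, B0) \<and> length xs = length ys \<and> B = instantiate xs ys B0)"


section \<open>Weakly guarded definitions\<close>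

inductive replace1 :: "('x, 'q, 'k) defs \<Rightarrow> ('x, 'q, 'k) proc \<Rightarrow> ('x, 'q, 'k) proc \<Rightarrow> bool"
  and replace1_summ :: "('x, 'q, 'k) defs \<Rightarrow> ('x, 'q, 'k) summ \<Rightarrow> ('x, 'q, 'k) summ \<Rightarrow> bool"
  for D where
  "unfolds D A ys B \<Longrightarrow> replace1 D (Const A ys) B"
| "replace1 D P P' \<Longrightarrow> replace1 D (Par P Q) (Par P' Q)"
| "replace1 D Q Q' \<Longrightarrow> replace1 D (Par P Q) (Par P Q')"
| "replace1 D P P' \<Longrightarrow> replace1 D (Nu b P) (Nu b P')"
| "replace1_summ D M M' \<Longrightarrow> replace1 D (Sum M) (Sum M')"
| "replace1 D P P' \<Longrightarrow> replace1_summ D (Pre a P) (Pre a P')"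
| "replace1_summ D M M' \<Longrightarrow> replace1_summ D (Plus M N) (Plus M' N)"
| "replace1_summ D N N' \<Longrightarrow> replace1_summ D (Plus M N) (Plus M N')"

text \<open>In a sum every constant is under a prefix, by the grammar.\<close>

primrec guarded :: "('x, 'q, 'k) proc \<Rightarrow> bool" where
  "guarded (Sum M) \<longleftrightarrow> True"
| "guarded (Par P Q) \<longleftrightarrow> guarded P \<and> guarded Q"
| "guarded (Nu b P) \<longleftrightarrow> guarded P"
| "guarded (Const A ys) \<longleftrightarrow> False"

definition weakly_guarded :: "('x, 'q, 'k) defs \<Rightarrow> ('x, 'q, 'k) proc \<Rightarrow> bool" where
  "weakly_guarded D P \<longleftrightarrow> (\<exists>P'. (replace1 D)\<^sup>*\<^sup>* P P' \<and> guarded P')"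

text \<open>
  The usual conventions for defining equations are included: the parameters are distinct, and
  every free name of the body is a parameter.
\<close>

definition wf_defs :: "('x, 'q, 'k) defs \<Rightarrow> bool" where
  "wf_defs D \<longleftrightarrow>
    (\<forall>A xs B. D A = (xs, B) \<longrightarrow>
      distinct xs \<and> B \<in> core \<and> fn B \<subseteq> Inl ` set xs \<and> weakly_guarded D B)"


section \<open>Structural congruence\<close>

text \<open>
  The smallest congruence containing \<open>R\<close>.  Sums may be replaced inside a sum only by sums.
\<close>

inductive congr ::
  "(('x, 'q, 'k) proc \<Rightarrow> ('x, 'q, 'k) proc \<Rightarrow> bool) \<Rightarrow>
   ('x, 'q, 'k) proc \<Rightarrow> ('x, 'q, 'k) proc \<Rightarrow> bool"
  for R where
  congr_base: "R P Q \<Longrightarrow> congr R P Q"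
| congr_refl: "congr R P P"
| congr_sym: "congr R P Q \<Longrightarrow> congr R Q P"
| congr_trans: "congr R P Q \<Longrightarrow> congr R Q Q' \<Longrightarrow> congr R P Q'"
| congr_par: "congr R P P' \<Longrightarrow> congr R Q Q' \<Longrightarrow> congr R (Par P Q) (Par P' Q')"
| congr_nu: "congr R P P' \<Longrightarrow> congr R (Nu b P) (Nu b P')"
| congr_pre: "congr R P P' \<Longrightarrow> congr R (Sum (Pre a P)) (Sum (Pre a P'))"
| congr_plus: "congr R (Sum M) (Sum M') \<Longrightarrow> congr R (Sum N) (Sum N') \<Longrightarrow>
    congr R (Sum (Plus M N)) (Sum (Plus M' N'))"

text \<open>
  Renaming of one binder.  As the new name is fresh for the scope, renaming by a transposition
  (acting on all occurrences, bound ones included) amounts to capture-avoiding substitution.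
\<close>

inductive alpha_law :: "('x, 'q, 'k) proc \<Rightarrow> ('x, 'q, 'k) proc \<Rightarrow> bool" where
  "Inl y \<notin> fn P \<Longrightarrow>
    alpha_law (Nu (BChan x) P) (Nu (BChan y) (map_proc (transpose x y) id id P))"
| "Inr r \<notin> fn P \<Longrightarrow>
    alpha_law (Nu (BStoch q l) P) (Nu (BStoch r l) (map_proc id (transpose q r) id P))"
| "Inl z \<notin> fn P \<Longrightarrow>
    alpha_law (Sum (Pre (In x y) P)) (Sum (Pre (In x z) (map_proc (transpose y z) id id P)))"

abbreviation alpha :: "('x, 'q, 'k) proc \<Rightarrow> ('x, 'q, 'k) proc \<Rightarrow> bool" where
  "alpha \<equiv> congr alpha_law"

inductive struct_law ::
  "('x, 'q, 'k) defs \<Rightarrow> ('x, 'q, 'k) proc \<Rightarrow> ('x, 'q, 'k) proc \<Rightarrow> bool"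
  for D where
  "alpha_law P Q \<Longrightarrow> struct_law D P Q"
| "bname b \<notin> fn Q \<Longrightarrow> struct_law D (Par (Nu b P) Q) (Nu b (Par P Q))"
| "bname b \<noteq> bname c \<Longrightarrow> struct_law D (Nu b (Nu c P)) (Nu c (Nu b P))"
| "struct_law D (Nu b (Sum Zero)) (Sum Zero)"
| "struct_law D (Sum (Plus (Plus M1 M2) M3)) (Sum (Plus M1 (Plus M2 M3)))"
| "struct_law D (Sum (Plus M N)) (Sum (Plus N M))"
| "struct_law D (Sum (Plus M Zero)) (Sum M)"
| "struct_law D (Par (Par P1 P2) P3) (Par P1 (Par P2 P3))"
| "struct_law D (Par P Q) (Par Q P)"
| "struct_law D (Par P (Sum Zero)) P"
| "unfolds D A ys B \<Longrightarrow> struct_law D (Const A ys) B"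
| "Inr q \<notin> fn_summ M \<union> fn P \<Longrightarrow>
    struct_law D (Sum (Plus (Pre (Delay l) P) M))
      (Nu (BStoch q l) (Sum (Plus (Pre (Stoch q) P) M)))"

abbreviation scong ::
  "('x, 'q, 'k) defs \<Rightarrow> ('x, 'q, 'k) proc \<Rightarrow> ('x, 'q, 'k) proc \<Rightarrow> bool" where
  "scong D \<equiv> congr (struct_law D)"

definition scong_class :: "('x, 'q, 'k) defs \<Rightarrow> ('x, 'q, 'k) proc \<Rightarrow> ('x, 'q, 'k) proc set" where
  "scong_class D P = {Q. scong D P Q}"


section \<open>Labeled semantics\<close>

datatype 'x std_label = LTau | LOut 'x 'x | LIn 'x 'x | LBOut 'x 'x

datatype pos = Plus0 | Plus1 | Par0 | Par1

datatype 'x label = Std "'x std_label" | Mark rate "pos list"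

fun bn_label :: "'x std_label \<Rightarrow> 'x set" where
  "bn_label (LBOut x y) = {y}"
| "bn_label _ = {}"

fun n_label :: "'x label \<Rightarrow> 'x set" where
  "n_label (Std LTau) = {}"
| "n_label (Std (LOut x y)) = {x, y}"
| "n_label (Std (LIn x w)) = {x, w}"
| "n_label (Std (LBOut x y)) = {x, y}"
| "n_label (Mark l i) = {}"

text \<open>
  The labeled semantics is only used for sources in \<open>core\<close>, which is closed under it.

  In the labeled semantics terms are understood up to \<open>\<alpha>\<close>-conversion, without which the side
  conditions on names could block transitions.  On raw terms this is expressed by the rule
  \<open>Alpha\<close>.  Markovian labels contain no names, so Markovian transitions never need it; leaving it
  out for them means that \<open>\<alpha>\<close>-variants of a target are not counted as distinct transitions.
\<close>

inductive step ::
  "('x, 'q, 'k) defs \<Rightarrow> ('x, 'q, 'k) proc \<Rightarrow> 'x label \<Rightarrow> ('x, 'q, 'k) proc \<Rightarrow> bool"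
  for D where
  Tau: "step D (Sum (Pre Tau P)) (Std LTau) P"
| Out: "step D (Sum (Pre (Out x y) P)) (Std (LOut x y)) P"
| Inp: "step D (Sum (Pre (In x y) P)) (Std (LIn x w)) (subst1 y w P)"
| SumL: "step D (Sum M) (Std \<mu>) P' \<Longrightarrow> step D (Sum (Plus M N)) (Std \<mu>) P'"
| SumR: "step D (Sum N) (Std \<mu>) P' \<Longrightarrow> step D (Sum (Plus M N)) (Std \<mu>) P'"
| ParL: "step D P (Std \<mu>) P' \<Longrightarrow> Inl ` bn_label \<mu> \<inter> fn Q = {} \<Longrightarrow>
    step D (Par P Q) (Std \<mu>) (Par P' Q)"
| ParR: "step D Q (Std \<mu>) Q' \<Longrightarrow> Inl ` bn_label \<mu> \<inter> fn P = {} \<Longrightarrow>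
    step D (Par P Q) (Std \<mu>) (Par P Q')"
| ComL: "step D P (Std (LOut x y)) P' \<Longrightarrow> step D Q (Std (LIn x y)) Q' \<Longrightarrow>
    step D (Par P Q) (Std LTau) (Par P' Q')"
| ComR: "step D P (Std (LIn x y)) P' \<Longrightarrow> step D Q (Std (LOut x y)) Q' \<Longrightarrow>
    step D (Par P Q) (Std LTau) (Par P' Q')"
| CloseL: "step D P (Std (LBOut x y)) P' \<Longrightarrow> step D Q (Std (LIn x y)) Q' \<Longrightarrow> Inl y \<notin> fn Q \<Longrightarrow>
    step D (Par P Q) (Std LTau) (Nu (BChan y) (Par P' Q'))"
| CloseR: "step D P (Std (LIn x y)) P' \<Longrightarrow> step D Q (Std (LBOut x y)) Q' \<Longrightarrow> Inl y \<notin> fn P \<Longrightarrow>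
    step D (Par P Q) (Std LTau) (Nu (BChan y) (Par P' Q'))"
| Res: "step D P \<eta> P' \<Longrightarrow> x \<notin> n_label \<eta> \<Longrightarrow> step D (Nu (BChan x) P) \<eta> (Nu (BChan x) P')"
| Open: "step D P (Std (LOut x y)) P' \<Longrightarrow> y \<noteq> x \<Longrightarrow>
    step D (Nu (BChan y) P) (Std (LBOut x y)) P'"
| Cons: "unfolds D A ys B \<Longrightarrow> step D B \<eta> P' \<Longrightarrow> step D (Const A ys) \<eta> P'"
| Alpha: "alpha P Q \<Longrightarrow> step D Q (Std \<mu>) P' \<Longrightarrow> step D P (Std \<mu>) P'"
| MDelay: "step D (Sum (Pre (Delay l) P)) (Mark l []) P"
| MSum0: "step D (Sum M) (Mark l i) P' \<Longrightarrow> step D (Sum (Plus M N)) (Mark l (Plus0 # i)) P'"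
| MSum1: "step D (Sum N) (Mark l i) P' \<Longrightarrow> step D (Sum (Plus M N)) (Mark l (Plus1 # i)) P'"
| MPar0: "step D P (Mark l i) P' \<Longrightarrow> step D (Par P Q) (Mark l (Par0 # i)) (Par P' Q)"
| MPar1: "step D Q (Mark l i) Q' \<Longrightarrow> step D (Par P Q) (Mark l (Par1 # i)) (Par P Q')"


section \<open>Reduction semantics\<close>

text \<open>The label \<open>None\<close> is \<open>\<epsilon>\<close> (a standard reduction) and \<open>Some q\<close> is \<open>q\<close>.\<close>

inductive red ::
  "('x, 'q, 'k) defs \<Rightarrow> ('x, 'q, 'k) proc \<Rightarrow> 'q option \<Rightarrow> ('x, 'q, 'k) proc \<Rightarrow> bool"
  for D where
  RStoch: "red D (Sum (Plus (Pre (Stoch q) P) M)) (Some q) P"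
| RTau: "red D (Sum (Plus (Pre Tau P) M)) None P"
| RCom: "red D (Par (Sum (Plus (Pre (In x z) P) M)) (Sum (Plus (Pre (Out x y) Q) N))) None
    (Par (subst1 z y P) Q)"
| RPar: "red D P a P' \<Longrightarrow> red D (Par P Q) a (Par P' Q)"
| RNu: "red D P a P' \<Longrightarrow> bname b \<notin> Inr ` set_option a \<Longrightarrow> red D (Nu b P) a (Nu b P')"
| RCong: "scong D P Q \<Longrightarrow> red D Q a Q' \<Longrightarrow> scong D Q' P' \<Longrightarrow> red D P a P'"


section \<open>Stochastic transitions\<close>

text \<open>
  The elements of a rate distribution are pairs of a rate and a class of structural congruence.
  Non-emptiness need not be required: the rules below produce non-empty multisets only.
\<close>

type_synonym ('x, 'q, 'k) rate_dist = "(rate \<times> ('x, 'q, 'k) proc set) multiset"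

definition nu_class ::
  "('x, 'q, 'k) defs \<Rightarrow> 'q \<Rightarrow> rate \<Rightarrow> ('x, 'q, 'k) proc set \<Rightarrow> ('x, 'q, 'k) proc set" where
  "nu_class D q l e = (\<Union>P\<in>e. scong_class D (Nu (BStoch q l) P))"

definition nu_dist ::
  "('x, 'q, 'k) defs \<Rightarrow> 'q \<Rightarrow> rate \<Rightarrow> ('x, 'q, 'k) rate_dist \<Rightarrow> ('x, 'q, 'k) rate_dist" where
  "nu_dist D q l \<sigma> = image_mset (\<lambda>(l', e). (l', nu_class D q l e)) \<sigma>"

text \<open>
  The least relation closed under the rules, when the negative premise ``there is no \<open>\<sigma>\<close> with
  \<open>P \<rightarrow> \<sigma>\<close>'' of \<open>Sto2\<close> is read as \<open>N P\<close>.
\<close>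

inductive sto_rules ::
  "('x, 'q, 'k) defs \<Rightarrow> (('x, 'q, 'k) proc \<Rightarrow> bool) \<Rightarrow>
   ('x, 'q, 'k) proc \<Rightarrow> ('x, 'q, 'k) rate_dist \<Rightarrow> bool"
  for D N where
  Sto1: "sto_rules D N P \<sigma> \<Longrightarrow> red D P (Some q) P' \<Longrightarrow>
    sto_rules D N (Nu (BStoch q l) P)
      (nu_dist D q l \<sigma> + {#(l, scong_class D (Nu (BStoch q l) P'))#})"
| Sto2: "N P \<Longrightarrow> red D P (Some q) P' \<Longrightarrow>
    sto_rules D N (Nu (BStoch q l) P) {#(l, scong_class D (Nu (BStoch q l) P'))#}"
| StoCong: "scong D P Q \<Longrightarrow> sto_rules D N Q \<sigma> \<Longrightarrow> sto_rules D N P \<sigma>"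

text \<open>
  The stochastic transition relation is the relation that results when the negative premise is
  read in that relation itself.  For weakly guarded definitions the rules are stratified (by the
  number of stochastic binders that can fire, counting unguarded prefixes \<open>(\<lambda>)\<close>), so there is
  exactly one such relation, and it is the one built up stratum by stratum.
\<close>

definition sto :: "('x, 'q, 'k) defs \<Rightarrow> ('x, 'q, 'k) proc \<Rightarrow> ('x, 'q, 'k) rate_dist \<Rightarrow> bool" where
  "sto D = (THE R. R = sto_rules D (\<lambda>P. \<not> (\<exists>\<sigma>. R P \<sigma>)))"

end

theory Submission
  imports Defs
begin

text \<open>
  Both semantics are compared with a third presentation of the transitions, which follows
  the structure of extended terms and is invariant under structural congruence.

  For (1) this is a system of commitments in which a sender is given the abstraction \<open>(z)R\<close> that
  its message will be received by: \<open>P\<close> commits to sending on \<open>x\<close> to \<open>(z)R\<close> and becomes the term \<open>P'\<close>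
  in which \<open>R\<close>, with the message put for \<open>z\<close>, stands inside the restrictions of \<open>P\<close>.  Scope extrusion
  is thus built in, and there are neither bound outputs nor rules for opening and closing scopes,
  so the laws of parallel composition and of restriction need few cases.  What makes them work is
  that a sender does not look at the abstraction, so changing it to \<open>(z)(R | Q)\<close> or \<open>(z)(\<nu>x)R\<close> merely
  moves \<open>Q\<close> or \<open>\<nu>x\<close> through the target.  Reductions are commitments, commitments of terms of
  \<open>core\<close> are labeled transitions, and labeled transitions are reductions since they expose a prefix.

  For (2) it is the multiset of stochastic derivatives of a term modulo structural congruence: those
  with a rate, coming from a prefix \<open>(\<lambda>)\<close> or from a bound prefix \<open>(q)\<close>, and those still waiting for a
  binder of \<open>q\<close>.  In \<open>core\<close> the derivatives with a rate are the Markovian transitions.  Terms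
  congruent to one in \<open>core\<close> have at most one active \<open>(q)\<close> per binder, so that the rules for \<open>P \<rightarrow> \<sigma>\<close>
  leave no choice and collect all of them.  A term has no \<open>\<sigma>\<close> iff it has no derivative with a rate;
  this determines the negative premises, by induction on the number of such derivatives, which is
  finite because of weak guardedness.
\<close>

section \<open>Alpha-equivalence\<close>

text \<open>Terms are raw, and \<open>alpha\<close> is generated with symmetry and transitivity, so
  it has no usable inversion at a binder; it is characterised by the images of terms in de Bruijn
  levels, and facts about it are computed on these images. A second obstacle is that a receiving
  commitment shows the bound name of its abstraction, which must be fresh for whatever stands beside
  it. Congruent terms are therefore shown to agree only on commitments whose bound name lies outside
  some finite set. Since a commitment \<open>KTau\<close> shows no name, this is enough for
  reductions. For the rates, targets are replaced by their classes before multiplicities are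
  compared: unfolding a constant may pick any alpha-variant of its body, so one term can have
  several multisets of derivatives, and only the classes can be followed through the congruence. On
  the labeled side the position strings keep apart derivatives that are otherwise equal, so a set of
  transitions can stand for a multiset.\<close>

definition perm :: "('x \<Rightarrow> 'x) \<Rightarrow> ('q \<Rightarrow> 'q) \<Rightarrow> ('x, 'q, 'k) proc \<Rightarrow> ('x, 'q, 'k) proc" where
  "perm f g = map_proc f g id"

definition perm_summ :: "('x \<Rightarrow> 'x) \<Rightarrow> ('q \<Rightarrow> 'q) \<Rightarrow> ('x, 'q, 'k) summ \<Rightarrow> ('x, 'q, 'k) summ" where
  "perm_summ f g = map_summ f g id"

lemma perm_simps [simp]:
  "perm f g (Sum M) = Sum (perm_summ f g M)"
  "perm f g (Par P Q) = Par (perm f g P) (perm f g Q)"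
  "perm f g (Nu b P) = Nu (map_nu_binder f g b) (perm f g P)"
  "perm f g (Const A ys) = Const A (map f ys)"
  "perm_summ f g Zero = Zero"
  "perm_summ f g (Pre a P) = Pre (map_prefix f g a) (perm f g P)"
  "perm_summ f g (Plus M N) = Plus (perm_summ f g M) (perm_summ f g N)"
  by (simp_all add: perm_def perm_summ_def)

text \<open>Renaming a binder can change its name but neither its kind nor the rate it
  assigns.\<close>

fun like :: "('x, 'q) nu_binder \<Rightarrow> ('x, 'q) nu_binder \<Rightarrow> bool" where
  "like (BChan x) (BChan y) = True"
| "like (BStoch q l) (BStoch r l') = (l = l')"
| "like _ _ = False"

text \<open>The last equation is a default for binders of different kinds; \<open>ren b c\<close>
  matters only under \<open>like b c\<close>. Opening a binder by a transposition instead of a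
  substitution keeps the renaming invertible.\<close>

fun ren :: "('x, 'q) nu_binder \<Rightarrow> ('x, 'q) nu_binder \<Rightarrow> ('x, 'q, 'k) proc \<Rightarrow> ('x, 'q, 'k) proc" where
  "ren (BChan x) (BChan y) P = perm (transpose x y) id P"
| "ren (BStoch q _) (BStoch r _) P = perm id (transpose q r) P"
| "ren _ _ P = P"

lemma like_refl [simp]: "like b b" by (cases b) auto

lemma like_sym: "like b c \<Longrightarrow> like c b" by (cases b; cases c) auto

lemma like_trans: "like a b \<Longrightarrow> like b c \<Longrightarrow> like a c" by (cases a; cases b; cases c) auto

lemma bname_perm [simp]: "bname (map_nu_binder f g b) = map_sum f g (bname b)"
  by (cases b) auto

lemma like_bname_eq: "like b c \<Longrightarrow> bname b = bname c \<Longrightarrow> b = c"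
  by (cases b; cases c) auto

lemma perm_comp: "perm f g (perm f' g' P) = perm (f \<circ> f') (g \<circ> g') P"
  by (simp add: perm_def proc.map_comp)

lemma perm_id [simp]: "perm id id P = P" "perm_summ id id M = M"
  by (simp_all add: perm_def perm_summ_def proc.map_id summ.map_id)

lemma inj_map_sum: "inj f \<Longrightarrow> inj g \<Longrightarrow> inj (map_sum f g)"
  by (simp add: sum.inj_map)

lemma finite_fn [simp]:
  fixes P :: "('x, 'q, 'k) proc" and M :: "('x, 'q, 'k) summ"
  shows "finite (fn P)" "finite (fn_summ M)"
  by (induct P and M rule: proc.induct summ.induct) (auto split: prefix.split)

lemma fn_perm:
  fixes P :: "('x, 'q, 'k) proc" and M :: "('x, 'q, 'k) summ"
  assumes f: "inj f" and g: "inj g"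
  shows "fn (perm f g P) = map_sum f g ` fn P" "fn_summ (perm_summ f g M) = map_sum f g ` fn_summ M"
proof (induct P and M rule: proc.induct summ.induct)
  case (Nu b P)
  then show ?case using inj_map_sum[OF f g] by (simp add: image_set_diff)
next
  case (Pre a P)
  have "map_sum f g ` (fn P - {Inl y}) = map_sum f g ` fn P - {Inl (f y)}" for y
    using inj_map_sum[OF f g] by (simp add: image_set_diff)
  with Pre show ?case by (cases a) auto
qed (auto simp: image_image image_Un)

lemma fresh_chan: "finite S \<Longrightarrow> \<exists>y :: 'x :: infinite. y \<notin> S"
  using ex_new_if_finite infinite_UNIV by blast

lemma fresh_like:
  assumes "finite S" shows "\<exists>c :: ('x :: infinite, 'q :: infinite) nu_binder. like b c \<and> bname c \<notin> S"
proof (cases b)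
  case (BChan x)
  have "finite (Inl -` S :: 'x set)" using assms by (simp add: finite_vimageI)
  then obtain y :: 'x where "y \<notin> Inl -` S" using fresh_chan by blast
  then show ?thesis using BChan by (intro exI[of _ "BChan y"]) auto
next
  case (BStoch q l)
  have "finite (Inr -` S :: 'q set)" using assms by (simp add: finite_vimageI)
  then obtain y :: 'q where "y \<notin> Inr -` S" using fresh_chan by blast
  then show ?thesis using BStoch by (intro exI[of _ "BStoch y l"]) auto
qed

text \<open>
  The de Bruijn levels of a term, in an environment for its free names.  Two terms are
  \<open>\<alpha>\<close>-equivalent iff their images agree, and both substitution and permutation act on
  the environment.
\<close>

fun dbb :: "nat \<Rightarrow> ('x, 'q) nu_binder \<Rightarrow> ('n + nat, 'n + nat) nu_binder" where
  "dbb k (BChan x) = BChan (Inr k)"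
| "dbb k (BStoch q l) = BStoch (Inr k) l"

primrec db :: "('x, 'q, 'k) proc \<Rightarrow> nat \<Rightarrow> ('x + 'q \<Rightarrow> 'n + nat) \<Rightarrow> ('n + nat, 'n + nat, 'k) proc"
  and db_summ :: "('x, 'q, 'k) summ \<Rightarrow> nat \<Rightarrow> ('x + 'q \<Rightarrow> 'n + nat) \<Rightarrow> ('n + nat, 'n + nat, 'k) summ"
where
  "db (Sum M) k e = Sum (db_summ M k e)"
| "db (Par P Q) k e = Par (db P k e) (db Q k e)"
| "db (Nu b P) k e = Nu (dbb k b) (db P (Suc k) (e(bname b := Inr k)))"
| "db (Const A ys) k e = Const A (map (e \<circ> Inl) ys)"
| "db_summ Zero k e = Zero"
| "db_summ (Pre a P) k e =
    (case a of
       Out x y \<Rightarrow> Pre (Out (e (Inl x)) (e (Inl y))) (db P k e)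
     | In x y \<Rightarrow> Pre (In (e (Inl x)) (Inr k)) (db P (Suc k) (e(Inl y := Inr k)))
     | Tau \<Rightarrow> Pre Tau (db P k e)
     | Delay l \<Rightarrow> Pre (Delay l) (db P k e)
     | Stoch q \<Rightarrow> Pre (Stoch (e (Inr q))) (db P k e))"
| "db_summ (Plus M N) k e = Plus (db_summ M k e) (db_summ N k e)"

lemma db_cong:
  fixes P :: "('x, 'q, 'k) proc" and M :: "('x, 'q, 'k) summ" and e :: "'x + 'q \<Rightarrow> 'n + nat"
  shows
  "(\<And>n. n \<in> fn P \<Longrightarrow> e n = e' n) \<Longrightarrow> db P k e = db P k e'"
  "(\<And>n. n \<in> fn_summ M \<Longrightarrow> e n = e' n) \<Longrightarrow> db_summ M k e = db_summ M k e'"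
proof (induct P and M arbitrary: k e e' and k e e' rule: proc.induct summ.induct)
  case (Nu b P)
  have "db P (Suc k) (e(bname b := Inr k)) = db P (Suc k) (e'(bname b := Inr k))"
    using Nu(2) by (intro Nu(1)) auto
  then show ?case by simp
next
  case (Pre a P)
  have "a = In x y \<Longrightarrow> db P (Suc k) (e(Inl y := Inr k)) = db P (Suc k) (e'(Inl y := Inr k))" for x y
    using Pre(2) by (intro Pre(1)) auto
  moreover have "(\<And>x y. a \<noteq> In x y) \<Longrightarrow> db P k e = db P k e'"
    using Pre(2) by (intro Pre(1)) (cases a; auto)
  ultimately show ?case using Pre(2) by (cases a) auto
next
  case (Par P Q)
  have "db P k e = db P k e'" "db Q k e = db Q k e'" using Par(3) by (auto intro!: Par(1,2))
  then show ?case by simp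
next
  case (Plus P Q)
  have "db_summ P k e = db_summ P k e'" "db_summ Q k e = db_summ Q k e'"
    using Plus(3) by (auto intro!: Plus(1,2))
  then show ?case by simp
next
  case (Sum M)
  have "db_summ M k e = db_summ M k e'" by (rule Sum(1)) (use Sum(2) in simp)
  then show ?case by simp
qed simp_all

lemma fun_upd_comp_inj: "inj h \<Longrightarrow> (e(h n := v)) \<circ> h = (e \<circ> h)(n := v)"
  by (auto simp: fun_eq_iff dest: injD)

lemma dbb_perm [simp]: "dbb k (map_nu_binder f g b) = dbb k b"
  by (cases b) auto

lemma dbb_like: "dbb k b = dbb k c \<longleftrightarrow> like b c"
  by (cases b; cases c) auto

text \<open>Bound names of the permuted term are overwritten in the environment by their levels.
  Injectivity makes updating commute with composing, so only the free names feel the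
  permutation.\<close>

lemma db_perm:
  fixes P :: "('x, 'q, 'k) proc" and M :: "('x, 'q, 'k) summ" and e :: "'x + 'q \<Rightarrow> 'n + nat"
  assumes f: "inj f" and g: "inj g"
  shows "db (perm f g P) k e = db P k (e \<circ> map_sum f g)"
    "db_summ (perm_summ f g M) k e = db_summ M k (e \<circ> map_sum f g)"
proof (induct P and M arbitrary: k e and k e rule: proc.induct summ.induct)
  case (Nu b P)
  have "db (perm f g P) (Suc k) (e(map_sum f g (bname b) := Inr k)) =
      db P (Suc k) ((e \<circ> map_sum f g)(bname b := Inr k))"
    unfolding Nu by (simp only: fun_upd_comp_inj inj_map_sum[OF f g])
  then show ?case by (simp only: perm_simps db.simps bname_perm dbb_perm)
next
  case (Pre a P)
  have *: "e(Inl (f y) := v) \<circ> map_sum f g = (e \<circ> map_sum f g)(Inl y := v)" for e and y and v :: "'n + nat"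
    using fun_upd_comp_inj[OF inj_map_sum[OF f g], of e "Inl y" v] by simp
  have **: "(e \<circ> map_sum f g) (Inl y) = e (Inl (f y))" "(e \<circ> map_sum f g) (Inr q) = e (Inr (g q))" for y q
    by simp_all
  show ?case
    by (cases a) (simp_all only: perm_simps prefix.map db_summ.simps prefix.case Pre * **)
qed auto

lemma avoid_notin: "finite S \<Longrightarrow> avoid (x :: 'x :: infinite) S \<notin> S"
  unfolding avoid_def using someI_ex[OF fresh_chan[of S]] by auto

lemma new_bound_notin:
  fixes x :: "'x :: infinite"
  assumes "Inl y \<in> fn P" "y \<noteq> x" shows "new_bound s x P \<noteq> s y"
proof -
  have "{y. Inl y \<in> fn P \<and> y \<noteq> x} \<subseteq> Inl -` fn P" by auto
  then have "finite {y. Inl y \<in> fn P \<and> y \<noteq> x}"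
    by (rule finite_subset) (simp add: finite_vimageI)
  then have "new_bound s x P \<notin> s ` {y. Inl y \<in> fn P \<and> y \<noteq> x}"
    unfolding new_bound_def by (intro avoid_notin) simp
  with assms show ?thesis by blast
qed

text \<open>The choice made by \<open>new_bound\<close> cannot be seen in the image: the new bound
  name gets the level of the old one, and as it differs from the images of the other free names it
  overwrites none of them.\<close>

lemma db_subst:
  fixes P :: "('x :: infinite, 'q, 'k) proc" and M :: "('x, 'q, 'k) summ"
  shows "db (subst s P) k e = db P k (e \<circ> map_sum s id)"
    "db_summ (subst_summ s M) k e = db_summ M k (e \<circ> map_sum s id)"
proof (induct P and M arbitrary: s k e and s k e rule: proc.induct summ.induct)
  case (Nu b P)
  show ?case
  proof (cases b)
    case (BChan x)
    let ?z = "new_bound s x P"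
    have "db P (Suc k) (e(Inl ?z := Inr k) \<circ> map_sum (s(x := ?z)) id) =
        db P (Suc k) ((e \<circ> map_sum s id)(Inl x := Inr k))"
    proof (rule db_cong)
      fix n assume "n \<in> fn P"
      then show "(e(Inl ?z := Inr k) \<circ> map_sum (s(x := ?z)) id) n =
          ((e \<circ> map_sum s id)(Inl x := Inr k)) n"
        using new_bound_notin[of _ P x s] by (cases n) (auto, metis)
    qed
    then show ?thesis
      by (simp only: BChan subst.simps Let_def nu_binder.case db.simps Nu dbb.simps bname.simps)
  next
    case (BStoch q l)
    have "(e(Inr q := Inr k)) \<circ> map_sum s id = (e \<circ> map_sum s id)(Inr q := Inr k)"
      by (auto simp: fun_eq_iff split: sum.split) (metis map_sum.simps sum.exhaust sum.inject(2) id_apply sum.distinct(1))+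
    then show ?thesis
      by (simp only: BStoch subst.simps nu_binder.case db.simps Nu dbb.simps bname.simps)
  qed
next
  case (Pre a P)
  show ?case
  proof (cases a)
    case (In u x)
    let ?z = "new_bound s x P"
    have "db P (Suc k) (e(Inl ?z := Inr k) \<circ> map_sum (s(x := ?z)) id) =
        db P (Suc k) ((e \<circ> map_sum s id)(Inl x := Inr k))"
    proof (rule db_cong)
      fix n assume "n \<in> fn P"
      then show "(e(Inl ?z := Inr k) \<circ> map_sum (s(x := ?z)) id) n =
          ((e \<circ> map_sum s id)(Inl x := Inr k)) n"
        using new_bound_notin[of _ P x s] by (cases n) (auto, metis)
    qed
    moreover have "(e \<circ> map_sum s id) (Inl u) = e (Inl (s u))" by simp
    ultimately show ?thesis
      by (simp only: In subst_summ.simps Let_def prefix.case db_summ.simps Pre)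
  qed (simp_all add: Pre)
qed auto

lemma map_sum_transpose:
  "map_sum (transpose x y) id = transpose (Inl x) (Inl y)"
  "map_sum id (transpose q r) = transpose (Inr q) (Inr r)"
  by (auto simp: fun_eq_iff transpose_def map_sum_def split: sum.split)

lemma ren_perm:
  assumes "like b c"
  obtains f g where "bij f" "bij g" "map_sum f g = transpose (bname b) (bname c)"
    "\<And>P :: ('x, 'q, 'k) proc. ren b c P = perm f g P"
proof (cases b)
  case (BChan x)
  with assms obtain y where "c = BChan y" by (cases c) auto
  with BChan show ?thesis using that[of "transpose x y" id] by (simp add: map_sum_transpose)
next
  case (BStoch q l)
  with assms obtain r where "c = BStoch r l" by (cases c) auto
  with BStoch show ?thesis using that[of id "transpose q r"] by (simp add: map_sum_transpose)
qed

lemma db_ren: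
  fixes P :: "('x, 'q, 'k) proc"
  shows "like b c \<Longrightarrow> db (ren b c P) k e = db P k (e \<circ> transpose (bname b) (bname c))"
  by (erule ren_perm[where 'x = 'x and 'q = 'q and 'k = 'k]) (simp add: db_perm bij_is_inj)

lemma fn_ren:
  fixes P :: "('x, 'q, 'k) proc"
  shows "like b c \<Longrightarrow> fn (ren b c P) = transpose (bname b) (bname c) ` fn P"
  by (erule ren_perm[where 'x = 'x and 'q = 'q and 'k = 'k]) (simp add: fn_perm bij_is_inj)

lemma fn_ren_subset:
  "like b c \<Longrightarrow> bname c \<notin> fn (Nu b P) \<Longrightarrow> fn (ren b c P) \<subseteq> insert (bname c) (fn P - {bname b})"
  by (auto simp: fn_ren transpose_def)

lemma db_open:
  "like b c \<Longrightarrow> bname c \<notin> fn (Nu b P) \<Longrightarrow>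
    db (ren b c P) k (e(bname c := v)) = db P k (e(bname b := v))"
  by (auto simp: db_ren transpose_def intro!: db_cong)

lemma alpha_law_ren: "like b c \<Longrightarrow> bname c \<notin> fn P \<Longrightarrow> alpha_law (Nu b P) (Nu c (ren b c P))"
  by (cases b; cases c) (auto simp: perm_def intro: alpha_law.intros)

lemma ren_same [simp]: "ren b b P = P"
  by (cases b) auto

lemma alpha_ren:
  assumes "like b c" "bname c \<notin> fn (Nu b P)" shows "alpha (Nu b P) (Nu c (ren b c P))"
proof (cases "bname c = bname b")
  case True
  then have "c = b" using assms like_bname_eq by metis
  then show ?thesis by (simp add: congr_refl)
next
  case False
  then show ?thesis using assms by (intro congr_base alpha_law_ren) auto
qed

lemma alpha_ren_In:
  assumes "Inl z \<notin> fn P - {Inl y}"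
  shows "alpha (Sum (Pre (In x y) P)) (Sum (Pre (In x z) (ren (BChan y) (BChan z) P)))"
proof (cases "y = z")
  case True
  then show ?thesis by (simp add: congr_refl)
next
  case False
  then show ?thesis using assms by (auto simp: perm_def intro!: congr_base alpha_law.intros)
qed

lemma alpha_db:
  fixes e :: "'x + 'q \<Rightarrow> 'n + nat" and P :: "('x, 'q, 'k) proc"
  assumes "alpha P Q" shows "db P k e = db Q k e"
  using assms
proof (induct arbitrary: k e)
  case (congr_base P Q)
  then show ?case
  proof cases
    case (1 y P x)
    then show ?thesis unfolding perm_def[symmetric] using db_open[of "BChan x" "BChan y" P "Suc k" e] by simp
  next
    case (2 r P q l)
    then show ?thesis unfolding perm_def[symmetric] using db_open[of "BStoch q l" "BStoch r l" P "Suc k" e] by simp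
  next
    case (3 z P x y)
    then show ?thesis unfolding perm_def[symmetric] using db_open[of "BChan y" "BChan z" P "Suc k" e] by simp
  qed
next
  case (congr_pre P P' a)
  then have "db P k e = db P' k e" for k and e :: "'x + 'q \<Rightarrow> 'n + nat" by blast
  then show ?case by (simp only: db.simps db_summ.simps)
qed auto

text \<open>The binder case of the next induction, shared by restriction and input. The two scopes
  may have different bound names, so both are opened with one fresh name \<open>c\<close>; its value
  in the environment is the level \<open>k\<close>, and the induction hypothesis applies at
  \<open>Suc k\<close>.\<close>

lemma db_alpha_open:
  fixes e :: "'x :: infinite + 'q :: infinite \<Rightarrow> 'n + nat" and P Q :: "('x, 'q, 'k) proc"
  assumes IH: "\<And>f g k (e :: 'x + 'q \<Rightarrow> 'n + nat) Q. db (perm f g P) k e = db Q k e \<Longrightarrow> bij f \<Longrightarrow> bij g \<Longrightarrow>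
      inj_on e (fn (perm f g P) \<union> fn Q) \<Longrightarrow>
      (\<forall>n \<in> fn (perm f g P) \<union> fn Q. \<forall>j \<ge> k. e n \<noteq> Inr j) \<Longrightarrow> alpha (perm f g P) Q"
    and eq: "db (perm f g P) (Suc k) (e(bname b := Inr k)) = db Q (Suc k) (e(bname b' := Inr k))"
    and lk: "like b b'" and bij: "bij f" "bij g"
    and inj: "inj_on e (fn (perm f g P) - {bname b} \<union> (fn Q - {bname b'}))"
    and new: "\<And>n j. n \<in> fn (perm f g P) - {bname b} \<union> (fn Q - {bname b'}) \<Longrightarrow> j \<ge> k \<Longrightarrow> e n \<noteq> Inr j"
  shows "\<exists>c. like b c \<and> like b' c \<and> bname c \<notin> fn (perm f g P) \<and> bname c \<notin> fn Q \<and>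
    alpha (ren b c (perm f g P)) (ren b' c Q)"
proof -
  let ?P = "perm f g P" and ?F = "fn (perm f g P) - {bname b} \<union> (fn Q - {bname b'})"
  obtain c where c: "like b c" "bname c \<notin> fn ?P \<union> fn Q \<union> {bname b, bname b'}"
    using fresh_like[of "fn ?P \<union> fn Q \<union> {bname b, bname b'}" b] by auto
  have c': "like b' c" using lk c(1) like_sym like_trans by blast
  obtain f1 g1 where fg: "bij f1" "bij g1" "\<And>P :: ('x, 'q, 'k) proc. ren b c P = perm f1 g1 P"
    using ren_perm[OF c(1)] by metis
  have R: "ren b c ?P = perm (f1 \<circ> f) (g1 \<circ> g) P" by (simp add: fg(3) perm_comp)
  have sub: "fn (ren b c ?P) \<subseteq> insert (bname c) (fn ?P - {bname b})"
    "fn (ren b' c Q) \<subseteq> insert (bname c) (fn Q - {bname b'})"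
    by (rule fn_ren_subset[OF c(1)], use c in simp, rule fn_ren_subset[OF c'], use c in simp)
  have "alpha (ren b c ?P) (ren b' c Q)" unfolding R
  proof (rule IH)
    show "db (perm (f1 \<circ> f) (g1 \<circ> g) P) (Suc k) (e(bname c := Inr k)) =
      db (ren b' c Q) (Suc k) (e(bname c := Inr k))"
      using eq c c' unfolding R[symmetric] by (simp add: db_open)
    show "bij (f1 \<circ> f)" "bij (g1 \<circ> g)" using fg bij by (auto intro: bij_comp)
    have "bname c \<notin> ?F" using c by simp
    have "inj_on (e(bname c := Inr k)) (insert (bname c) ?F)"
    proof (rule inj_onI)
      fix n m assume "n \<in> insert (bname c) ?F" "m \<in> insert (bname c) ?F"
        "(e(bname c := Inr k)) n = (e(bname c := Inr k)) m"
      then show "n = m" using new[of n k] new[of m k] inj_onD[OF inj, of n m]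
        by (auto split: if_splits)
    qed
    then show "inj_on (e(bname c := Inr k)) (fn (perm (f1 \<circ> f) (g1 \<circ> g) P) \<union> fn (ren b' c Q))"
      unfolding R[symmetric] by (rule inj_on_subset) (use sub in blast)
    show "\<forall>n\<in>fn (perm (f1 \<circ> f) (g1 \<circ> g) P) \<union> fn (ren b' c Q). \<forall>j\<ge>Suc k. (e(bname c := Inr k)) n \<noteq> Inr j"
      unfolding R[symmetric]
    proof (intro ballI allI impI)
      fix n j assume n: "n \<in> fn (ren b c ?P) \<union> fn (ren b' c Q)" and "Suc k \<le> j"
      then show "(e(bname c := Inr k)) n \<noteq> Inr j"
        using sub new[of n j] by (cases "n = bname c") auto
    qed
  qed
  with c c' show ?thesis by auto
qed

text \<open>The induction is on \<open>P\<close> but speaks about \<open>perm f g P\<close>, because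
  opening a binder turns its scope into a permuted subterm. Injectivity of the environment, and its
  avoiding all levels from \<open>k\<close> on, ensure that equal values come from equal
  names.\<close>

lemma db_alpha_perm:
  fixes e :: "'x :: infinite + 'q :: infinite \<Rightarrow> 'n + nat"
    and P :: "('x, 'q, 'k) proc" and M :: "('x, 'q, 'k) summ"
  shows "db (perm f g P) k e = db Q k e \<Longrightarrow> bij f \<Longrightarrow> bij g \<Longrightarrow>
      inj_on e (fn (perm f g P) \<union> fn Q) \<Longrightarrow>
      (\<forall>n \<in> fn (perm f g P) \<union> fn Q. \<forall>j \<ge> k. e n \<noteq> Inr j) \<Longrightarrow> alpha (perm f g P) Q"
    and "db_summ (perm_summ f g M) k e = db_summ N k e \<Longrightarrow> bij f \<Longrightarrow> bij g \<Longrightarrow>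
      inj_on e (fn_summ (perm_summ f g M) \<union> fn_summ N) \<Longrightarrow>
      (\<forall>n \<in> fn_summ (perm_summ f g M) \<union> fn_summ N. \<forall>j \<ge> k. e n \<noteq> Inr j) \<Longrightarrow>
      alpha (Sum (perm_summ f g M)) (Sum N)"
proof (induct P and M arbitrary: f g k e Q and f g k e N rule: proc.induct summ.induct)
  case (Sum M)
  obtain N where "Q = Sum N" using Sum(2) by (cases Q) auto
  with Sum show ?case by simp
next
  case (Par P1 P2)
  obtain Q1 Q2 where Q: "Q = Par Q1 Q2" using Par(3) by (cases Q) auto
  have "alpha (perm f g P1) Q1" "alpha (perm f g P2) Q2"
    using Par(3-) unfolding Q by (auto intro!: Par(1,2) elim: inj_on_subset)
  then show ?case unfolding Q by (auto intro: congr_par)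
next
  case (Nu b P)
  obtain b' Q' where Q: "Q = Nu b' Q'" using Nu(2) by (cases Q) auto
  let ?b = "map_nu_binder f g b" and ?P = "perm f g P"
  have "(dbb k ?b :: ('n + nat, 'n + nat) nu_binder) = dbb k b'" using Nu(2) Q by simp
  then have lk: "like ?b b'" by (simp only: dbb_like)
  have "\<exists>c. like ?b c \<and> like b' c \<and> bname c \<notin> fn ?P \<and> bname c \<notin> fn Q' \<and> alpha (ren ?b c ?P) (ren b' c Q')"
    using Nu(2-) lk unfolding Q by (intro db_alpha_open[where e = e and k = k, OF Nu(1)]) simp_all
  then obtain c where c: "like ?b c" "like b' c" "bname c \<notin> fn ?P" "bname c \<notin> fn Q'"
    and "alpha (ren ?b c ?P) (ren b' c Q')" by blast
  then have "alpha (Nu c (ren ?b c ?P)) (Nu c (ren b' c Q'))" by (intro congr_nu)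
  moreover have "alpha (Nu ?b ?P) (Nu c (ren ?b c ?P))" "alpha (Nu b' Q') (Nu c (ren b' c Q'))"
    using c by (auto intro!: alpha_ren)
  ultimately show ?case unfolding Q by (auto intro: congr_trans congr_sym)
next
  case (Const A ys)
  then obtain zs where Q: "Q = Const A zs" by (cases Q) auto
  have "map (e \<circ> Inl) (map f ys) = map (e \<circ> Inl) zs" using Const(1) Q by simp
  moreover have "inj_on (e \<circ> Inl) (set (map f ys) \<union> set zs)"
    using Const(4) Q by (intro comp_inj_on) (auto simp: image_Un image_image)
  ultimately have "map f ys = zs" using map_inj_on by metis
  then show ?case using Q by (simp add: congr_refl)
next
  case Zero
  then show ?case by (cases N) (auto simp: congr_refl split: prefix.splits)
next
  case (Pre a P)
  obtain a' P' where N: "N = Pre a' P'" using Pre(2) by (cases N) (auto split: prefix.splits)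
  let ?P = "perm f g P"
  show ?case
  proof (cases a)
    case (In x y)
    then obtain x' y' where a': "a' = In x' y'" using Pre(2) N by (auto split: prefix.splits)
    have "e (Inl (f x)) = e (Inl x')" using Pre(2) In N a' by simp
    then have "(Inl (f x) :: 'x + 'q) = Inl x'"
      by (rule inj_onD[OF Pre(5)]) (simp_all add: In N a')
    then have x': "x' = f x" by simp
    have "\<exists>c. like (BChan (f y)) c \<and> like (BChan y') c \<and> bname c \<notin> fn ?P \<and> bname c \<notin> fn P' \<and>
        alpha (ren (BChan (f y)) c ?P) (ren (BChan y') c P')"
      using Pre(2-) unfolding N In a'
      by (intro db_alpha_open[where e = e and k = k, OF Pre(1)]) (auto elim: inj_on_subset)
    then obtain c where c: "like (BChan (f y)) c" "like (BChan y') c" "bname c \<notin> fn ?P" "bname c \<notin> fn P'"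
      and al: "alpha (ren (BChan (f y)) c ?P) (ren (BChan y') c P')" by blast
    from c(1) obtain z where z: "c = BChan z" by (cases c) auto
    have "alpha (Sum (Pre (In (f x) (f y)) ?P)) (Sum (Pre (In (f x) z) (ren (BChan (f y)) c ?P)))"
      "alpha (Sum (Pre (In (f x) y') P')) (Sum (Pre (In (f x) z) (ren (BChan y') c P')))"
      unfolding z using c z by (simp_all del: ren.simps add: alpha_ren_In)
    moreover have "alpha (Sum (Pre (In (f x) z) (ren (BChan (f y)) c ?P)))
        (Sum (Pre (In (f x) z) (ren (BChan y') c P')))"
      using al by (rule congr_pre)
    ultimately show ?thesis unfolding N In a' x' by (auto intro: congr_trans congr_sym)
  next
    case (Out x y)
    then obtain x' y' where a': "a' = Out x' y'" using Pre(2) N by (auto split: prefix.splits)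
    have "e (Inl (f x)) = e (Inl x')" "e (Inl (f y)) = e (Inl y')" using Pre(2) Out N a' by simp_all
    then have "(Inl (f x) :: 'x + 'q) = Inl x' \<and> (Inl (f y) :: 'x + 'q) = Inl y'"
      by (intro conjI inj_onD[OF Pre(5)]; simp add: Out N a')
    then have "x' = f x" "y' = f y" by simp_all
    moreover have "alpha ?P P'"
      by (rule Pre(1)[OF _ Pre(3,4) inj_on_subset[OF Pre(5)]])
        (use Pre(2,6) in \<open>auto simp: N Out a'\<close>)
    ultimately show ?thesis unfolding N Out a' by (auto intro: congr_pre)
  next
    case (Stoch q)
    then obtain q' where a': "a' = Stoch q'" using Pre(2) N by (auto split: prefix.splits)
    have "e (Inr (g q)) = e (Inr q')" using Pre(2) Stoch N a' by simp_all
    then have "(Inr (g q) :: 'x + 'q) = Inr q'"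
      by (intro inj_onD[OF Pre(5)]; simp add: Stoch N a')
    then have "q' = g q" by simp
    moreover have "alpha ?P P'"
      by (rule Pre(1)[OF _ Pre(3,4) inj_on_subset[OF Pre(5)]])
        (use Pre(2,6) in \<open>auto simp: N Stoch a'\<close>)
    ultimately show ?thesis unfolding N Stoch a' by (auto intro: congr_pre)
  next
    case Tau
    then have a': "a' = Tau" using Pre(2) N by (auto split: prefix.splits)
    have "alpha ?P P'"
      by (rule Pre(1)[OF _ Pre(3,4) inj_on_subset[OF Pre(5)]])
        (use Pre(2,6) in \<open>auto simp: N Tau a'\<close>)
    then show ?thesis unfolding N Tau a' by (auto intro: congr_pre)
  next
    case (Delay l)
    then have a': "a' = Delay l" using Pre(2) N by (auto split: prefix.splits)
    have "alpha ?P P'"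
      by (rule Pre(1)[OF _ Pre(3,4) inj_on_subset[OF Pre(5)]])
        (use Pre(2,6) in \<open>auto simp: N Delay a'\<close>)
    then show ?thesis unfolding N Delay a' by (auto intro: congr_pre)
  qed
next
  case (Plus M1 M2)
  obtain N1 N2 where N: "N = Plus N1 N2" using Plus(3) by (cases N) (auto split: prefix.splits)
  have "alpha (Sum (perm_summ f g M1)) (Sum N1)" "alpha (Sum (perm_summ f g M2)) (Sum N2)"
    using Plus(3-) unfolding N by (auto intro!: Plus(1,2) elim: inj_on_subset)
  then show ?case unfolding N by (auto intro: congr_plus)
qed

text \<open>The environment \<open>Inl\<close> is injective and takes no level as a value, so images
  are faithful. Alpha-equivalences can now be proved by comparing environments on the free names,
  with \<open>db_cong\<close>.\<close>

lemma alpha_iff_db: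
  fixes P :: "('x :: infinite, 'q :: infinite, 'k) proc"
  shows "alpha P Q \<longleftrightarrow> db P 0 (Inl :: 'x + 'q \<Rightarrow> ('x + 'q) + nat) = db Q 0 Inl"
  using db_alpha_perm(1)[of id id P 0 "Inl :: 'x + 'q \<Rightarrow> ('x + 'q) + nat" Q] alpha_db by auto

section \<open>Alpha-equivalence under renaming and substitution\<close>

lemma alpha_fn: "alpha P Q \<Longrightarrow> fn P = fn Q"
proof (induct rule: congr.induct)
  case (congr_base P Q)
  have *: "transpose n m ` A - {m} = A - {n}" if "m \<notin> A" for n m :: "'a + 'b" and A
    using that by (auto simp: transpose_def image_iff)
  from congr_base show ?case
  proof cases
    case (1 y P x)
    then show ?thesis using fn_ren[of "BChan x" "BChan y" P] * by (simp add: perm_def[symmetric])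
  next
    case (2 r P q l)
    then show ?thesis using fn_ren[of "BStoch q l" "BStoch r l" P] * by (simp add: perm_def[symmetric])
  next
    case (3 z P x y)
    then show ?thesis using fn_ren[of "BChan y" "BChan z" P] * by (simp add: perm_def[symmetric])
  qed
next
  case (congr_pre P P' a)
  then show ?case by (cases a) auto
qed auto

lemma alpha_perm:
  fixes P :: "('x :: infinite, 'q :: infinite, 'k) proc"
  assumes "alpha P Q" "bij f" "bij g" shows "alpha (perm f g P) (perm f g Q)"
  using assms by (simp add: alpha_iff_db db_perm bij_is_inj alpha_db[OF assms(1)])

lemma alpha_perm_cong:
  fixes P :: "('x :: infinite, 'q :: infinite, 'k) proc"
  assumes "bij f" "bij g" "bij f'" "bij g'" "\<And>n. n \<in> fn P \<Longrightarrow> map_sum f g n = map_sum f' g' n"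
  shows "alpha (perm f g P) (perm f' g' P)"
  using assms by (auto simp add: alpha_iff_db db_perm bij_is_inj intro!: db_cong)

lemma alpha_perm_fresh:
  fixes P :: "('x :: infinite, 'q :: infinite, 'k) proc"
  assumes "bij f" "bij g" "\<And>n. n \<in> fn P \<Longrightarrow> map_sum f g n = n"
  shows "alpha (perm f g P) P"
  using alpha_perm_cong[of f g id id P] assms by (simp add: sum.map_id)

lemma alpha_ren_fresh:
  fixes P :: "('x :: infinite, 'q :: infinite, 'k) proc"
  assumes "like b c" "bname b \<notin> fn P" "bname c \<notin> fn P"
  shows "alpha (ren b c P) P"
proof -
  obtain f g where "bij f" "bij g" "map_sum f g = transpose (bname b) (bname c)"
    "\<And>P :: ('x, 'q, 'k) proc. ren b c P = perm f g P"
    by (rule ren_perm[OF assms(1)]) blast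
  with assms show ?thesis by (auto simp: transpose_def intro!: alpha_perm_fresh)
qed

lemma alpha_ren_cong:
  fixes P :: "('x :: infinite, 'q :: infinite, 'k) proc"
  assumes "alpha P Q" "like b c" shows "alpha (ren b c P) (ren b c Q)"
proof -
  obtain f g where "bij f" "bij g" "\<And>P :: ('x, 'q, 'k) proc. ren b c P = perm f g P"
    by (rule ren_perm[OF assms(2)]) blast
  with assms show ?thesis by (auto intro!: alpha_perm)
qed

lemma ren_ren:
  fixes P :: "('c, 'd, 'k) proc"
  shows "like b c \<Longrightarrow> ren b c (ren b c P) = P" "like b c \<Longrightarrow> ren c b (ren b c P) = P"
proof -
  have *: "transpose y x \<circ> transpose x y = id" "transpose x y \<circ> transpose x y = id" for x y :: 'c
    by (simp_all add: fun_eq_iff transpose_def)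
  have **: "transpose y x \<circ> transpose x y = id" "transpose x y \<circ> transpose x y = id" for x y :: 'd
    by (simp_all add: fun_eq_iff transpose_def)
  show "like b c \<Longrightarrow> ren b c (ren b c P) = P" "like b c \<Longrightarrow> ren c b (ren b c P) = P"
    by (cases b; cases c; simp add: perm_comp * **)+
qed

lemma alpha_subst:
  fixes P :: "('x :: infinite, 'q :: infinite, 'k) proc"
  assumes "alpha P Q" shows "alpha (subst s P) (subst s Q)"
  by (simp add: alpha_iff_db db_subst alpha_db[OF assms])

lemma alpha_subst_cong:
  fixes P :: "('x :: infinite, 'q :: infinite, 'k) proc"
  assumes "\<And>x. Inl x \<in> fn P \<Longrightarrow> s x = t x" shows "alpha (subst s P) (subst t P)"
  unfolding alpha_iff_db db_subst
proof (rule db_cong)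
  fix n assume "n \<in> fn P"
  then show "(Inl \<circ> map_sum s id) n = (Inl \<circ> map_sum t id) n" using assms by (cases n) auto
qed

lemma alpha_subst_id:
  fixes P :: "('x :: infinite, 'q :: infinite, 'k) proc"
  assumes "\<And>x. Inl x \<in> fn P \<Longrightarrow> s x = x" shows "alpha (subst s P) P"
proof -
  have "db (subst s P) 0 (Inl :: 'x + 'q \<Rightarrow> ('x + 'q) + nat) = db P 0 Inl" unfolding db_subst
  proof (rule db_cong)
    fix n assume "n \<in> fn P"
    then show "(Inl \<circ> map_sum s id) n = Inl n" using assms by (cases n) auto
  qed
  then show ?thesis by (simp add: alpha_iff_db)
qed

lemma alpha_perm_subst:
  fixes P :: "('x :: infinite, 'q :: infinite, 'k) proc"
  assumes "bij f" "bij g" "\<And>x. Inl x \<in> fn P \<Longrightarrow> t (f x) = f (s x)"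
  shows "alpha (perm f g (subst s P)) (subst t (perm f g P))"
proof -
  have "db (perm f g (subst s P)) 0 (Inl :: 'x + 'q \<Rightarrow> ('x + 'q) + nat) = db (subst t (perm f g P)) 0 Inl"
    unfolding db_subst db_perm(1)[OF bij_is_inj[OF assms(1)] bij_is_inj[OF assms(2)]]
  proof (rule db_cong)
    fix n assume "n \<in> fn P"
    then show "(Inl \<circ> map_sum f g \<circ> map_sum s id) n = (Inl \<circ> map_sum t id \<circ> map_sum f g) n"
      using assms(3) by (cases n) auto
  qed
  then show ?thesis by (simp add: alpha_iff_db)
qed

lemma fn_subst:
  fixes P :: "('x :: infinite, 'q, 'k) proc" and M :: "('x, 'q, 'k) summ"
  shows "fn (subst s P) = map_sum s id ` fn P" "fn_summ (subst_summ s M) = map_sum s id ` fn_summ M"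
proof -
  have aux: "map_sum (s(x := new_bound s x P)) id ` fn P - {Inl (new_bound s x P)} = map_sum s id ` (fn P - {Inl x})"
    for x s and P :: "('x, 'q, 'k) proc"
  proof -
    let ?z = "new_bound s x P"
    have *: "map_sum (s(x := ?z)) id n = map_sum s id n \<and> map_sum s id n \<noteq> Inl ?z"
      if "n \<in> fn P - {Inl x}" for n
      using that new_bound_notin[of _ P x s] by (cases n) (auto, metis)
    have "map_sum (s(x := ?z)) id ` fn P - {Inl ?z} = map_sum (s(x := ?z)) id ` (fn P - {Inl x}) - {Inl ?z}"
      by auto
    also have "map_sum (s(x := ?z)) id ` (fn P - {Inl x}) = map_sum s id ` (fn P - {Inl x})"
      by (rule image_cong) (use * in auto)
    finally have "map_sum (s(x := ?z)) id ` fn P - {Inl ?z} = map_sum s id ` (fn P - {Inl x}) - {Inl ?z}" .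
    moreover have "Inl ?z \<notin> map_sum s id ` (fn P - {Inl x})" using * by (metis imageE)
    ultimately show ?thesis by simp
  qed
  have aux2: "map_sum s id ` A - {Inr q} = map_sum s id ` (A - {Inr q})" for q :: 'q and s :: "'x \<Rightarrow> 'x" and A
    by (auto simp: image_iff) (metis map_sum.simps sum.exhaust sum.distinct(1) sum.inject(2) id_apply DiffI singletonD)+
  show "fn (subst s P) = map_sum s id ` fn P" "fn_summ (subst_summ s M) = map_sum s id ` fn_summ M"
  proof (induct P and M arbitrary: s and s rule: proc.induct summ.induct)
    case (Nu b P)
    show ?case
      by (cases b) (simp_all only: subst.simps nu_binder.case fn.simps bname.simps Nu aux aux2 Let_def)
  next
    case (Pre a P)
    show ?case
      by (cases a; simp only: subst_summ.simps prefix.case fn_summ.simps Pre aux Let_def image_Un; simp)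
  qed (auto simp: image_Un image_image)
qed

section \<open>Inversion of alpha-equivalence\<close>

lemma alpha_NuI:
  fixes P :: "('x :: infinite, 'q :: infinite, 'k) proc"
  assumes "like b c" "bname c \<notin> fn (Nu b P)" "alpha (ren b c P) Q"
  shows "alpha (Nu b P) (Nu c Q)"
  using alpha_ren[OF assms(1,2)] congr_nu[OF assms(3)] congr_trans by metis

text \<open>Rule inversion would have to look through transitivity and symmetry; instead the shape
  of \<open>Q\<close> and the relation between the scopes are read off from the equal
  images.\<close>

lemma alpha_Nu_inv:
  fixes P :: "('x :: infinite, 'q :: infinite, 'k) proc"
  assumes "alpha (Nu b P) Q"
  obtains c Q' where "Q = Nu c Q'" "like b c" "bname c \<notin> fn (Nu b P)" "alpha (ren b c P) Q'"
proof -
  let ?e = "Inl :: 'x + 'q \<Rightarrow> ('x + 'q) + nat"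
  have eq: "db (Nu b P) 0 ?e = db Q 0 ?e" by (rule alpha_db[OF assms])
  then obtain c Q' where Q: "Q = Nu c Q'" by (cases Q) auto
  have "(dbb 0 b :: (('x + 'q) + nat, ('x + 'q) + nat) nu_binder) = dbb 0 c" using eq Q by simp
  then have lk: "like b c" by (simp only: dbb_like)
  have c: "bname c \<notin> fn (Nu b P)" using alpha_fn[OF assms] Q by simp
  \<comment> \<open>This environment is still injective, since \<open>Inr 0\<close> is no value of
    \<open>Inl\<close>, and it takes no level from \<open>Suc 0\<close> on.\<close>
  let ?e' = "?e(bname c := Inr 0)"
  obtain f g where fg: "bij f" "bij g" "\<And>P :: ('x, 'q, 'k) proc. ren b c P = perm f g P"
    by (rule ren_perm[OF lk]) blast
  have "db (ren b c P) (Suc 0) ?e' = db Q' (Suc 0) ?e'"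
    unfolding db_open[OF lk c] using eq Q by simp
  then have "alpha (ren b c P) Q'" unfolding fg(3)
    by (rule db_alpha_perm(1)) (use fg in \<open>auto simp: inj_on_def split: if_splits\<close>)
  with Q lk c show ?thesis using that by blast
qed

lemma alpha_Par_inv:
  fixes P :: "('x :: infinite, 'q :: infinite, 'k) proc"
  assumes "alpha (Par P Q) R"
  obtains P' Q' where "R = Par P' Q'" "alpha P P'" "alpha Q Q'"
proof -
  let ?e = "Inl :: 'x + 'q \<Rightarrow> ('x + 'q) + nat"
  have eq: "db (Par P Q) 0 ?e = db R 0 ?e" by (rule alpha_db[OF assms])
  then obtain P' Q' where R: "R = Par P' Q'" by (cases R) auto
  then show ?thesis using that eq by (simp add: alpha_iff_db)
qed

lemma alpha_Const_inv:
  fixes R :: "('x :: infinite, 'q :: infinite, 'k) proc"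
  assumes "alpha (Const A ys) R" shows "R = Const A ys"
proof -
  let ?e = "Inl :: 'x + 'q \<Rightarrow> ('x + 'q) + nat"
  have eq: "db (Const A ys) 0 ?e = db R 0 ?e" by (rule alpha_db[OF assms])
  then obtain zs where "R = Const A zs" by (cases R) auto
  then show ?thesis using eq inj_map_eq_map[of "?e \<circ> Inl" zs ys] by (auto simp: inj_def)
qed

lemma alpha_Sum_inv:
  fixes R :: "('x :: infinite, 'q :: infinite, 'k) proc"
  assumes "alpha (Sum M) R" obtains N where "R = Sum N"
  using alpha_db[OF assms, of 0 "Inl :: 'x + 'q \<Rightarrow> ('x + 'q) + nat"] that by (cases R) auto

section \<open>Substitution and structural congruence\<close>

lemma proc_stochs_subst [simp]:
  fixes P :: "('x, 'q, 'k) proc" and M :: "('x, 'q, 'k) summ"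
  shows "proc_stochs (subst s P) = proc_stochs P" "summ_stochs (subst_summ s M) = summ_stochs M"
proof (induct P and M arbitrary: s and s rule: proc.induct summ.induct)
  case (Nu b P)
  then show ?case by (cases b) (simp_all add: Let_def)
next
  case (Pre a P)
  then show ?case by (cases a) (simp_all add: Let_def)
qed auto

lemma alpha_subst_BChan:
  fixes P :: "('x :: infinite, 'q :: infinite, 'k) proc"
  assumes "Inl z \<notin> map_sum s id ` (fn P - {Inl x})"
  shows "alpha (subst s (Nu (BChan x) P)) (Nu (BChan z) (subst (s(x := z)) P))"
proof -
  have "db P (Suc 0) ((Inl \<circ> map_sum s id)(Inl x := Inr 0)) =
      db P (Suc 0) (Inl(Inl z := Inr 0) \<circ> map_sum (s(x := z)) id)"
  proof (rule db_cong)
    fix n assume "n \<in> fn P"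
    with assms have "n \<noteq> Inl x \<Longrightarrow> map_sum s id n \<noteq> Inl z" by force
    then show "((Inl \<circ> map_sum s id)(Inl x := Inr 0)) n = (Inl(Inl z := Inr 0) \<circ> map_sum (s(x := z)) id) n"
      by (cases n) auto
  qed
  then show ?thesis
    by (simp only: alpha_iff_db db_subst db.simps bname.simps dbb.simps)
qed

lemma alpha_subst_In:
  fixes P :: "('x :: infinite, 'q :: infinite, 'k) proc"
  assumes "Inl z \<notin> map_sum s id ` (fn P - {Inl y})"
  shows "alpha (subst s (Sum (Pre (In x y) P))) (Sum (Pre (In (s x) z) (subst (s(y := z)) P)))"
proof -
  have "db P (Suc 0) ((Inl \<circ> map_sum s id)(Inl y := Inr 0)) =
      db P (Suc 0) (Inl(Inl z := Inr 0) \<circ> map_sum (s(y := z)) id)"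
  proof (rule db_cong)
    fix n assume "n \<in> fn P"
    with assms have "n \<noteq> Inl y \<Longrightarrow> map_sum s id n \<noteq> Inl z" by force
    then show "((Inl \<circ> map_sum s id)(Inl y := Inr 0)) n = (Inl(Inl z := Inr 0) \<circ> map_sum (s(y := z)) id) n"
      by (cases n) auto
  qed
  moreover have "(Inl \<circ> map_sum s (id :: 'q \<Rightarrow> 'q)) (Inl x) = (Inl (Inl (s x)) :: ('x + 'q) + nat)" by simp
  ultimately show ?thesis
    by (simp only: alpha_iff_db db_subst db.simps db_summ.simps prefix.case)
qed

lemma scong_scope: "bname b \<notin> fn Q \<Longrightarrow> scong D (Par (Nu b P) Q) (Nu b (Par P Q))"
  and scong_swap: "bname b \<noteq> bname c \<Longrightarrow> scong D (Nu b (Nu c P)) (Nu c (Nu b P))"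
  and scong_nu_zero: "scong D (Nu b (Sum Zero)) (Sum Zero)"
  and scong_plus_assoc: "scong D (Sum (Plus (Plus M1 M2) M3)) (Sum (Plus M1 (Plus M2 M3)))"
  and scong_plus_comm: "scong D (Sum (Plus M N)) (Sum (Plus N M))"
  and scong_plus_zero: "scong D (Sum (Plus M Zero)) (Sum M)"
  and scong_par_assoc: "scong D (Par (Par P Q) R) (Par P (Par Q R))"
  and scong_par_comm: "scong D (Par P Q) (Par Q P)"
  and scong_par_zero: "scong D (Par P (Sum Zero)) P"
  and scong_unfold: "unfolds D A ys B \<Longrightarrow> scong D (Const A ys) B"
  and scong_delay: "Inr q \<notin> fn_summ M \<union> fn P \<Longrightarrow>
    scong D (Sum (Plus (Pre (Delay l) P) M)) (Nu (BStoch q l) (Sum (Plus (Pre (Stoch q) P) M)))"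
  by (rule congr_base, rule struct_law.intros, assumption?)+

lemma alpha_scong: "alpha P Q \<Longrightarrow> scong D P Q"
  by (induct rule: congr.induct) (auto intro: congr.intros struct_law.intros)

lemma lookup_map:
  assumes "length xs = length ys" "z \<in> set xs"
  shows "(case map_of (zip xs (map f ys)) z of Some w \<Rightarrow> w | None \<Rightarrow> z) =
    f (case map_of (zip xs ys) z of Some w \<Rightarrow> w | None \<Rightarrow> z)"
proof -
  have "map_of (zip xs (map f ys)) = map_option f \<circ> map_of (zip xs ys)"
    by (simp add: zip_map2 map_of_map)
  moreover have "map_of (zip xs ys) z \<noteq> None" using assms by (simp add: map_of_zip_is_None)
  ultimately show ?thesis by auto
qed

lemma lookup_in:
  assumes "length xs = length ys" "z \<in> set xs"
  shows "(case map_of (zip xs ys) z of Some w \<Rightarrow> w | None \<Rightarrow> z) \<in> set ys"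
proof -
  have "map_of (zip xs ys) z \<noteq> None" using assms by (simp add: map_of_zip_is_None)
  then obtain w where "map_of (zip xs ys) z = Some w" by auto
  then show ?thesis using map_of_SomeD set_zip_rightD by fastforce
qed

section \<open>Structural congruence under renaming and substitution\<close>

locale defs =
  fixes D :: "('x :: infinite, 'q :: infinite, 'k) defs"
  assumes wf: "wf_defs D"
begin

lemma unfolds_det: "unfolds D A ys B \<Longrightarrow> unfolds D A ys B' \<Longrightarrow> B = B'"
  by (auto simp: unfolds_def)

lemma unfolds_fn: assumes "unfolds D A ys B" shows "fn B \<subseteq> Inl ` set ys"
proof -
  from assms obtain xs B0 where B: "D A = (xs, B0)" "length xs = length ys" "B = instantiate xs ys B0"
    unfolding unfolds_def by blast
  then have "fn B0 \<subseteq> Inl ` set xs" using wf unfolding wf_defs_def by blast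
  then show ?thesis unfolding B(3) instantiate_def fn_subst using lookup_in[OF B(2)] by fastforce
qed

lemma unfolds_core: "unfolds D A ys B \<Longrightarrow> B \<in> core"
  using wf unfolding unfolds_def instantiate_def wf_defs_def core_def by auto

text \<open>All free names of a body are parameters, so a map on the arguments determines what
  happens to every free name of the unfolded body. \<open>h\<close> stands for a permutation or a
  substitution. The result is an equality of images, that is, agreement up to alpha, since
  instantiation chooses bound names anew.\<close>

lemma unfolds_map:
  assumes "unfolds D A ys B" "\<And>x. x \<in> set ys \<Longrightarrow> h (Inl x) = Inl (f x)"
  shows "\<exists>B'. unfolds D A (map f ys) B' \<and>
     db B' 0 (Inl :: 'x + 'q \<Rightarrow> ('x + 'q) + nat) = db B 0 (Inl \<circ> h)"
proof -
  from assms obtain xs B0 where B: "D A = (xs, B0)" "length xs = length ys" "B = instantiate xs ys B0"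
    unfolding unfolds_def by blast
  then have f: "fn B0 \<subseteq> Inl ` set xs" using wf unfolding wf_defs_def by blast
  have "unfolds D A (map f ys) (instantiate xs (map f ys) B0)" using B unfolding unfolds_def by auto
  moreover have "db (instantiate xs (map f ys) B0) 0 (Inl :: 'x + 'q \<Rightarrow> ('x + 'q) + nat) = db B 0 (Inl \<circ> h)"
    unfolding B(3) instantiate_def db_subst
  proof (rule db_cong, goal_cases)
    case (1 n)
    with f obtain x where x: "n = Inl x" "x \<in> set xs" by auto
    then show ?case using assms(2)[OF lookup_in[OF B(2) x(2)]]
      by (simp add: lookup_map[OF B(2) x(2)])
  qed
  ultimately show ?thesis by blast
qed

lemma unfolds_perm:
  assumes "unfolds D A ys B" "bij f" "bij g"
  shows "\<exists>B'. unfolds D A (map f ys) B' \<and> alpha (perm f g B) B'"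
  using unfolds_map[OF assms(1), of "map_sum f g" f] assms(2,3)
  by (auto simp: alpha_iff_db db_perm bij_is_inj)

lemma unfolds_subst:
  assumes "unfolds D A ys B"
  shows "\<exists>B'. unfolds D A (map s ys) B' \<and> alpha (subst s B) B'"
  using unfolds_map[OF assms(1), of "map_sum s id" s]
  by (auto simp: alpha_iff_db db_subst)

lemma struct_law_perm:
  assumes "struct_law D P Q" "bij f" "bij g" shows "scong D (perm f g P) (perm f g Q)"
  using assms(1)
proof cases
  case 1
  then show ?thesis using alpha_perm[OF congr_base[of alpha_law] assms(2,3)] alpha_scong by blast
next
  case (2 b Q' P')
  have "inj (map_sum f g)" using assms by (simp add: inj_map_sum bij_is_inj)
  with 2(3) have "bname (map_nu_binder f g b) \<notin> fn (perm f g Q')"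
    using assms by (simp add: fn_perm bij_is_inj inj_image_mem_iff)
  with 2 show ?thesis by (simp add: scong_scope)
next
  case (3 b c P')
  have "inj (map_sum f g)" using assms by (simp add: inj_map_sum bij_is_inj)
  with 3(3) have "bname (map_nu_binder f g b) \<noteq> bname (map_nu_binder f g c)"
    by (simp add: inj_eq)
  with 3 show ?thesis by (simp del: bname_perm add: scong_swap)
next
  case (11 A ys)
  then show ?thesis using unfolds_perm[OF 11(2) assms(2,3)]
    by (auto intro: congr_trans congr_base struct_law.intros alpha_scong congr_sym)
next
  case (12 q M P' l)
  have "inj (map_sum f g)" using assms by (simp add: inj_map_sum bij_is_inj)
  then have "Inr (g q) \<notin> map_sum f g ` (fn_summ M \<union> fn P')"
    using 12(3) inj_image_mem_iff[of "map_sum f g" "Inr q"] by simp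
  then have "Inr (g q) \<notin> fn_summ (perm_summ f g M) \<union> fn (perm f g P')"
    using assms by (simp add: fn_perm bij_is_inj image_Un)
  with 12 show ?thesis by (auto intro: congr_base struct_law.intros)
qed (auto intro: congr_base struct_law.intros)

lemma scong_perm:
  assumes "scong D P Q" "bij f" "bij g" shows "scong D (perm f g P) (perm f g Q)"
  using assms(1)
proof (induct)
  case (congr_base P Q)
  then show ?case using struct_law_perm assms by blast
qed (auto intro: congr.intros)

lemma scong_ren: "scong D P Q \<Longrightarrow> like b c \<Longrightarrow> scong D (ren b c P) (ren b c Q)"
  by (erule ren_perm[where ?'k = 'k]) (simp add: scong_perm)

text \<open>The bound name that \<open>subst\<close> chooses depends on the scope. To compare
  substitutions in different scopes, one new binder \<open>c\<close> is found that serves all scopes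
  with free names in \<open>T\<close>. A stochastic binder is kept as it is.\<close>

lemma subst_Nu:
  assumes "finite T"
  obtains c s' where "like b c" "\<And>n. n \<in> T \<Longrightarrow> n \<noteq> bname b \<Longrightarrow> map_sum s id n \<noteq> bname c"
    "\<And>x. Inl x \<noteq> bname b \<Longrightarrow> s' x = s x"
    "\<And>P :: ('x, 'q, 'k) proc. fn P \<subseteq> T \<Longrightarrow> alpha (subst s (Nu b P)) (Nu c (subst s' P))"
    "\<And>n. n \<in> U \<Longrightarrow> finite U \<Longrightarrow> bname b \<notin> U \<Longrightarrow> bname c \<noteq> n"
proof (cases b)
  case (BChan x)
  have "finite (Inl -` (map_sum s id ` T \<union> (if finite U then U else {})))"
    using assms by (simp add: finite_vimageI)
  then obtain z where "z \<notin> Inl -` (map_sum s id ` T \<union> (if finite U then U else {}))" using fresh_chan by blast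
  then have z: "Inl z \<notin> map_sum s id ` T" "finite U \<Longrightarrow> Inl z \<notin> U" by auto
  show ?thesis
  proof (rule that[of "BChan z" "s(x := z)"])
    show "alpha (subst s (Nu b P)) (Nu (BChan z) (subst (s(x := z)) P))"
      if "fn P \<subseteq> T" for P :: "('x, 'q, 'k) proc"
      unfolding BChan by (rule alpha_subst_BChan) (use z that in auto)
  qed (use BChan z in \<open>auto simp: image_iff\<close>)
next
  case (BStoch q l)
  have *: "map_sum s id n \<noteq> Inr q" if "n \<noteq> Inr q" for n :: "'x + 'q" using that by (cases n) auto
  show ?thesis
  proof (rule that[of b s])
    show "map_sum s id n \<noteq> bname b" if "n \<in> T" "n \<noteq> bname b" for n using that * BStoch by auto
  qed (use BStoch in \<open>auto simp: congr_refl\<close>)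
qed

lemma fn_subst_notin:
  assumes "\<And>n. n \<in> fn Q \<Longrightarrow> map_sum s id n \<noteq> m" shows "m \<notin> fn (subst s (Q :: ('x, 'q, 'k) proc))"
  using assms by (auto simp: fn_subst)

lemma struct_law_subst:
  assumes "struct_law D P Q" shows "scong D (subst s P) (subst s Q)"
  using assms
proof cases
  case 1
  then show ?thesis using alpha_subst[OF congr_base[of alpha_law]] alpha_scong by blast
next
  case (2 b Q' P')
  obtain c s' where c: "\<And>n. n \<in> fn P' \<union> fn Q' \<Longrightarrow> n \<noteq> bname b \<Longrightarrow> map_sum s id n \<noteq> bname c"
    and s': "\<And>x. Inl x \<noteq> bname b \<Longrightarrow> s' x = s x"
    and al: "\<And>P :: ('x, 'q, 'k) proc. fn P \<subseteq> fn P' \<union> fn Q' \<Longrightarrow> alpha (subst s (Nu b P)) (Nu c (subst s' P))"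
    by (rule subst_Nu[of "fn P' \<union> fn Q'" b s "{}"]) auto
  have 1: "scong D (subst s P) (Par (Nu c (subst s' P')) (subst s Q'))"
    using al[of P'] 2 by (auto intro: congr_par congr_refl alpha_scong)
  have 2: "scong D (Par (Nu c (subst s' P')) (subst s Q')) (Nu c (Par (subst s' P') (subst s Q')))"
    by (intro congr_base struct_law.intros fn_subst_notin) (use c 2 in auto)
  have "alpha (subst s Q') (subst s' Q')" using 2 s' \<open>bname b \<notin> fn Q'\<close> by (intro alpha_subst_cong) metis
  then have 3: "scong D (Nu c (Par (subst s' P') (subst s Q'))) (Nu c (subst s' (Par P' Q')))"
    by (auto intro: congr_nu congr_par congr_refl alpha_scong)
  have 4: "scong D (subst s Q) (Nu c (subst s' (Par P' Q')))"
    unfolding \<open>Q = _\<close> by (intro alpha_scong al) auto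
  show ?thesis using 1 2 3 4 by (meson congr_trans congr_sym)
next
  case (3 b c P')
  show ?thesis
  proof (cases "\<exists>x y. b = BChan x \<and> c = BChan y")
    case True
    then obtain x y where xy: "b = BChan x" "c = BChan y" by blast
    \<comment> \<open>Both bound channels are sent to fresh names; the two results then differ only
      in the order of the binders.\<close>
    obtain z where z: "z \<notin> insert x (insert y (s ` (Inl -` fn P')))"
      using fresh_chan[of "insert x (insert y (s ` (Inl -` fn P')))"] by (auto simp: finite_vimageI)
    obtain w where w: "w \<notin> insert z (insert x (insert y (s ` (Inl -` fn P'))))"
      using fresh_chan[of "insert z (insert x (insert y (s ` (Inl -` fn P'))))"] by (auto simp: finite_vimageI)
    have "x \<noteq> y" using 3 xy by simp
    have *: "alpha (subst s (Nu (BChan x) (Nu (BChan y) P'))) (Nu (BChan z) (Nu (BChan w) (subst (s(x := z, y := w)) P')))"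
      if "x \<noteq> y" "z \<noteq> w" "z \<notin> s ` (Inl -` fn P')" "w \<notin> s ` (Inl -` fn P')" for x y z w
    proof -
      have "alpha (subst s (Nu (BChan x) (Nu (BChan y) P'))) (Nu (BChan z) (subst (s(x := z)) (Nu (BChan y) P')))"
        by (rule alpha_subst_BChan) (use that in \<open>auto simp: map_sum_def split: sum.splits\<close>)
      moreover have "alpha (subst (s(x := z)) (Nu (BChan y) P')) (Nu (BChan w) (subst (s(x := z, y := w)) P'))"
        by (rule alpha_subst_BChan) (use that in \<open>auto simp: map_sum_def split: sum.splits if_splits\<close>)
      ultimately show ?thesis by (meson congr_trans congr_nu)
    qed
    have "scong D (Nu (BChan z) (Nu (BChan w) (subst (s(x := z, y := w)) P')))
        (Nu (BChan w) (Nu (BChan z) (subst (s(x := z, y := w)) P')))"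
      by (intro congr_base struct_law.intros) (use w in auto)
    moreover have "s(x := z, y := w) = s(y := w, x := z)" using \<open>x \<noteq> y\<close> by auto
    ultimately show ?thesis using *[of x y z w] *[of y x w z] w z \<open>x \<noteq> y\<close> unfolding 3 xy
      by (smt (verit) alpha_scong congr_trans congr_sym insertCI)
  next
    case False
    \<comment> \<open>At least one of the binders is stochastic and unchanged by substitution, so at
      most the other one has to be renamed.\<close>
    have comm: "scong D (subst s (Nu (BStoch q l) (Nu c P'))) (subst s (Nu c (Nu (BStoch q l) P')))"
      if "Inr q \<noteq> bname c" for q l c
    proof (cases c)
      case (BChan y)
      obtain z where z: "Inl z \<notin> map_sum s id ` fn P'"
        using fresh_chan[of "Inl -` (map_sum s id ` fn P')"] by (auto simp: finite_vimageI)
      have "alpha (subst s (Nu c P')) (Nu (BChan z) (subst (s(y := z)) P'))"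
        unfolding BChan by (rule alpha_subst_BChan) (use z in auto)
      then have "alpha (subst s (Nu (BStoch q l) (Nu c P'))) (Nu (BStoch q l) (Nu (BChan z) (subst (s(y := z)) P')))"
        by (auto intro: congr_nu)
      moreover have "alpha (subst s (Nu c (Nu (BStoch q l) P'))) (Nu (BChan z) (subst (s(y := z)) (Nu (BStoch q l) P')))"
        unfolding BChan by (rule alpha_subst_BChan) (use z in auto)
      moreover have "scong D (Nu (BStoch q l) (Nu (BChan z) (subst (s(y := z)) P'))) (Nu (BChan z) (subst (s(y := z)) (Nu (BStoch q l) P')))"
        by (simp add: scong_swap)
      ultimately show ?thesis by (meson alpha_scong congr_trans congr_sym)
    next
      case (BStoch r m)
      with that show ?thesis by (simp add: scong_swap)
    qed
    from False show ?thesis unfolding 3 using comm[of _ c _] comm[of _ b _] 3(3)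
      by (cases b; cases c) (auto intro: congr_sym simp del: subst.simps)
  qed
next
  case (4 b)
  then show ?thesis by (cases b) (auto simp: Let_def intro: congr_base struct_law.intros)
next
  case (11 A ys)
  obtain B' where "unfolds D A (map s ys) B'" "alpha (subst s Q) B'"
    using unfolds_subst[OF 11(2)] by blast
  then show ?thesis unfolding 11(1) subst.simps by (meson congr_trans congr_sym alpha_scong scong_unfold)
next
  case (12 q M P' l)
  have "Inr q \<notin> fn_summ (subst_summ s M) \<union> fn (subst s P')"
    using 12 by (auto simp: fn_subst map_sum_def split: sum.splits)
  with 12 show ?thesis by (auto intro: congr_base struct_law.intros)
qed (auto intro: congr_base struct_law.intros)

text \<open>Under a binder both sides must receive the same new bound name before the induction
  hypothesis can be used; it is chosen for the two scopes together.\<close>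

lemma scong_subst: "scong D P Q \<Longrightarrow> scong D (subst s P) (subst s Q)"
proof (induct arbitrary: s rule: congr.induct)
  case (congr_base P Q)
  then show ?case by (rule struct_law_subst)
next
  case (congr_nu P P' b)
  obtain c s' where "\<And>Q :: ('x, 'q, 'k) proc. fn Q \<subseteq> fn P \<union> fn P' \<Longrightarrow> alpha (subst s (Nu b Q)) (Nu c (subst s' Q))"
    by (rule subst_Nu[of "fn P \<union> fn P'" b s "{}"]) auto
  then have "alpha (subst s (Nu b P)) (Nu c (subst s' P))" "alpha (subst s (Nu b P')) (Nu c (subst s' P'))"
    by auto
  then show ?case using congr.congr_nu[OF congr_nu(2)] by (meson alpha_scong congr_trans congr_sym)
next
  case (congr_pre P P' a)
  show ?case
  proof (cases a)
    case (In x y)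
    obtain z where z: "Inl z \<notin> map_sum s id ` (fn P \<union> fn P')"
      using fresh_chan[of "Inl -` (map_sum s id ` (fn P \<union> fn P'))"] by (auto simp: finite_vimageI)
    have "alpha (subst s (Sum (Pre (In x y) P))) (Sum (Pre (In (s x) z) (subst (s(y := z)) P)))"
      "alpha (subst s (Sum (Pre (In x y) P'))) (Sum (Pre (In (s x) z) (subst (s(y := z)) P')))"
      by (rule alpha_subst_In, use z in blast)+
    then show ?thesis using congr.congr_pre[OF congr_pre(2)] unfolding In
      by (meson alpha_scong congr_trans congr_sym)
  qed (use congr_pre in \<open>auto intro: congr.congr_pre\<close>)
qed (auto intro: congr.intros)

end

section \<open>Commitments\<close>

text \<open>
  \<open>com D S P (KRcv x z) R\<close>: \<open>P\<close> can receive on \<open>x\<close>, leaving the abstraction \<open>(z)R\<close>.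
  \<open>com D S P (KSnd x z R) P'\<close>: \<open>P\<close> can send on \<open>x\<close> to the abstraction \<open>(z)R\<close>, which results in \<open>P'\<close>.
  Binders are renamed when they are passed; \<open>S\<close> is a set of names that these renamings avoid, which
  replaces a strong induction principle.
\<close>

datatype ('x, 'q, 'k) act = KTau | KRcv 'x 'x | KSnd 'x 'x "('x, 'q, 'k) proc"

primrec fnk :: "('x, 'q, 'k) act \<Rightarrow> ('x + 'q) set" where
  "fnk KTau = {}"
| "fnk (KRcv x z) = {Inl x, Inl z}"
| "fnk (KSnd x z R) = {Inl x, Inl z} \<union> fn R"

text \<open>A receiver hands over its abstraction as the target, so \<open>z\<close> is visible
  outside; a sender carries the abstraction in its label only and exposes no binder.\<close>

primrec bnk :: "('x, 'q, 'k) act \<Rightarrow> ('x + 'q) set" where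
  "bnk KTau = {}"
| "bnk (KRcv x z) = {Inl z}"
| "bnk (KSnd x z R) = {}"

text \<open>The names that a target may have beyond those of the source, as \<open>com_fn\<close>
  shows.\<close>

primrec resk :: "('x, 'q, 'k) act \<Rightarrow> ('x + 'q) set" where
  "resk KTau = {}"
| "resk (KRcv x z) = {Inl z}"
| "resk (KSnd x z R) = fn R - {Inl z}"

primrec permk :: "('x \<Rightarrow> 'x) \<Rightarrow> ('q \<Rightarrow> 'q) \<Rightarrow> ('x, 'q, 'k) act \<Rightarrow> ('x, 'q, 'k) act" where
  "permk f g KTau = KTau"
| "permk f g (KRcv x z) = KRcv (f x) (f z)"
| "permk f g (KSnd x z R) = KSnd (f x) (f z) (perm f g R)"

primrec summands :: "('x, 'q, 'k) summ \<Rightarrow> (('x, 'q) prefix \<times> ('x, 'q, 'k) proc) multiset" where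
  "summands Zero = {#}"
| "summands (Pre a P) = {#(a, P)#}"
| "summands (Plus M N) = summands M + summands N"

inductive leaf :: "('x, 'q) prefix \<Rightarrow> ('x, 'q, 'k) proc \<Rightarrow> ('x, 'q, 'k) act \<Rightarrow> ('x, 'q, 'k) proc \<Rightarrow> bool" where
  leaf_tau: "leaf Tau Q KTau Q"
| leaf_in: "Inl z \<notin> fn Q - {Inl y} \<Longrightarrow> alpha (ren (BChan y) (BChan z) Q) R \<Longrightarrow> leaf (In x y) Q (KRcv x z) R"
| leaf_out: "alpha (subst1 z y R) R' \<Longrightarrow> leaf (Out x y) Q (KSnd x z R) (Par Q R')"

inductive com :: "('x, 'q, 'k) defs \<Rightarrow> ('x + 'q) set \<Rightarrow> ('x, 'q, 'k) proc \<Rightarrow> ('x, 'q, 'k) act \<Rightarrow>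
   ('x, 'q, 'k) proc \<Rightarrow> bool" for D where
  com_sum: "(a, Q) \<in># summands M \<Longrightarrow> leaf a Q \<kappa> R \<Longrightarrow> com D S (Sum M) \<kappa> R"
| com_par1: "com D S P \<kappa> P' \<Longrightarrow> bnk \<kappa> \<inter> fn Q = {} \<Longrightarrow> com D S (Par P Q) \<kappa> (Par P' Q)"
| com_par2: "com D S Q \<kappa> Q' \<Longrightarrow> bnk \<kappa> \<inter> fn P = {} \<Longrightarrow> com D S (Par P Q) \<kappa> (Par P Q')"
| com_comL: "com D S P (KSnd x z R) P' \<Longrightarrow> com D S Q (KRcv x z) R \<Longrightarrow> Inl z \<notin> S \<union> fn P \<union> fn Q \<Longrightarrow>
    com D S (Par P Q) KTau P'"
| com_comR: "com D S P (KRcv x z) R \<Longrightarrow> com D S Q (KSnd x z R) Q' \<Longrightarrow> Inl z \<notin> S \<union> fn P \<union> fn Q \<Longrightarrow>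
    com D S (Par P Q) KTau Q'"
| com_nu: "com D (insert (bname c) S) P1 \<kappa> P' \<Longrightarrow> alpha (Nu b P) (Nu c P1) \<Longrightarrow>
    bname c \<notin> S \<union> fnk \<kappa> \<Longrightarrow> com D S (Nu b P) \<kappa> (Nu c P')"
| com_const: "com D S B' \<kappa> P' \<Longrightarrow> unfolds D A ys B \<Longrightarrow> alpha B B' \<Longrightarrow> com D S (Const A ys) \<kappa> P'"

inductive_cases com_SumE: "com D S (Sum M) \<kappa> R"
inductive_cases com_ConstE: "com D S (Const A ys) \<kappa> R"

section \<open>Commitments and alpha-equivalence\<close>

lemma permk_id [simp]: "permk id id \<kappa> = \<kappa>"
  by (cases \<kappa>) auto

lemma finite_fnk [simp]: "finite (fnk \<kappa>)"
  by (cases \<kappa>) auto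

lemma fnk_permk: "inj f \<Longrightarrow> inj g \<Longrightarrow> fnk (permk f g \<kappa>) = map_sum f g ` fnk \<kappa>"
  by (cases \<kappa>) (auto simp: fn_perm)

lemma bnk_permk: "bnk (permk f g \<kappa>) = map_sum f g ` bnk \<kappa>"
  by (cases \<kappa>) auto

lemma resk_subset: "resk \<kappa> \<subseteq> fnk \<kappa>" "bnk \<kappa> \<subseteq> fnk \<kappa>"
  by (cases \<kappa>; auto)+

lemma alpha_Nu_ren:
  fixes P :: "('x :: infinite, 'q :: infinite, 'k) proc"
  assumes "alpha (Nu b P) (Nu c Q)" "like b d" "bname d \<notin> fn (Nu b P)"
  shows "alpha (ren b d P) (ren c d Q)"
proof -
  have "like b c" using assms(1) by (rule alpha_Nu_inv) auto
  then have c: "like c d" "bname d \<notin> fn (Nu c Q)"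
    using assms alpha_fn[OF assms(1)] like_sym like_trans by (blast, metis)
  have "alpha (Nu d (ren b d P)) (Nu d (ren c d Q))"
    using alpha_ren[OF assms(2,3)] alpha_ren[OF c] assms(1) by (meson congr_trans congr_sym)
  then show ?thesis by (rule alpha_Nu_inv) (auto)
qed

lemma alpha_Nu_cong_Par:
  fixes P :: "('x :: infinite, 'q :: infinite, 'k) proc"
  assumes "alpha (Nu b P) (Nu c P1)" "bname b \<notin> fn Q" "bname c \<notin> fn Q"
  shows "alpha (Nu b (Par P Q)) (Nu c (Par P1 Q))"
proof -
  from assms(1) have lk: "like b c" and c: "bname c \<notin> fn (Nu b P)" and al: "alpha (ren b c P) P1"
    by (auto elim: alpha_Nu_inv)
  have "ren b c (Par P Q) = Par (ren b c P) (ren b c Q)" using lk by (cases b; cases c) auto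
  then have "alpha (ren b c (Par P Q)) (Par P1 Q)"
    using al alpha_ren_fresh[OF lk assms(2,3)] by (auto intro: congr_par)
  then show ?thesis using lk c assms by (intro alpha_NuI) auto
qed

lemma summands_alpha:
  fixes M :: "('x :: infinite, 'q :: infinite, 'k) summ"
  assumes "alpha (Sum M) (Sum N)" "(a, P) \<in># summands M"
  shows "\<exists>a' P'. (a', P') \<in># summands N \<and> alpha (Sum (Pre a P)) (Sum (Pre a' P'))"
  using assms
proof (induct M arbitrary: N rule: summ.induct[where ?P1.0 = "\<lambda>_. True"])
  case (Plus M1 M2)
  have "db_summ (Plus M1 M2) 0 (Inl :: _ \<Rightarrow> ('x + 'q) + nat) = db_summ N 0 Inl"
    using Plus(3) by (simp add: alpha_iff_db)
  then obtain N1 N2 where N: "N = Plus N1 N2" by (cases N) (auto split: prefix.splits)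
  have "alpha (Sum M1) (Sum N1)" "alpha (Sum M2) (Sum N2)"
    using Plus(3) unfolding N by (simp_all add: alpha_iff_db)
  then show ?case using Plus(1)[of N1] Plus(2)[of N2] Plus(4) unfolding N by auto
next
  case (Pre a' Q)
  have "db_summ (Pre a' Q) 0 (Inl :: _ \<Rightarrow> ('x + 'q) + nat) = db_summ N 0 Inl"
    using Pre(2) by (simp add: alpha_iff_db)
  then obtain b P' where N: "N = Pre b P'" by (cases N) (auto split: prefix.splits)
  then show ?case using Pre by auto
qed auto

lemma alpha_Pre_inv:
  fixes P :: "('x :: infinite, 'q :: infinite, 'k) proc"
  assumes "alpha (Sum (Pre a P)) (Sum (Pre a' P'))"
  shows "case a of In x y \<Rightarrow> (\<exists>y'. a' = In x y' \<and> alpha (Nu (BChan y) P) (Nu (BChan y') P'))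
     | _ \<Rightarrow> a' = a \<and> alpha P P'"
proof -
  have "db_summ (Pre a P) 0 (Inl :: _ \<Rightarrow> ('x + 'q) + nat) = db_summ (Pre a' P') 0 Inl"
    using assms by (simp add: alpha_iff_db)
  then show ?thesis
    by (cases a; cases a') (auto simp: alpha_iff_db)
qed

lemma leaf_alpha:
  fixes P :: "('x :: infinite, 'q :: infinite, 'k) proc"
  assumes "leaf a P \<kappa> R" "alpha (Sum (Pre a P)) (Sum (Pre a' P'))"
  shows "\<exists>R'. leaf a' P' \<kappa> R' \<and> alpha R R'"
  using assms(1)
proof cases
  case leaf_tau
  then show ?thesis using alpha_Pre_inv[OF assms(2)] by (auto intro: leaf.intros)
next
  case (leaf_in z y x)
  then obtain y' where a': "a' = In x y'" "alpha (Nu (BChan y) P) (Nu (BChan y') P')"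
    using alpha_Pre_inv[OF assms(2)] by auto
  have "alpha (ren (BChan y) (BChan z) P) (ren (BChan y') (BChan z) P')"
    by (rule alpha_Nu_ren[OF a'(2)]) (use leaf_in in auto)
  moreover have "Inl z \<notin> fn P' - {Inl y'}" using alpha_fn[OF a'(2)] leaf_in(3) by auto
  ultimately show ?thesis using leaf_in a'
    by (metis leaf.leaf_in congr_trans congr_sym congr_refl)
next
  case (leaf_out z y R0 R' x)
  then show ?thesis using alpha_Pre_inv[OF assms(2)] by (auto intro: leaf.intros congr_par congr_refl)
qed

text \<open>The abstraction is looked at only where the output prefix is reached, and
  \<open>leaf_out\<close> accepts every alpha-variant of the instance; so even the target stays the
  same. This lets the two premises of a communication be matched again after each has been renamed
  separately.\<close>

lemma com_snd_alpha:
  fixes P :: "('x :: infinite, 'q :: infinite, 'k) proc"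
  assumes "com D S P (KSnd x z R) P'" "alpha R R1" shows "com D S P (KSnd x z R1) P'"
  using assms(1)
proof (induct S P "KSnd x z R" P' rule: com.induct)
  case (com_sum a Q M R' S)
  from com_sum(2) obtain y R'' where "a = Out x y" "R' = Par Q R''" "alpha (subst1 z y R) R''"
    by cases auto
  moreover have "alpha (subst1 z y R1) (subst1 z y R)"
    unfolding subst1_def by (rule alpha_subst[OF congr_sym[OF assms(2)]])
  ultimately have "leaf a Q (KSnd x z R1) R'" using leaf_out congr_trans by metis
  with com_sum(1) show ?case by (rule com.com_sum)
next
  case (com_nu c S P1 P' b P)
  then show ?case using alpha_fn[OF assms(2)] by (intro com.com_nu) auto
qed (auto intro: com.intros)

text \<open>At a binder nothing has to be renamed: \<open>com_nu\<close> takes an arbitrary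
  alpha-variant of the source, and that of the given derivation is also one of
  \<open>Q\<close>.\<close>

lemma com_alpha:
  fixes P :: "('x :: infinite, 'q :: infinite, 'k) proc"
  assumes "com D S P \<kappa> P'" "alpha P Q" shows "\<exists>Q'. com D S Q \<kappa> Q' \<and> alpha P' Q'"
  using assms
proof (induct arbitrary: Q rule: com.induct)
  case (com_sum a P M \<kappa> R S)
  obtain N where Q: "Q = Sum N" using com_sum(3) alpha_Sum_inv by blast
  obtain a' P' where "(a', P') \<in># summands N" "alpha (Sum (Pre a P)) (Sum (Pre a' P'))"
    using summands_alpha com_sum Q by blast
  then show ?case using leaf_alpha com_sum(2) unfolding Q by (meson com.com_sum)
next
  case (com_par1 S P1 \<kappa> P1' P2)
  obtain Q1 Q2 where Q: "Q = Par Q1 Q2" "alpha P1 Q1" "alpha P2 Q2" using alpha_Par_inv[OF com_par1(4)] .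
  obtain Q1' where "com D S Q1 \<kappa> Q1'" "alpha P1' Q1'" using com_par1(2) Q by blast
  then show ?case using Q com_par1(3) alpha_fn[OF Q(3)] by (auto intro: com.com_par1 congr_par)
next
  case (com_par2 S P2 \<kappa> P2' P1)
  obtain Q1 Q2 where Q: "Q = Par Q1 Q2" "alpha P1 Q1" "alpha P2 Q2" using alpha_Par_inv[OF com_par2(4)] .
  obtain Q2' where "com D S Q2 \<kappa> Q2'" "alpha P2' Q2'" using com_par2(2) Q by blast
  then show ?case using Q com_par2(3) alpha_fn[OF Q(2)] by (auto intro: com.com_par2 congr_par)
next
  case (com_comL S P1 x z R P' P2)
  obtain Q1 Q2 where Q: "Q = Par Q1 Q2" "alpha P1 Q1" "alpha P2 Q2" using alpha_Par_inv[OF com_comL(6)] .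
  obtain R' where R': "com D S Q2 (KRcv x z) R'" "alpha R R'" using com_comL(4) Q by blast
  obtain Q' where "com D S Q1 (KSnd x z R) Q'" "alpha P' Q'" using com_comL(2) Q by blast
  then have "com D S Q1 (KSnd x z R') Q'" "alpha P' Q'" using com_snd_alpha R'(2) by blast+
  then show ?case using Q com_comL(5) alpha_fn[OF Q(2)] alpha_fn[OF Q(3)] R'(1)
    by (auto intro: com.com_comL)
next
  case (com_comR S P1 x z R P2 P')
  obtain Q1 Q2 where Q: "Q = Par Q1 Q2" "alpha P1 Q1" "alpha P2 Q2" using alpha_Par_inv[OF com_comR(6)] .
  obtain R' where R': "com D S Q1 (KRcv x z) R'" "alpha R R'" using com_comR(2) Q by blast
  obtain Q' where "com D S Q2 (KSnd x z R) Q'" "alpha P' Q'" using com_comR(4) Q by blast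
  then have "com D S Q2 (KSnd x z R') Q'" "alpha P' Q'" using com_snd_alpha R'(2) by blast+
  then show ?case using Q com_comR(5) alpha_fn[OF Q(2)] alpha_fn[OF Q(3)] R'(1)
    by (auto intro: com.com_comR)
next
  case (com_nu c S P1 \<kappa> P' b P)
  obtain b' Q' where Q: "Q = Nu b' Q'" using alpha_Nu_inv[OF com_nu(5)] by metis
  have "alpha (Nu b' Q') (Nu c P1)" using com_nu(3,5) Q by (meson congr_trans congr_sym)
  then have "com D S Q \<kappa> (Nu c P')" unfolding Q by (rule com.com_nu[OF com_nu(1) _ com_nu(4)])
  then show ?case using congr_refl by (intro exI conjI)
next
  case (com_const S B' \<kappa> P' A ys B)
  have "Q = Const A ys" by (rule alpha_Const_inv[OF com_const(5)])
  then show ?case using com.com_const[OF com_const(1,3,4)] congr_refl by (auto intro: exI)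
qed

context defs begin

lemma com_fn:
  assumes "com D S P \<kappa> P'"
  shows "fn P' \<subseteq> fn P \<union> resk \<kappa> \<and> (\<forall>x z. \<kappa> = KRcv x z \<longrightarrow> Inl x \<in> fn P) \<and> (\<forall>x z R. \<kappa> = KSnd x z R \<longrightarrow> Inl x \<in> fn P)"
  using assms
proof (induct rule: com.induct)
  case (com_sum a Q M \<kappa> R S)
  have *: "fn_summ (Pre a Q) \<subseteq> fn_summ M" using com_sum(1) by (induct M rule: summ.induct[where ?P1.0 = "\<lambda>_. True"]) auto
  from com_sum(2) show ?case
  proof cases
    case leaf_tau
    then show ?thesis using * by auto
  next
    case (leaf_in z y x)
    have "fn R \<subseteq> insert (Inl z) (fn Q - {Inl y})"
      using alpha_fn[OF leaf_in(4)] fn_ren_subset[of "BChan y" "BChan z" Q] leaf_in(3) by auto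
    then show ?thesis using * leaf_in by auto
  next
    case (leaf_out z y R0 R' x)
    have "fn R' \<subseteq> insert (Inl y) (fn R0 - {Inl z})"
      unfolding alpha_fn[OF leaf_out(4), symmetric] subst1_def fn_subst
      by (auto simp: map_sum_def split: sum.splits if_splits)
    then show ?thesis using * leaf_out by auto
  qed
next
  case (com_nu c S P1 \<kappa> P' b P)
  have "fn (Nu b P) = fn (Nu c P1)" using alpha_fn[OF com_nu(3)] .
  then show ?case using com_nu(2,4) by auto
next
  case (com_const S B' \<kappa> P' A ys B)
  have "fn B' \<subseteq> fn (Const A ys)" using unfolds_fn[OF com_const(3)] alpha_fn[OF com_const(4)] by simp
  then show ?case using com_const(2) by blast
qed auto

end

section \<open>Renaming commitments and changing the avoided names\<close>

lemma perm_ren: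
  assumes "bij f" "bij g" "like b c"
  shows "perm f g (ren b c P) = ren (map_nu_binder f g b) (map_nu_binder f g c) (perm f g P)"
proof -
  have t: "f \<circ> transpose x y = transpose (f x) (f y) \<circ> f" "g \<circ> transpose q r = transpose (g q) (g r) \<circ> g" for x y q r
    using assms by (auto simp: fun_eq_iff transpose_def bij_is_inj inj_eq)
  show ?thesis using assms(3) by (cases b; cases c) (simp_all add: perm_comp t)
qed

lemma leaf_perm:
  fixes P :: "('x :: infinite, 'q :: infinite, 'k) proc"
  assumes "leaf a P \<kappa> R" "bij f" "bij g"
  shows "leaf (map_prefix f g a) (perm f g P) (permk f g \<kappa>) (perm f g R)"
  using assms(1)
proof cases
  case leaf_tau
  then show ?thesis by (auto intro: leaf.intros)
next
  case (leaf_in z y x)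
  have "inj (map_sum f g)" using assms by (simp add: inj_map_sum bij_is_inj)
  then have "Inl (f z) \<notin> fn (perm f g P) - {Inl (f y)}"
    using leaf_in(3) assms inj_image_mem_iff[of "map_sum f g" "Inl z" "fn P"] inj_eq[of "map_sum f g" "Inl z" "Inl y"]
    by (auto simp: fn_perm bij_is_inj)
  moreover have "alpha (ren (BChan (f y)) (BChan (f z)) (perm f g P)) (perm f g R)"
    using alpha_perm[OF leaf_in(4) assms(2,3)] perm_ren[OF assms(2,3), of "BChan y" "BChan z" P]
    by (simp del: ren.simps)
  ultimately show ?thesis using leaf_in by (auto intro: leaf.intros)
next
  case (leaf_out z y R0 R' x)
  have "alpha (perm f g (subst1 z y R0)) (subst1 (f z) (f y) (perm f g R0))" unfolding subst1_def
    by (rule alpha_perm_subst[OF assms(2,3)]) (use assms in \<open>auto simp: bij_is_inj inj_eq\<close>)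
  then have "alpha (subst1 (f z) (f y) (perm f g R0)) (perm f g R')"
    using alpha_perm[OF leaf_out(4) assms(2,3)] by (meson congr_trans congr_sym)
  then show ?thesis using leaf_out by (auto intro: leaf.intros)
qed

lemma summands_perm: "summands (perm_summ f g M) = image_mset (map_prod (map_prefix f g) (perm f g)) (summands M)"
  by (induct M rule: summ.induct[where ?P1.0 = "\<lambda>_. True"]) auto

lemma bij_transpose: "bij (transpose x y)"
  by (simp add: o_bij[of "transpose x y" "transpose x y"])

context defs begin

text \<open>The communication case of the next lemma. The private name \<open>f z\<close> of the two
  premises may lie in the new set \<open>T\<close>, so one more transposition moves it to a fresh
  \<open>w\<close>; the induction hypotheses allow this since they hold for every \<open>f\<close>.
  Neither \<open>P\<close> nor \<open>Q\<close> nor the target mentions \<open>z\<close>, so up to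
  alpha they do not notice.\<close>

lemma com_comm_perm:
  assumes snd: "com D S P (KSnd x z R) P'" and rcv: "com D S Q (KRcv x z) R"
    and z: "Inl z \<notin> fn P \<union> fn Q" and T: "finite T" and bij: "bij f" "bij g"
    and IH1: "\<And>f. bij f \<Longrightarrow> \<exists>P''. com D T (perm f g P) (KSnd (f x) (f z) (perm f g R)) P'' \<and> alpha (perm f g P') P''"
    and IH2: "\<And>f. bij f \<Longrightarrow> \<exists>R'. com D T (perm f g Q) (KRcv (f x) (f z)) R' \<and> alpha (perm f g R) R'"
  shows "\<exists>w R' P''. com D T (perm f g P) (KSnd (f x) w R') P'' \<and> com D T (perm f g Q) (KRcv (f x) w) R' \<and>
    Inl w \<notin> T \<union> fn (perm f g P) \<union> fn (perm f g Q) \<and> alpha (perm f g P') P''"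
proof -
  let ?F = "T \<union> fn (perm f g P) \<union> fn (perm f g Q) \<union> fn (perm f g P') \<union> {Inl (f z)}"
  obtain w where "w \<notin> Inl -` ?F" using T fresh_chan[of "Inl -` ?F"] by (auto simp: finite_vimageI)
  then have w: "Inl w \<notin> ?F" by simp
  let ?t = "transpose (f z) w"
  have bt: "bij (?t \<circ> f)" by (rule bij_comp[OF bij(1) bij_transpose])
  have inj: "inj (map_sum f g)" using bij by (simp add: inj_map_sum bij_is_inj)
  have fx: "alpha (perm (?t \<circ> f) g X) (perm f g X)" if "Inl z \<notin> fn X" "Inl w \<notin> fn (perm f g X)" for X :: "('x, 'q, 'k) proc"
  proof -
    have "Inl (f z) \<notin> fn (perm f g X)"
      using that(1) bij inj inj_image_mem_iff[of "map_sum f g" "Inl z" "fn X"] by (simp add: fn_perm bij_is_inj)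
    then have "alpha (perm ?t id (perm f g X)) (perm f g X)"
      using that(2) bij_transpose by (intro alpha_perm_fresh) (auto simp: map_sum_transpose transpose_def)
    then show ?thesis by (simp add: perm_comp)
  qed
  have "x \<noteq> z" using com_fn[OF rcv] z by auto
  then have "f x \<noteq> f z" using bij by (simp add: bij_is_inj inj_eq)
  have "Inl (f x) \<in> fn (perm f g Q)" using com_fn[OF rcv] bij by (auto simp: fn_perm bij_is_inj image_iff intro!: bexI[of _ "Inl x"])
  then have "f x \<noteq> w" using w by auto
  have k: "(?t \<circ> f) x = f x" "(?t \<circ> f) z = w" using \<open>f x \<noteq> w\<close> \<open>f x \<noteq> f z\<close> by (auto simp: transpose_def)
  have zP': "Inl z \<notin> fn P'" using com_fn[OF snd] z by auto
  obtain R0 where R0: "com D T (perm (?t \<circ> f) g Q) (KRcv (f x) w) R0" "alpha (perm (?t \<circ> f) g R) R0"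
    using IH2[OF bt] unfolding k by blast
  obtain P0 where P0: "com D T (perm (?t \<circ> f) g P) (KSnd (f x) w (perm (?t \<circ> f) g R)) P0" "alpha (perm (?t \<circ> f) g P') P0"
    using IH1[OF bt] unfolding k by blast
  have "alpha (perm (?t \<circ> f) g Q) (perm f g Q)" by (rule fx) (use z w in auto)
  then obtain R1 where R1: "com D T (perm f g Q) (KRcv (f x) w) R1" "alpha R0 R1"
    using com_alpha[OF R0(1)] by blast
  have "alpha (perm (?t \<circ> f) g P) (perm f g P)" by (rule fx) (use z w in auto)
  then obtain P1 where P1: "com D T (perm f g P) (KSnd (f x) w (perm (?t \<circ> f) g R)) P1" "alpha P0 P1"
    using com_alpha[OF P0(1)] by blast
  have "com D T (perm f g P) (KSnd (f x) w R1) P1"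
    using com_snd_alpha[OF P1(1)] congr_trans[OF R0(2) R1(2)] by blast
  moreover have "alpha (perm f g P') P1"
    using fx[OF zP'] w P0(2) P1(2) congr_trans congr_sym by (metis UnCI)
  ultimately show ?thesis using R1(1) w by (intro exI[of _ w] exI[of _ R1] exI[of _ P1]) auto
qed

text \<open>Equivariance and the exchange of the avoided set form one induction: avoiding
  \<open>T\<close> means renaming the binders that are passed, which is again a permutation of a
  subderivation.\<close>

lemma com_perm:
  assumes "com D S P \<kappa> P'" "finite T" "bij f" "bij g"
  shows "\<exists>P''. com D T (perm f g P) (permk f g \<kappa>) P'' \<and> alpha (perm f g P') P''"
  using assms
proof (induct arbitrary: T f g rule: com.induct)
  case (com_sum a P M \<kappa> R S)
  have "(map_prefix f g a, perm f g P) \<in># summands (perm_summ f g M)"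
    unfolding summands_perm using com_sum(1) by (auto intro!: image_eqI[of _ _ "(a, P)"])
  then show ?case using leaf_perm[OF com_sum(2) com_sum(4,5)] by (auto intro: com.com_sum congr_refl)
next
  case (com_par1 S P \<kappa> P' Q)
  obtain P'' where "com D T (perm f g P) (permk f g \<kappa>) P''" "alpha (perm f g P') P''"
    using com_par1 by blast
  moreover have "bnk (permk f g \<kappa>) \<inter> fn (perm f g Q) = {}"
    using com_par1(3,5,6) image_Int[of "map_sum f g" "bnk \<kappa>" "fn Q"]
    by (simp add: bnk_permk fn_perm bij_is_inj inj_map_sum)
  ultimately show ?case by (auto intro: com.com_par1 congr_par congr_refl)
next
  case (com_par2 S P \<kappa> P' Q)
  obtain P'' where "com D T (perm f g P) (permk f g \<kappa>) P''" "alpha (perm f g P') P''"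
    using com_par2 by blast
  moreover have "bnk (permk f g \<kappa>) \<inter> fn (perm f g Q) = {}"
    using com_par2(3,5,6) image_Int[of "map_sum f g" "bnk \<kappa>" "fn Q"]
    by (simp add: bnk_permk fn_perm bij_is_inj inj_map_sum)
  ultimately show ?case by (auto intro: com.com_par2 congr_par congr_refl)
next
  case (com_comL S P x z R P' Q)
  have "\<exists>w R' P''. com D T (perm f g P) (KSnd (f x) w R') P'' \<and> com D T (perm f g Q) (KRcv (f x) w) R' \<and>
      Inl w \<notin> T \<union> fn (perm f g P) \<union> fn (perm f g Q) \<and> alpha (perm f g P') P''"
    using com_comL(2,4)[OF com_comL(6) _ com_comL(8)] com_comL(5)
    by (intro com_comm_perm[OF com_comL(1,3) _ com_comL(6-8)]) auto
  then show ?case by (auto intro: com.com_comL)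
next
  case (com_comR S P x z R Q Q')
  have "\<exists>w R' P''. com D T (perm f g Q) (KSnd (f x) w R') P'' \<and> com D T (perm f g P) (KRcv (f x) w) R' \<and>
      Inl w \<notin> T \<union> fn (perm f g Q) \<union> fn (perm f g P) \<and> alpha (perm f g Q') P''"
    using com_comR(2,4)[OF com_comR(6) _ com_comR(8)] com_comR(5)
    by (intro com_comm_perm[OF com_comR(3,1) _ com_comR(6-8)]) auto
  then show ?case by (auto intro: com.com_comR)
next
  case (com_nu c S P1 \<kappa> P' b P)
  let ?c = "map_nu_binder f g c" and ?b = "map_nu_binder f g b"
  have inj: "inj (map_sum f g)" "inj f" "inj g" using com_nu(6,7) by (simp_all add: inj_map_sum bij_is_inj)
  \<comment> \<open>The permuted binder \<open>?c\<close> need not avoid \<open>T\<close>, but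
    \<open>d\<close> does. Their transposition is composed with \<open>f\<close> and
    \<open>g\<close> before the induction hypothesis is applied.\<close>
  obtain d where d: "like ?c d" "bname d \<notin> T \<union> fnk (permk f g \<kappa>) \<union> fn (perm f g P1) \<union> fn (perm f g P') \<union> {bname ?c}"
    using fresh_like[of "T \<union> fnk (permk f g \<kappa>) \<union> fn (perm f g P1) \<union> fn (perm f g P') \<union> {bname ?c}" ?c] com_nu(5) by auto
  obtain f1 g1 where fg: "bij f1" "bij g1" "map_sum f1 g1 = transpose (bname ?c) (bname d)"
     "\<And>P :: ('x, 'q, 'k) proc. ren ?c d P = perm f1 g1 P"
    using ren_perm[OF d(1)] by metis
  obtain X where X: "com D (insert (bname d) T) (perm (f1 \<circ> f) (g1 \<circ> g) P1) (permk (f1 \<circ> f) (g1 \<circ> g) \<kappa>) X"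
    "alpha (perm (f1 \<circ> f) (g1 \<circ> g) P') X"
    using com_nu(2)[OF finite.insertI[OF com_nu(5)] bij_comp[OF com_nu(6) fg(1)] bij_comp[OF com_nu(7) fg(2)]]
    by blast
  have c: "bname ?c \<notin> fnk (permk f g \<kappa>)"
    using com_nu(4) inj by (simp add: fnk_permk inj_image_mem_iff)
  have fx: "map_sum f1 g1 n = n" if "n \<in> fnk (permk f g \<kappa>)" for n
    using that c d(2) unfolding fg(3) by (auto simp: transpose_def)
  \<comment> \<open>The permuted label contains neither of the transposed names and is fixed; for
    the abstraction of a sender this holds only up to alpha, which \<open>com_snd_alpha\<close>
    absorbs.\<close>
  have "com D (insert (bname d) T) (perm (f1 \<circ> f) (g1 \<circ> g) P1) (permk f g \<kappa>) X"
  proof (cases \<kappa>)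
    case (KSnd x z R)
    then have "f1 (f x) = f x" "f1 (f z) = f z" using fx[of "Inl (f x)"] fx[of "Inl (f z)"] by auto
    moreover have "alpha (perm f1 g1 (perm f g R)) (perm f g R)"
      by (rule alpha_perm_fresh) (use fg fx KSnd in auto)
    ultimately show ?thesis using X(1) KSnd com_snd_alpha by (auto simp: perm_comp)
  next
    case (KRcv x z)
    then have "f1 (f x) = f x" "f1 (f z) = f z" using fx[of "Inl (f x)"] fx[of "Inl (f z)"] by auto
    then show ?thesis using X(1) KRcv by auto
  qed (use X in auto)
  moreover have "alpha (Nu ?b (perm f g P)) (Nu d (perm (f1 \<circ> f) (g1 \<circ> g) P1))"
    using alpha_perm[OF com_nu(3,6,7)] alpha_ren[OF d(1), of "perm f g P1"] d(2)
    by (auto simp: fg(4) perm_comp intro: congr_trans)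
  ultimately have "com D T (Nu ?b (perm f g P)) (permk f g \<kappa>) (Nu d X)"
    using d by (intro com.com_nu) auto
  moreover have "alpha (Nu ?c (perm f g P')) (Nu d X)"
    using alpha_ren[OF d(1), of "perm f g P'"] X(2) d(2)
    by (auto simp: fg(4) perm_comp intro: congr_trans congr.congr_nu)
  ultimately show ?case by auto
next
  case (com_const S B' \<kappa> P' A ys B)
  obtain B1 where B1: "unfolds D A (map f ys) B1" "alpha (perm f g B) B1"
    using unfolds_perm[OF com_const(3,6,7)] by blast
  have "alpha B1 (perm f g B')" using B1(2) alpha_perm[OF com_const(4,6,7)] by (meson congr_trans congr_sym)
  then show ?case using com_const(2)[OF com_const(5-)] B1(1) by (auto intro: com.com_const)
qed

lemma com_avoid:
  assumes "com D S P \<kappa> P'" "finite T" shows "\<exists>P''. com D T P \<kappa> P'' \<and> alpha P' P''"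
  using com_perm[OF assms, of id id] by simp

text \<open>
  The derivation of a sending commitment does not look at the abstraction that it is offered:
  changing the abstraction changes the target by a relation that is respected by contexts.
\<close>

lemma com_snd_param:
  assumes "com D S P (KSnd x z R) P'"
    and leaf: "\<And>y. Inl y \<notin> V \<Longrightarrow> \<Psi> (subst1 z y R) (subst1 w y R1)"
    and cong: "\<And>A A' B B'. \<Psi> A B \<Longrightarrow> scong D A A' \<Longrightarrow> scong D B B' \<Longrightarrow> \<Psi> A' B'"
    and par: "\<And>Q A B. fn Q \<inter> V = {} \<Longrightarrow> \<Psi> A B \<Longrightarrow> \<Psi> (Par Q A) (Par Q B)"
    and nu: "\<And>c A B. bname c \<notin> U \<Longrightarrow> \<Psi> A B \<Longrightarrow> \<Psi> (Nu c A) (Nu c B)"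
    and S: "U \<union> V \<union> fnk (KSnd x w R1) \<subseteq> S" and V: "fn P \<inter> V = {}"
  shows "\<exists>P1. com D S P (KSnd x w R1) P1 \<and> \<Psi> P' P1"
  using assms(1) S V
proof (induct S P "KSnd x z R" P' rule: com.induct)
  case (com_sum a Q M R' S)
  from com_sum(2) obtain y R'' where R'': "a = Out x y" "R' = Par Q R''" "alpha (subst1 z y R) R''"
    by cases auto
  have *: "fn_summ (Pre a Q) \<subseteq> fn_summ M" using com_sum(1) by (induct M rule: summ.induct[where ?P1.0 = "\<lambda>_. True"]) auto
  then have y: "Inl y \<notin> V" "fn Q \<inter> V = {}" using com_sum(4) R'' by auto
  have "com D S (Sum M) (KSnd x w R1) (Par Q (subst1 w y R1))"
    by (rule com.com_sum[OF com_sum(1)]) (simp only: R''(1) leaf_out[OF congr_refl])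
  moreover have "\<Psi> R' (Par Q (subst1 w y R1))"
    unfolding R''(2) using par[OF y(2)] cong[OF leaf[OF y(1)] alpha_scong[OF R''(3)] congr_refl] by blast
  ultimately show ?case by blast
next
  case (com_par1 S P P' Q)
  then obtain P1 where P1: "com D S P (KSnd x w R1) P1" "\<Psi> P' P1" by auto
  have "fn Q \<inter> V = {}" using com_par1 by auto
  then have "\<Psi> (Par P' Q) (Par P1 Q)" using par[OF _ P1(2)] cong[OF _ scong_par_comm scong_par_comm] by blast
  then show ?case using P1 by (auto intro!: exI[of _ "Par P1 Q"] com.com_par1)
next
  case (com_par2 S Q Q' P)
  then obtain Q1 where Q1: "com D S Q (KSnd x w R1) Q1" "\<Psi> Q' Q1" by auto
  have "fn P \<inter> V = {}" using com_par2 by auto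
  then have "\<Psi> (Par P Q') (Par P Q1)" using par[OF _ Q1(2)] by blast
  then show ?case using Q1 by (auto intro!: exI[of _ "Par P Q1"] com.com_par2)
next
  case (com_nu c S P1 P' b P)
  have "fn (Nu b P) = fn (Nu c P1)" using alpha_fn[OF com_nu(3)] .
  then have "fn P1 \<inter> V = {}" using com_nu(4,5,6) by auto
  then obtain P2 where "com D (insert (bname c) S) P1 (KSnd x w R1) P2" "\<Psi> P' P2"
    using com_nu(2,5) by (auto simp: subset_insertI2)
  moreover have "bname c \<notin> S \<union> fnk (KSnd x w R1)" using com_nu(4,5) by auto
  moreover have "\<Psi> (Nu c P') (Nu c P2)" using nu calculation(2) com_nu(4,5) by auto
  ultimately show ?case using com.com_nu[OF _ com_nu(3)] by blast
next
  case (com_const S B' P' A ys B)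
  have "fn B' \<subseteq> fn (Const A ys)" using unfolds_fn[OF com_const(3)] alpha_fn[OF com_const(4)] by simp
  then show ?case using com_const by (blast intro: com.com_const)
qed

end

lemma subst1_par: "subst1 z y (Par P Q) = Par (subst1 z y P) (subst1 z y Q)"
  by (simp add: subst1_def)

lemma alpha_subst1_fresh:
  fixes P :: "('x :: infinite, 'q :: infinite, 'k) proc"
  assumes "Inl z \<notin> fn P" shows "alpha (subst1 z y P) P"
  unfolding subst1_def by (rule alpha_subst_id) (use assms in auto)

lemma alpha_subst1_nu:
  fixes P :: "('x :: infinite, 'q :: infinite, 'k) proc"
  assumes "bname b \<noteq> Inl z" "bname b \<noteq> Inl y"
  shows "alpha (subst1 z y (Nu b P)) (Nu b (subst1 z y P))"
proof (cases b)
  case (BChan x)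
  have "alpha (subst (id(z := y)) (Nu (BChan x) P)) (Nu (BChan x) (subst ((id(z := y))(x := x)) P))"
    by (rule alpha_subst_BChan) (use assms BChan in \<open>auto simp: map_sum_def split: sum.splits if_splits\<close>)
  moreover have "(id(z := y))(x := x) = id(z := y)" using assms BChan by auto
  ultimately show ?thesis using BChan by (simp add: subst1_def)
qed (simp add: subst1_def congr_refl)

context defs begin

text \<open>Commitments up to structural congruence; by \<open>com_avoid\<close> the set of avoided names is immaterial.\<close>

definition cm :: "('x, 'q, 'k) proc \<Rightarrow> ('x, 'q, 'k) act \<Rightarrow> ('x, 'q, 'k) proc \<Rightarrow> bool" where
  "cm P \<kappa> X \<longleftrightarrow> (\<exists>P'. com D {} P \<kappa> P' \<and> scong D P' X)"

lemma cmI: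
  assumes "com D S P \<kappa> P'" "scong D P' X" shows "cm P \<kappa> X"
proof -
  obtain P'' where "com D {} P \<kappa> P''" "alpha P' P''" using com_avoid[OF assms(1), of "{}"] by auto
  then show ?thesis using assms(2) unfolding cm_def by (meson alpha_scong congr_trans congr_sym)
qed

lemma cmE:
  assumes "cm P \<kappa> X" "finite T" obtains P' where "com D T P \<kappa> P'" "scong D P' X"
proof -
  obtain P' where P': "com D {} P \<kappa> P'" "scong D P' X" using assms unfolding cm_def by blast
  obtain P'' where "com D T P \<kappa> P''" "alpha P' P''" using com_avoid[OF P'(1) assms(2)] by auto
  then show ?thesis using that P'(2) by (meson alpha_scong congr_trans congr_sym)
qed

lemma cm_scong: "cm P \<kappa> X \<Longrightarrow> scong D X Y \<Longrightarrow> cm P \<kappa> Y"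
  unfolding cm_def by (meson congr_trans)

lemma cm_perm:
  assumes "cm P \<kappa> X" "bij f" "bij g" shows "cm (perm f g P) (permk f g \<kappa>) (perm f g X)"
proof -
  obtain P' where P': "com D {} P \<kappa> P'" "scong D P' X" using assms unfolding cm_def by blast
  obtain P'' where "com D {} (perm f g P) (permk f g \<kappa>) P''" "alpha (perm f g P') P''"
    using com_perm[OF P'(1) _ assms(2,3), of "{}"] by auto
  then show ?thesis using scong_perm[OF P'(2) assms(2,3)] unfolding cm_def
    by (meson alpha_scong congr_trans congr_sym)
qed

lemma cm_alpha: "cm P \<kappa> X \<Longrightarrow> alpha P Q \<Longrightarrow> cm Q \<kappa> X"
  unfolding cm_def by (meson com_alpha alpha_scong congr_trans congr_sym)

text \<open>\<open>U\<close> holds names that no crossed binder may have, and \<open>V\<close> names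
  foreign to \<open>P\<close>, so that neither the message nor a component in parallel mentions
  them. Both are put into the avoided set, which yields the side conditions under which the relation
  \<open>\<Psi>\<close> has to be preserved.\<close>

lemma cm_snd_param:
  assumes "cm P (KSnd x z R) X"
    and "\<And>y. Inl y \<notin> V \<Longrightarrow> \<Psi> (subst1 z y R) (subst1 w y R1)"
    and "\<And>A A' B B'. \<Psi> A B \<Longrightarrow> scong D A A' \<Longrightarrow> scong D B B' \<Longrightarrow> \<Psi> A' B'"
    and "\<And>Q A B. fn Q \<inter> V = {} \<Longrightarrow> \<Psi> A B \<Longrightarrow> \<Psi> (Par Q A) (Par Q B)"
    and "\<And>c A B. bname c \<notin> U \<Longrightarrow> \<Psi> A B \<Longrightarrow> \<Psi> (Nu c A) (Nu c B)"
    and "finite U" "finite V" "fn P \<inter> V = {}"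
  shows "\<exists>Y. cm P (KSnd x w R1) Y \<and> \<Psi> X Y"
proof -
  let ?T = "U \<union> V \<union> fnk (KSnd x w R1)"
  have "finite ?T" using assms by simp
  then obtain P' where P': "com D ?T P (KSnd x z R) P'" "scong D P' X" by (rule cmE[OF assms(1)])
  have "\<exists>P1. com D ?T P (KSnd x w R1) P1 \<and> \<Psi> P' P1"
    by (rule com_snd_param[where \<Psi> = \<Psi> and U = U and V = V, OF P'(1) assms(2-5) subset_refl assms(8)])
  then obtain P1 where "com D ?T P (KSnd x w R1) P1" "\<Psi> P' P1" by blast
  then show ?thesis using cmI[OF _ congr_refl] assms(3)[OF _ P'(2) congr_refl] by blast
qed

text \<open>The transported relation is the congruence itself. At the leaf it has to hold between
  two instances of the abstractions: this is where closure of the congruence under substitution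
  enters.\<close>

lemma cm_snd_scong:
  assumes "cm P (KSnd x z R) X" "scong D R R1" shows "cm P (KSnd x z R1) X"
proof -
  have "\<exists>Y. cm P (KSnd x z R1) Y \<and> scong D X Y"
  proof (rule cm_snd_param[where U = "{}" and V = "{}", OF assms(1)])
    show "scong D (subst1 z y R) (subst1 z y R1)" for y
      unfolding subst1_def by (rule scong_subst[OF assms(2)])
    show "scong D A' B'" if "scong D A B" "scong D A A'" "scong D B B'" for A A' B B'
      using that by (meson congr_trans congr_sym)
  qed (auto intro: congr_par congr_refl congr.congr_nu)
  then show ?thesis by (meson cm_scong congr_sym)
qed

lemma scong_scope2: "bname b \<notin> fn Q \<Longrightarrow> scong D (Par Q (Nu b P)) (Nu b (Par Q P))"
  by (meson scong_scope scong_par_comm congr_nu congr_trans)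

text \<open>\<open>\<Psi> A B\<close> says that \<open>B\<close> is \<open>A\<close> with
  \<open>Q\<close> beside it. At the leaf \<open>Q\<close> stands next to the instance of
  \<open>R\<close>, and every further component or restriction can be pulled past it because the
  crossed binders avoid \<open>fn Q\<close>.\<close>

lemma cm_snd_par:
  assumes "cm P (KSnd x z R) X" "Inl z \<notin> fn Q" shows "cm P (KSnd x z (Par R Q)) (Par X Q)"
proof -
  have "\<exists>Y. cm P (KSnd x z (Par R Q)) Y \<and> scong D Y (Par X Q)"
  proof (rule cm_snd_param[where U = "fn Q" and V = "{}" and \<Psi> = "\<lambda>A B. scong D B (Par A Q)", OF assms(1)])
    show "scong D (subst1 z y (Par R Q)) (Par (subst1 z y R) Q)" for y
      unfolding subst1_par using alpha_subst1_fresh[OF assms(2)] by (intro congr_par congr_refl alpha_scong)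
    show "scong D B' (Par A' Q)" if "scong D B (Par A Q)" "scong D A A'" "scong D B B'" for A A' B B'
      using that by (meson congr_trans congr_sym congr_par congr_refl)
    show "scong D (Par Q' B) (Par (Par Q' A) Q)" if "scong D B (Par A Q)" for Q' A B
      using that by (meson congr_trans congr_sym congr_par congr_refl scong_par_assoc)
    show "scong D (Nu c B) (Par (Nu c A) Q)" if "bname c \<notin> fn Q" "scong D B (Par A Q)" for c A B
      using that by (meson congr_trans congr_sym congr_nu scong_scope)
  qed auto
  then show ?thesis using cm_scong by blast
qed

text \<open>The same transport with the two sides of \<open>\<Psi>\<close> exchanged: a component
  offered as part of the abstraction is split off the target.\<close>

lemma cm_snd_par_inv:
  assumes "cm P (KSnd x z (Par R Q)) X" "Inl z \<notin> fn Q" shows "\<exists>Y. cm P (KSnd x z R) Y \<and> scong D X (Par Y Q)"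
proof (rule cm_snd_param[where U = "fn Q" and V = "{}" and \<Psi> = "\<lambda>A B. scong D A (Par B Q)", OF assms(1)])
  show "scong D (subst1 z y (Par R Q)) (Par (subst1 z y R) Q)" for y
    unfolding subst1_par using alpha_subst1_fresh[OF assms(2)] by (intro congr_par congr_refl alpha_scong)
  show "scong D A' (Par B' Q)" if "scong D A (Par B Q)" "scong D A A'" "scong D B B'" for A A' B B'
    using that by (meson congr_trans congr_sym congr_par congr_refl)
  show "scong D (Par Q' A) (Par (Par Q' B) Q)" if "scong D A (Par B Q)" for Q' A B
    using that by (meson congr_trans congr_sym congr_par congr_refl scong_par_assoc)
  show "scong D (Nu c A) (Par (Nu c B) Q)" if "bname c \<notin> fn Q" "scong D A (Par B Q)" for c A B
    using that by (meson congr_trans congr_sym congr_nu scong_scope)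
qed auto

text \<open>Here \<open>bname b\<close> is in both sets: the message must differ from it for the
  substitution to pass \<open>Nu b\<close>, a component beside must not mention it for the scope
  law, and a crossed binder must differ from it for the swap law.\<close>

lemma cm_snd_nu:
  assumes "cm P (KSnd x z R) X" "bname b \<noteq> Inl z" "bname b \<notin> fn P"
  shows "cm P (KSnd x z (Nu b R)) (Nu b X)"
proof -
  have "\<exists>Y. cm P (KSnd x z (Nu b R)) Y \<and> scong D Y (Nu b X)"
  proof (rule cm_snd_param[where U = "{bname b}" and V = "{bname b}" and \<Psi> = "\<lambda>A B. scong D B (Nu b A)", OF assms(1)])
    show "scong D (subst1 z y (Nu b R)) (Nu b (subst1 z y R))" if "Inl y \<notin> {bname b}" for y
      by (intro alpha_scong alpha_subst1_nu) (use that assms in auto)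
    show "scong D B' (Nu b A')" if "scong D B (Nu b A)" "scong D A A'" "scong D B B'" for A A' B B'
      using that by (meson congr_trans congr_sym congr_nu)
    show "scong D (Par Q' B) (Nu b (Par Q' A))" if "fn Q' \<inter> {bname b} = {}" "scong D B (Nu b A)" for Q' A B
    proof -
      have "bname b \<notin> fn Q'" using that by auto
      then show ?thesis using that(2) by (meson congr_trans congr_par congr_refl scong_scope2)
    qed
    show "scong D (Nu c B) (Nu b (Nu c A))" if "bname c \<notin> {bname b}" "scong D B (Nu b A)" for c A B
      using that by (metis congr_trans congr_nu scong_swap singletonI)
  qed (use assms in auto)
  then show ?thesis using cm_scong by blast
qed

lemma cm_snd_nu_inv:
  assumes "cm P (KSnd x z (Nu b R)) X" "bname b \<noteq> Inl z" "bname b \<notin> fn P"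
  shows "\<exists>Y. cm P (KSnd x z R) Y \<and> scong D X (Nu b Y)"
proof (rule cm_snd_param[where U = "{bname b}" and V = "{bname b}" and \<Psi> = "\<lambda>A B. scong D A (Nu b B)", OF assms(1)])
  show "scong D (subst1 z y (Nu b R)) (Nu b (subst1 z y R))" if "Inl y \<notin> {bname b}" for y
    by (intro alpha_scong alpha_subst1_nu) (use that assms in auto)
  show "scong D A' (Nu b B')" if "scong D A (Nu b B)" "scong D A A'" "scong D B B'" for A A' B B'
    using that by (meson congr_trans congr_sym congr_nu)
  show "scong D (Par Q' A) (Nu b (Par Q' B))" if "fn Q' \<inter> {bname b} = {}" "scong D A (Nu b B)" for Q' A B
  proof -
    have "bname b \<notin> fn Q'" using that by auto
    then show ?thesis using that(2) by (meson congr_trans congr_par congr_refl scong_scope2)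
  qed
  show "scong D (Nu c A) (Nu b (Nu c B))" if "bname c \<notin> {bname b}" "scong D A (Nu b B)" for c A B
    using that by (metis congr_trans congr_nu scong_swap singletonI)
qed (use assms in auto)

lemma cm_sum: "cm (Sum M) \<kappa> X \<longleftrightarrow> (\<exists>a Q R. (a, Q) \<in># summands M \<and> leaf a Q \<kappa> R \<and> scong D R X)"
  unfolding cm_def by (blast elim: com_SumE intro: com_sum)

lemma cm_par1: "cm P \<kappa> X \<Longrightarrow> bnk \<kappa> \<inter> fn Q = {} \<Longrightarrow> cm (Par P Q) \<kappa> (Par X Q)"
  unfolding cm_def by (meson com_par1 congr_par congr_refl)

lemma cm_par2: "cm Q \<kappa> X \<Longrightarrow> bnk \<kappa> \<inter> fn P = {} \<Longrightarrow> cm (Par P Q) \<kappa> (Par P X)"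
  unfolding cm_def by (meson com_par2 congr_par congr_refl)

text \<open>Up to congruence the two abstractions need not coincide literally: the sender is offered
  the one that the receiver really leaves.\<close>

lemma cm_comL:
  assumes "cm P (KSnd x z R) X" "cm Q (KRcv x z) R" "Inl z \<notin> fn P \<union> fn Q"
  shows "cm (Par P Q) KTau X"
proof -
  obtain R' where R': "com D {} Q (KRcv x z) R'" "scong D R' R" by (rule cmE[OF assms(2) finite.emptyI])
  have "cm P (KSnd x z R') X" by (rule cm_snd_scong[OF assms(1) congr_sym[OF R'(2)]])
  then obtain X' where "com D {} P (KSnd x z R') X'" "scong D X' X" unfolding cm_def by blast
  then show ?thesis using R'(1) assms(3) by (intro cmI[where S = "{}"] com_comL) auto
qed

lemma cm_comR:
  assumes "cm P (KRcv x z) R" "cm Q (KSnd x z R) X" "Inl z \<notin> fn P \<union> fn Q"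
  shows "cm (Par P Q) KTau X"
proof -
  obtain R' where R': "com D {} P (KRcv x z) R'" "scong D R' R" by (rule cmE[OF assms(1) finite.emptyI])
  have "cm Q (KSnd x z R') X" by (rule cm_snd_scong[OF assms(2) congr_sym[OF R'(2)]])
  then obtain X' where "com D {} Q (KSnd x z R') X'" "scong D X' X" unfolding cm_def by blast
  then show ?thesis using R'(1) assms(3) by (intro cmI[where S = "{}"] com_comR) auto
qed

lemma cm_ParE:
  assumes "cm (Par P Q) \<kappa> X" "finite T"
  obtains (par1) P' where "com D T P \<kappa> P'" "bnk \<kappa> \<inter> fn Q = {}" "scong D (Par P' Q) X"
  | (par2) Q' where "com D T Q \<kappa> Q'" "bnk \<kappa> \<inter> fn P = {}" "scong D (Par P Q') X"
  | (comL) x z R P' where "\<kappa> = KTau" "com D T P (KSnd x z R) P'" "com D T Q (KRcv x z) R"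
      "Inl z \<notin> T \<union> fn P \<union> fn Q" "scong D P' X"
  | (comR) x z R Q' where "\<kappa> = KTau" "com D T P (KRcv x z) R" "com D T Q (KSnd x z R) Q'"
      "Inl z \<notin> T \<union> fn P \<union> fn Q" "scong D Q' X"
proof -
  obtain Y where "com D T (Par P Q) \<kappa> Y" "scong D Y X" by (rule cmE[OF assms])
  from this(1) show ?thesis
  proof cases
    case com_par1
    with \<open>scong D Y X\<close> show ?thesis by (intro that(1)) auto
  next
    case com_par2
    with \<open>scong D Y X\<close> show ?thesis by (intro that(2)) auto
  next
    case com_comL
    with \<open>scong D Y X\<close> show ?thesis by (intro that(3)) auto
  next
    case com_comR
    with \<open>scong D Y X\<close> show ?thesis by (intro that(4)) auto
  qed
qed

lemma cm_nu:
  assumes "cm P1 \<kappa> X" "alpha (Nu b P) (Nu c P1)" "bname c \<notin> fnk \<kappa>" shows "cm (Nu b P) \<kappa> (Nu c X)"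
proof -
  obtain Y where "com D {bname c} P1 \<kappa> Y" "scong D Y X" using cmE[OF assms(1), of "{bname c}"] by auto
  then show ?thesis using assms by (intro cmI[where S = "{}", OF com_nu]) (auto intro: congr_nu)
qed

lemma cm_NuE:
  assumes "cm (Nu b P) \<kappa> X" "finite T"
  obtains c P1 P' where "com D (insert (bname c) T) P1 \<kappa> P'" "alpha (Nu b P) (Nu c P1)"
    "bname c \<notin> T \<union> fnk \<kappa>" "scong D (Nu c P') X"
proof -
  obtain Y where "com D T (Nu b P) \<kappa> Y" "scong D Y X" by (rule cmE[OF assms])
  from this(1) show ?thesis
  proof cases
    case com_nu
    with \<open>scong D Y X\<close> show ?thesis by (intro that) auto
  qed
qed

lemma cm_const: "unfolds D A ys B \<Longrightarrow> cm (Const A ys) \<kappa> X \<longleftrightarrow> cm B \<kappa> X"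
proof
  assume u: "unfolds D A ys B" and "cm (Const A ys) \<kappa> X"
  then obtain P' where P': "com D {} (Const A ys) \<kappa> P'" "scong D P' X" unfolding cm_def by blast
  from P'(1) obtain B0 B' where "com D {} B' \<kappa> P'" "unfolds D A ys B0" "alpha B0 B'" by (auto elim: com_ConstE)
  then have "cm B' \<kappa> X" "alpha B B'" using P'(2) unfolds_det[OF u] unfolding cm_def by auto
  then show "cm B \<kappa> X" by (meson cm_alpha congr_sym)
next
  assume u: "unfolds D A ys B" and "cm B \<kappa> X"
  then show "cm (Const A ys) \<kappa> X" unfolding cm_def using com_const[OF _ u congr_refl] by blast
qed

end

declare congr_trans [trans]

context defs begin

text \<open>With \<open>0\<close> put in parallel, the scope can be narrowed to \<open>0\<close>,
  where the restriction disappears.\<close>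

lemma scong_nu_vacuous:
  assumes "bname b \<notin> fn P" shows "scong D (Nu b P) P"
proof -
  have "scong D (Nu b P) (Nu b (Par (Sum Zero) P))"
    by (meson congr_nu congr_sym congr_trans scong_par_comm scong_par_zero)
  also have "scong D (Nu b (Par (Sum Zero) P)) (Par (Nu b (Sum Zero)) P)"
    using congr_sym[OF scong_scope[OF assms]] .
  also have "scong D (Par (Nu b (Sum Zero)) P) P"
    by (meson congr_par congr_refl scong_nu_zero congr_trans scong_par_comm scong_par_zero)
  finally show ?thesis .
qed

section \<open>Commitments are invariant under structural congruence\<close>

text \<open>The exceptional set \<open>U\<close> constrains only labels \<open>KRcv x z\<close>: the
  name \<open>z\<close> might clash with a component of \<open>Q\<close>, although the commitment
  would be possible with another bound name. For the other labels \<open>bnk\<close> is empty and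
  the inclusion is unconditional.\<close>

definition csim :: "('x + 'q) set \<Rightarrow> ('x, 'q, 'k) proc \<Rightarrow> ('x, 'q, 'k) proc \<Rightarrow> bool" where
  "csim U P Q \<longleftrightarrow> (\<forall>\<kappa> X. bnk \<kappa> \<inter> U = {} \<longrightarrow> cm P \<kappa> X \<longrightarrow> cm Q \<kappa> X)"

lemma csimD: "csim U P Q \<Longrightarrow> bnk \<kappa> \<inter> U = {} \<Longrightarrow> cm P \<kappa> X \<Longrightarrow> cm Q \<kappa> X"
  by (auto simp: csim_def)

lemma csim_mono: "csim U P Q \<Longrightarrow> U \<subseteq> U' \<Longrightarrow> csim U' P Q"
  unfolding csim_def by blast

lemma csim_trans: "csim U P Q \<Longrightarrow> csim V Q R \<Longrightarrow> csim (U \<union> V) P R"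
  unfolding csim_def by (simp add: Int_Un_distrib)

text \<open>Congruence of \<open>P\<close> and \<open>P1\<close> is assumed besides the simulation
  because, when only \<open>Q\<close> moves, \<open>P\<close> itself remains in the target.\<close>

lemma csim_par1:
  assumes "csim U P P1" "finite U" "scong D P P1"
  shows "csim (U \<union> fn P \<union> fn Q \<union> fn P1) (Par P Q) (Par P1 Q)" (is "csim ?U _ _")
  unfolding csim_def
proof (intro allI impI)
  fix \<kappa> X assume bn: "bnk \<kappa> \<inter> ?U = {}" and cm: "cm (Par P Q) \<kappa> X"
  then have bn': "bnk \<kappa> \<inter> U = {}" "bnk \<kappa> \<inter> fn P1 = {}" "bnk \<kappa> \<inter> fn Q = {}" by blast+
  have sim: "cm P1 \<kappa> Y" if "com D S P \<kappa> Y" "bnk \<kappa> \<inter> U = {}" for S \<kappa> Y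
    by (rule csimD[OF assms(1) that(2) cmI[OF that(1) congr_refl]])
  have "finite ?U" using assms by simp
  with cm show "cm (Par P1 Q) \<kappa> X"
  proof (cases rule: cm_ParE)
    case (par1 P')
    show ?thesis by (rule cm_scong[OF cm_par1[OF sim[OF par1(1) bn'(1)] bn'(3)] par1(3)])
  next
    case (par2 Q')
    have "cm (Par P1 Q) \<kappa> (Par P1 Q')" by (rule cm_par2[OF cmI[OF par2(1) congr_refl] bn'(2)])
    moreover have "scong D (Par P1 Q') X" using par2(3) assms(3) by (meson congr_par congr_refl congr_sym congr_trans)
    ultimately show ?thesis by (rule cm_scong)
  next
    case (comL x z R P')
    have "cm P1 (KSnd x z R) P'" by (rule sim[OF comL(2)]) simp
    then show ?thesis unfolding comL(1)
      using comL(4) by (intro cm_scong[OF cm_comL[OF _ cmI[OF comL(3) congr_refl]] comL(5)]) auto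
  next
    case (comR x z R Q')
    have "cm P1 (KRcv x z) R" by (rule sim[OF comR(2)]) (use comR(4) in simp)
    then show ?thesis unfolding comR(1)
      using comR(4) by (intro cm_scong[OF cm_comR[OF _ cmI[OF comR(3) congr_refl]] comR(5)]) auto
  qed
qed

lemma csim_alpha: "alpha P Q \<Longrightarrow> csim {} P Q"
  unfolding csim_def using cm_alpha by blast

lemma csim_par_comm: "csim {} (Par P Q) (Par Q P)"
  unfolding csim_def
proof (intro allI impI)
  fix \<kappa> X assume cm: "cm (Par P Q) \<kappa> X"
  have s: "scong D (Par A B) X" if "scong D (Par B A) X" for A B
    by (rule congr_trans[OF scong_par_comm that])
  from cm finite.emptyI show "cm (Par Q P) \<kappa> X"
  proof (cases rule: cm_ParE)
    case (par1 P')
    show ?thesis by (rule cm_scong[OF cm_par2[OF cmI[OF par1(1) congr_refl] par1(2)] s[OF par1(3)]])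
  next
    case (par2 Q')
    show ?thesis by (rule cm_scong[OF cm_par1[OF cmI[OF par2(1) congr_refl] par2(2)] s[OF par2(3)]])
  next
    case (comL x z R P')
    then show ?thesis unfolding comL(1)
      by (intro cm_scong[OF cm_comR[OF cmI[OF comL(3) congr_refl] cmI[OF comL(2) congr_refl]] comL(5)]) auto
  next
    case (comR x z R Q')
    then show ?thesis unfolding comR(1)
      by (intro cm_scong[OF cm_comL[OF cmI[OF comR(3) congr_refl] cmI[OF comR(2) congr_refl]] comR(5)]) auto
  qed
qed

lemma csim_par2:
  assumes "csim U P P1" "finite U" "scong D P P1"
  shows "csim (U \<union> fn P \<union> fn Q \<union> fn P1) (Par Q P) (Par Q P1)"
  using csim_trans[OF csim_trans[OF csim_par_comm csim_par1[OF assms]] csim_par_comm] by simp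

text \<open>The delicate cases are communications in which the third component changes sides. It is
  either added to the abstraction that the sender is offered (\<open>cm_snd_par\<close>) or split
  off from it (\<open>cm_snd_par_inv\<close>).\<close>

lemma csim_par_assoc: "csim (fn P \<union> fn Q \<union> fn R) (Par (Par P Q) R) (Par P (Par Q R))" (is "csim ?U _ _")
  unfolding csim_def
proof (intro allI impI)
  fix \<kappa> X assume bn: "bnk \<kappa> \<inter> ?U = {}" and cm: "cm (Par (Par P Q) R) \<kappa> X"
  then have bn': "bnk \<kappa> \<inter> fn P = {}" "bnk \<kappa> \<inter> fn Q = {}" "bnk \<kappa> \<inter> fn R = {}" by blast+
  have I: "cm A \<kappa>' Y" if "com D S A \<kappa>' Y" for A \<kappa>' Y S by (rule cmI[OF that congr_refl])
  have fin: "finite ?U" by simp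
  have as: "scong D (Par A (Par B C)) X" if "scong D (Par (Par A B) C) X" for A B C X
    by (rule congr_trans[OF congr_sym[OF scong_par_assoc] that])
  show "cm (Par P (Par Q R)) \<kappa> X"
  proof (rule cm_ParE[OF cm fin])
    fix W assume W: "com D ?U (Par P Q) \<kappa> W" "scong D (Par W R) X"
    show ?thesis
    proof (rule cm_ParE[OF I[OF W(1)] fin])
      fix P' assume P': "com D ?U P \<kappa> P'" "scong D (Par P' Q) W"
      have "scong D (Par (Par P' Q) R) X" by (rule congr_trans[OF congr_par[OF P'(2) congr_refl] W(2)])
      then show ?thesis using bn' by (intro cm_scong[OF cm_par1[OF I[OF P'(1)]] as]) auto
    next
      fix Q' assume Q': "com D ?U Q \<kappa> Q'" "scong D (Par P Q') W"
      have "scong D (Par (Par P Q') R) X" by (rule congr_trans[OF congr_par[OF Q'(2) congr_refl] W(2)])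
      then show ?thesis using bn' by (intro cm_scong[OF cm_par2[OF cm_par1[OF I[OF Q'(1)]]] as]) auto
    next
      fix x z B P' assume k: "\<kappa> = KTau" and P': "com D ?U P (KSnd x z B) P'" and Q': "com D ?U Q (KRcv x z) B"
        and z: "Inl z \<notin> ?U \<union> fn P \<union> fn Q" and W': "scong D P' W"
      have "cm (Par Q R) (KRcv x z) (Par B R)" using z by (intro cm_par1 I[OF Q']) auto
      moreover have "cm P (KSnd x z (Par B R)) (Par P' R)" using z by (intro cm_snd_par I[OF P']) auto
      ultimately have "cm (Par P (Par Q R)) KTau (Par P' R)" using z by (intro cm_comL) auto
      then show ?thesis unfolding k by (rule cm_scong) (rule congr_trans[OF congr_par[OF W' congr_refl] W(2)])
    next
      fix x z B Q' assume k: "\<kappa> = KTau" and P': "com D ?U P (KRcv x z) B" and Q': "com D ?U Q (KSnd x z B) Q'"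
        and z: "Inl z \<notin> ?U \<union> fn P \<union> fn Q" and W': "scong D Q' W"
      have "cm (Par Q R) (KSnd x z B) (Par Q' R)" by (intro cm_par1 I[OF Q']) auto
      then have "cm (Par P (Par Q R)) KTau (Par Q' R)" using z by (intro cm_comR[OF I[OF P']]) auto
      then show ?thesis unfolding k by (rule cm_scong) (rule congr_trans[OF congr_par[OF W' congr_refl] W(2)])
    qed
  next
    fix R' assume R': "com D ?U R \<kappa> R'" "scong D (Par (Par P Q) R') X"
    then show ?thesis using bn' by (intro cm_scong[OF cm_par2[OF cm_par2[OF I[OF R'(1)]]] as]) auto
  next
    fix x z B W assume k: "\<kappa> = KTau" and W: "com D ?U (Par P Q) (KSnd x z B) W" and R': "com D ?U R (KRcv x z) B"
      and z: "Inl z \<notin> ?U \<union> fn (Par P Q) \<union> fn R" and X: "scong D W X"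
    show ?thesis
    proof (rule cm_ParE[OF I[OF W] fin])
      fix P' assume P': "com D ?U P (KSnd x z B) P'" and W': "scong D (Par P' Q) W"
      \<comment> \<open>\<open>P\<close> sends to \<open>R\<close>. After reassociation the receiver
        is \<open>Q | R\<close>, so \<open>Q\<close> has to become part of the abstraction.\<close>
      have "cm P (KSnd x z (Par B Q)) (Par P' Q)" using z by (intro cm_snd_par[OF I[OF P']]) auto
      then have "cm P (KSnd x z (Par Q B)) (Par P' Q)" by (rule cm_snd_scong) (rule scong_par_comm)
      moreover have "cm (Par Q R) (KRcv x z) (Par Q B)" using z by (intro cm_par2 I[OF R']) auto
      ultimately have "cm (Par P (Par Q R)) KTau (Par P' Q)" using z by (intro cm_comL) auto
      then show ?thesis unfolding k by (rule cm_scong) (rule congr_trans[OF W' X])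
    next
      fix Q' assume Q': "com D ?U Q (KSnd x z B) Q'" and W': "scong D (Par P Q') W"
      have "cm (Par Q R) KTau Q'" using z by (intro cm_comL[OF I[OF Q'] I[OF R']]) auto
      then have "cm (Par P (Par Q R)) KTau (Par P Q')" by (intro cm_par2) auto
      then show ?thesis unfolding k by (rule cm_scong) (rule congr_trans[OF W' X])
    qed auto
  next
    fix x z B R' assume k: "\<kappa> = KTau" and W: "com D ?U (Par P Q) (KRcv x z) B" and R': "com D ?U R (KSnd x z B) R'"
      and z: "Inl z \<notin> ?U \<union> fn (Par P Q) \<union> fn R" and X: "scong D R' X"
    show ?thesis
    proof (rule cm_ParE[OF I[OF W] fin])
      fix P' assume P': "com D ?U P (KRcv x z) P'" and W': "scong D (Par P' Q) B"
      \<comment> \<open>Conversely, \<open>R\<close> was offered an abstraction that contains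
        \<open>Q\<close>. After reassociation \<open>Q\<close> stands on the side of the sender and
        is split off.\<close>
      have "cm R (KSnd x z (Par P' Q)) R'" by (rule cm_snd_scong[OF I[OF R'] congr_sym[OF W']])
      moreover have zQ: "Inl z \<notin> fn Q" using z by auto
      ultimately obtain Y where Y: "cm R (KSnd x z P') Y" "scong D R' (Par Y Q)"
        using cm_snd_par_inv by blast
      have "cm (Par Q R) (KSnd x z P') (Par Q Y)" by (rule cm_par2[OF Y(1)]) simp
      then have "cm (Par P (Par Q R)) KTau (Par Q Y)" using z by (intro cm_comR[OF I[OF P']]) auto
      moreover have "scong D (Par Q Y) X" using Y(2) X scong_par_comm by (meson congr_trans congr_sym)
      ultimately show ?thesis unfolding k by (rule cm_scong)
    next
      fix Q' assume Q': "com D ?U Q (KRcv x z) Q'" and W': "scong D (Par P Q') B"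
      have "scong D B (Par Q' P)" using W' scong_par_comm by (meson congr_trans congr_sym)
      then have "cm R (KSnd x z (Par Q' P)) R'" by (rule cm_snd_scong[OF I[OF R']])
      moreover have zP: "Inl z \<notin> fn P" using z by auto
      ultimately obtain Y where Y: "cm R (KSnd x z Q') Y" "scong D R' (Par Y P)"
        using cm_snd_par_inv by blast
      have "cm (Par Q R) KTau Y" using z by (intro cm_comR[OF I[OF Q'] Y(1)]) auto
      then have "cm (Par P (Par Q R)) KTau (Par P Y)" by (intro cm_par2) auto
      moreover have "scong D (Par P Y) X" using Y(2) X scong_par_comm by (meson congr_trans congr_sym)
      ultimately show ?thesis unfolding k by (rule cm_scong)
    qed auto
  qed
qed

text \<open>Commutativity rotates the three components, so that two uses of the direction already
  proved give the other one.\<close>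

lemma csim_par_assoc2: "csim (fn P \<union> fn Q \<union> fn R) (Par P (Par Q R)) (Par (Par P Q) R)"
proof -
  have "csim ({} \<union> (fn Q \<union> fn R \<union> fn P) \<union> {} \<union> (fn R \<union> fn P \<union> fn Q) \<union> {}) (Par P (Par Q R)) (Par (Par P Q) R)"
    by (intro csim_trans[where Q = "Par R (Par P Q)"] csim_trans[where Q = "Par (Par R P) Q"]
      csim_trans[where Q = "Par Q (Par R P)"] csim_trans[where Q = "Par (Par Q R) P"] csim_par_comm csim_par_assoc)
  then show ?thesis by (rule csim_mono) auto
qed

lemma com_nil: "\<not> com D S (Sum Zero) \<kappa> P'"
  by (auto elim!: com_SumE)

lemma csim_par_zero: "csim {} (Par P (Sum Zero)) P"
  unfolding csim_def
proof (intro allI impI)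
  fix \<kappa> X assume cm: "cm (Par P (Sum Zero)) \<kappa> X"
  from cm finite.emptyI show "cm P \<kappa> X"
  proof (cases rule: cm_ParE)
    case (par1 P')
    show ?thesis by (rule cmI[OF par1(1) congr_trans[OF congr_sym[OF scong_par_zero] par1(3)]])
  qed (auto simp: com_nil)
qed

lemma csim_par_zero2: "csim {} P (Par P (Sum Zero))"
  unfolding csim_def using cm_par1[of P _ _ "Sum Zero"] cm_scong[OF _ scong_par_zero] by auto

lemma alpha_Nu_fn:
  fixes P :: "('x, 'q, 'k) proc"
  assumes "alpha (Nu b P) (Nu c P1)" shows "fn P1 \<subseteq> insert (bname c) (fn (Nu b P))"
  unfolding alpha_fn[OF assms] by auto

text \<open>The derivation for \<open>Nu b P\<close> may go through another binder \<open>c\<close>,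
  and \<open>Nu b (Par P Q)\<close> is renamed to match it. If the restricted side receives, the
  restriction is part of the abstraction offered to \<open>Q\<close> and has to be brought around
  the whole communication.\<close>

lemma csim_scope:
  assumes b: "bname b \<notin> fn Q"
  shows "csim (fn P \<union> fn Q) (Par (Nu b P) Q) (Nu b (Par P Q))"
  unfolding csim_def
proof (intro allI impI)
  let ?U = "fn P \<union> fn Q"
  fix \<kappa> X assume bn: "bnk \<kappa> \<inter> ?U = {}" and cm: "cm (Par (Nu b P) Q) \<kappa> X"
  then have bn': "bnk \<kappa> \<inter> fn P = {}" "bnk \<kappa> \<inter> fn Q = {}" by blast+
  have I: "cm A \<kappa>' Y" if "com D S A \<kappa>' Y" for A \<kappa>' Y S by (rule cmI[OF that congr_refl])
  have fin: "finite ?U" by simp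
  have al: "alpha (Nu b (Par P Q)) (Nu c (Par P1 Q))" if "alpha (Nu b P) (Nu c P1)" "bname c \<notin> fn Q" for c P1
    by (rule alpha_Nu_cong_Par[OF that(1) b that(2)])
  show "cm (Nu b (Par P Q)) \<kappa> X"
  proof (rule cm_ParE[OF cm fin])
    fix W assume W: "com D ?U (Nu b P) \<kappa> W" "scong D (Par W Q) X"
    show ?thesis
    proof (rule cm_NuE[OF I[OF W(1)] fin])
      fix c P1 P' assume P1: "com D (insert (bname c) ?U) P1 \<kappa> P'" and a: "alpha (Nu b P) (Nu c P1)"
        and c: "bname c \<notin> ?U \<union> fnk \<kappa>" and W': "scong D (Nu c P') W"
      have "cm (Nu b (Par P Q)) \<kappa> (Nu c (Par P' Q))"
        by (rule cm_nu[OF cm_par1[OF I[OF P1] bn'(2)] al[OF a]]) (use c in auto)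
      moreover have "scong D (Par (Nu c P') Q) X" by (rule congr_trans[OF congr_par[OF W' congr_refl] W(2)])
      then have "scong D (Nu c (Par P' Q)) X" using c scong_scope by (metis UnI1 UnI2 congr_sym congr_trans)
      ultimately show ?thesis by (rule cm_scong)
    qed
  next
    fix Q' assume Q': "com D ?U Q \<kappa> Q'" "scong D (Par (Nu b P) Q') X"
    \<comment> \<open>Only \<open>Q\<close> moves, so the binder is free to choose. Its target
      \<open>Q'\<close> may contain names from the label, hence \<open>c\<close> avoids these
      too.\<close>
    obtain c where c: "like b c" "bname c \<notin> ?U \<union> fnk \<kappa> \<union> fn Q'"
      using fresh_like[of "?U \<union> fnk \<kappa> \<union> fn Q'" b] by auto
    have a: "alpha (Nu b P) (Nu c (ren b c P))" by (rule alpha_ren[OF c(1)]) (use c in auto)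
    have "bnk \<kappa> \<inter> fn (ren b c P) = {}"
      using fn_ren_subset[OF c(1), of P] c(2) bn' resk_subset(2)[of \<kappa>] by auto
    then have "cm (Nu b (Par P Q)) \<kappa> (Nu c (Par (ren b c P) Q'))"
      by (intro cm_nu[OF cm_par2[OF I[OF Q'(1)]] al[OF a]]) (use c in auto)
    moreover have "scong D (Nu c (Par (ren b c P) Q')) (Par (Nu b P) Q')"
      using c(2) a by (meson UnI2 alpha_scong congr_par congr_refl congr_sym congr_trans scong_scope)
    ultimately show ?thesis using Q'(2) cm_scong congr_trans by metis
  next
    fix x z B W assume k: "\<kappa> = KTau" and W: "com D ?U (Nu b P) (KSnd x z B) W" and Q': "com D ?U Q (KRcv x z) B"
      and z: "Inl z \<notin> ?U \<union> fn (Nu b P) \<union> fn Q" and X: "scong D W X"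
    show ?thesis
    proof (rule cm_NuE[OF I[OF W] fin])
      fix c P1 P' assume P1: "com D (insert (bname c) ?U) P1 (KSnd x z B) P'" and a: "alpha (Nu b P) (Nu c P1)"
        and c: "bname c \<notin> ?U \<union> fnk (KSnd x z B)" and W': "scong D (Nu c P') W"
      have "Inl z \<notin> fn P1" using subsetD[OF alpha_Nu_fn[OF a], of "Inl z"] c z by auto
      then have "cm (Par P1 Q) KTau P'" using z by (intro cm_comL[OF I[OF P1] I[OF Q']]) auto
      then have "cm (Nu b (Par P Q)) KTau (Nu c P')" by (rule cm_nu[OF _ al[OF a]]) (use c in auto)
      then show ?thesis unfolding k by (rule cm_scong) (rule congr_trans[OF W' X])
    qed
  next
    fix x z B Q' assume k: "\<kappa> = KTau" and W: "com D ?U (Nu b P) (KRcv x z) B" and Q': "com D ?U Q (KSnd x z B) Q'"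
      and z: "Inl z \<notin> ?U \<union> fn (Nu b P) \<union> fn Q" and X: "scong D Q' X"
    show ?thesis
    proof (rule cm_NuE[OF I[OF W] fin])
      fix c P1 P' assume P1: "com D (insert (bname c) ?U) P1 (KRcv x z) P'" and a: "alpha (Nu b P) (Nu c P1)"
        and c: "bname c \<notin> ?U \<union> fnk (KRcv x z)" and W': "scong D (Nu c P') B"
      have "cm Q (KSnd x z (Nu c P')) Q'" by (rule cm_snd_scong[OF I[OF Q'] congr_sym[OF W']])
      then have "\<exists>Y. cm Q (KSnd x z P') Y \<and> scong D Q' (Nu c Y)" by (rule cm_snd_nu_inv) (use c in auto)
      then obtain Y where Y: "cm Q (KSnd x z P') Y" "scong D Q' (Nu c Y)" by blast
      have "Inl z \<notin> fn P1" using subsetD[OF alpha_Nu_fn[OF a], of "Inl z"] c z by auto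
      then have "cm (Par P1 Q) KTau Y" using z by (intro cm_comR[OF I[OF P1] Y(1)]) auto
      then have "cm (Nu b (Par P Q)) KTau (Nu c Y)" by (rule cm_nu[OF _ al[OF a]]) (use c in auto)
      then show ?thesis unfolding k by (rule cm_scong) (rule congr_trans[OF congr_sym[OF Y(2)] X])
    qed
  qed
qed

lemma csim_scope2:
  assumes b: "bname b \<notin> fn Q"
  shows "csim (fn P \<union> fn Q) (Nu b (Par P Q)) (Par (Nu b P) Q)"
  unfolding csim_def
proof (intro allI impI)
  let ?U = "fn P \<union> fn Q"
  fix \<kappa> X assume bn: "bnk \<kappa> \<inter> ?U = {}" and cm: "cm (Nu b (Par P Q)) \<kappa> X"
  then have bn': "bnk \<kappa> \<inter> fn P = {}" "bnk \<kappa> \<inter> fn Q = {}" by blast+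
  have I: "cm A \<kappa>' Y" if "com D S A \<kappa>' Y" for A \<kappa>' Y S by (rule cmI[OF that congr_refl])
  have fin: "finite ?U" by simp
  show "cm (Par (Nu b P) Q) \<kappa> X"
  proof (rule cm_NuE[OF cm fin])
    fix c W Y assume W: "com D (insert (bname c) ?U) W \<kappa> Y" "alpha (Nu b (Par P Q)) (Nu c W)"
      and c: "bname c \<notin> ?U \<union> fnk \<kappa>" and X: "scong D (Nu c Y) X"
    have lk: "like b c" using W(2) by (auto elim: alpha_Nu_inv)
    let ?P = "ren b c P"
    have "alpha (ren b c (Par P Q)) W" using W(2) by (auto elim: alpha_Nu_inv)
    moreover have "ren b c (Par P Q) = Par ?P (ren b c Q)" using lk by (cases b; cases c) auto
    moreover have "alpha (ren b c Q) Q" by (rule alpha_ren_fresh[OF lk b]) (use c in auto)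
    ultimately have "alpha W (Par ?P Q)" by (metis congr_par congr_refl congr_sym congr_trans)
    then have cm': "cm (Par ?P Q) \<kappa> Y" by (rule cm_alpha[OF I[OF W(1)]])
    have a: "alpha (Nu b P) (Nu c ?P)" by (rule alpha_ren[OF lk]) (use c in auto)
    have fnP: "fn ?P \<subseteq> insert (bname c) (fn P - {bname b})" by (rule fn_ren_subset[OF lk]) (use c in auto)
    let ?T = "insert (bname c) (?U \<union> fnk \<kappa>)"
    have finT: "finite ?T" by simp
    show ?thesis
    proof (rule cm_ParE[OF cm' finT])
      fix P' assume P': "com D ?T ?P \<kappa> P'" "scong D (Par P' Q) Y"
      have "cm (Par (Nu b P) Q) \<kappa> (Par (Nu c P') Q)"
        by (rule cm_par1[OF cm_nu[OF I[OF P'(1)] a] bn'(2)]) (use c in auto)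
      moreover have "scong D (Par (Nu c P') Q) X"
        using c P'(2) X by (meson UnI1 UnI2 congr_nu congr_trans scong_scope)
      ultimately show ?thesis by (rule cm_scong)
    next
      fix Q' assume Q': "com D ?T Q \<kappa> Q'" "scong D (Par ?P Q') Y"
      have "fn Q' \<subseteq> fn Q \<union> resk \<kappa>" using com_fn[OF Q'(1)] by blast
      then have cQ: "bname c \<notin> fn Q'" using c resk_subset(1)[of \<kappa>] by auto
      have "cm (Par (Nu b P) Q) \<kappa> (Par (Nu b P) Q')"
        by (rule cm_par2[OF I[OF Q'(1)]]) (use bn' in auto)
      moreover have "scong D (Par (Nu b P) Q') X"
        by (rule congr_trans[OF congr_par[OF alpha_scong[OF a] congr_refl]
            congr_trans[OF scong_scope[OF cQ] congr_trans[OF congr_nu[OF Q'(2)] X]]])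
      ultimately show ?thesis by (rule cm_scong)
    next
      fix x z B P' assume k: "\<kappa> = KTau" and P': "com D ?T ?P (KSnd x z B) P'" and Q': "com D ?T Q (KRcv x z) B"
        and z: "Inl z \<notin> ?T \<union> fn ?P \<union> fn Q" and Y: "scong D P' Y"
      \<comment> \<open>The abstraction comes from \<open>Q\<close>, which does not mention
        \<open>c\<close>; hence this label can pass the binder.\<close>
      have x: "Inl x \<in> fn Q" and B: "fn B \<subseteq> fn Q \<union> {Inl z}" using com_fn[OF Q'] by auto
      have "cm (Nu b P) (KSnd x z B) (Nu c P')"
        by (rule cm_nu[OF I[OF P'] a]) (use x B z c in auto)
      then have "cm (Par (Nu b P) Q) KTau (Nu c P')"
        using z by (intro cm_comL[OF _ I[OF Q']]) auto
      then show ?thesis unfolding k by (rule cm_scong) (rule congr_trans[OF congr_nu[OF Y] X])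
    next
      fix x z B Q' assume k: "\<kappa> = KTau" and P': "com D ?T ?P (KRcv x z) B" and Q': "com D ?T Q (KSnd x z B) Q'"
        and z: "Inl z \<notin> ?T \<union> fn ?P \<union> fn Q" and Y: "scong D Q' Y"
      have x: "Inl x \<in> fn Q" using com_fn[OF Q'] by auto
      have "cm (Nu b P) (KRcv x z) (Nu c B)"
        by (rule cm_nu[OF I[OF P'] a]) (use x z c in auto)
      \<comment> \<open>The receiver now acts from under the restriction, so the sender must be
        offered the restricted abstraction.\<close>
      moreover have "cm Q (KSnd x z (Nu c B)) (Nu c Q')"
        by (rule cm_snd_nu[OF I[OF Q']]) (use z c in auto)
      ultimately have "cm (Par (Nu b P) Q) KTau (Nu c Q')"
        using z by (intro cm_comR) auto
      then show ?thesis unfolding k by (rule cm_scong) (rule congr_trans[OF congr_nu[OF Y] X])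
    qed
  qed
qed

end

lemma ren_Nu:
  assumes "like b c" "bname d \<noteq> bname b" "bname d \<noteq> bname c"
  shows "ren b c (Nu d P) = Nu d (ren b c P)"
  using assms by (cases b; cases c; cases d) (auto simp: transpose_def)

text \<open>The result of a communication does not depend on the name that was chosen to bind the
  message.\<close>

lemma alpha_subst1_ren:
  fixes P :: "('x :: infinite, 'q :: infinite, 'k) proc"
  assumes "Inl w \<notin> fn P - {Inl z}"
  shows "alpha (subst1 w y (ren (BChan z) (BChan w) P)) (subst1 z y P)"
proof -
  have lk: "like (BChan z) (BChan w)" by simp
  have "db (subst1 w y (ren (BChan z) (BChan w) P)) 0 (Inl :: 'x + 'q \<Rightarrow> ('x + 'q) + nat) = db (subst1 z y P) 0 Inl"
    unfolding subst1_def db_subst db_ren[OF lk]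
  proof (rule db_cong)
    fix n assume "n \<in> fn P"
    then show "((Inl \<circ> map_sum (id(w := y)) id) \<circ> transpose (bname (BChan z)) (bname (BChan w))) n
       = (Inl \<circ> map_sum (id(z := y)) id) n"
      using assms by (cases n) (auto simp: transpose_def)
  qed
  then show ?thesis by (simp add: alpha_iff_db)
qed

context defs begin

lemma csim_swap:
  assumes bc: "bname b \<noteq> bname c" shows "csim {} (Nu b (Nu c P)) (Nu c (Nu b P))"
  unfolding csim_def
proof (intro allI impI)
  fix \<kappa> X assume cm: "cm (Nu b (Nu c P)) \<kappa> X"
  have I: "cm A \<kappa>' Y" if "com D S A \<kappa>' Y" for A \<kappa>' Y S by (rule cmI[OF that congr_refl])
  let ?T = "fn P \<union> {bname b, bname c}"
  have "finite ?T" by simp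
  then obtain b' W Y where W: "com D (insert (bname b') ?T) W \<kappa> Y" "alpha (Nu b (Nu c P)) (Nu b' W)"
    and b': "bname b' \<notin> ?T \<union> fnk \<kappa>" and X: "scong D (Nu b' Y) X"
    by (rule cm_NuE[OF cm])
  have lb: "like b b'" and "alpha (ren b b' (Nu c P)) W" using W(2) by (auto elim: alpha_Nu_inv)
  then have "alpha W (Nu c (ren b b' P))" using ren_Nu[OF lb] bc b' congr_sym by (metis UnI1 UnI2 insertCI)
  then have cm2: "cm (Nu c (ren b b' P)) \<kappa> Y" by (rule cm_alpha[OF I[OF W(1)]])
  let ?P1 = "ren b b' P"
  let ?T2 = "insert (bname b') ?T"
  have "finite ?T2" by simp
  then obtain c' P2 Z where Z: "com D (insert (bname c') ?T2) P2 \<kappa> Z" "alpha (Nu c ?P1) (Nu c' P2)"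
    and c': "bname c' \<notin> ?T2 \<union> fnk \<kappa>" and Y: "scong D (Nu c' Z) Y"
    by (rule cm_NuE[OF cm2])
  have lc: "like c c'" and P2: "alpha (ren c c' ?P1) P2" using Z(2) by (auto elim: alpha_Nu_inv)
  have "alpha (Nu b P) (Nu b' ?P1)" using b' by (intro alpha_ren[OF lb]) auto
  then have a1: "alpha (Nu c (Nu b P)) (Nu c (Nu b' ?P1))" by (rule congr_nu)
  have "alpha (Nu c (Nu b' ?P1)) (Nu c' (ren c c' (Nu b' ?P1)))"
    using alpha_fn[OF Z(2)] c' by (intro alpha_ren[OF lc]) auto
  moreover have "ren c c' (Nu b' ?P1) = Nu b' (ren c c' ?P1)"
    by (rule ren_Nu[OF lc]) (use b' c' in auto)
  ultimately have a2: "alpha (Nu c (Nu b P)) (Nu c' (Nu b' P2))"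
    using a1 P2 by (metis congr_nu congr_trans)
  have "cm (Nu b' P2) \<kappa> (Nu b' Z)" by (rule cm_nu[OF I[OF Z(1)] congr_refl]) (use b' in auto)
  then have "cm (Nu c (Nu b P)) \<kappa> (Nu c' (Nu b' Z))" by (rule cm_nu[OF _ a2]) (use c' in auto)
  moreover have "scong D (Nu c' (Nu b' Z)) (Nu b' (Nu c' Z))" by (rule scong_swap) (use c' in auto)
  then have "scong D (Nu c' (Nu b' Z)) X" by (rule congr_trans) (rule congr_trans[OF congr_nu[OF Y] X])
  ultimately show "cm (Nu c (Nu b P)) \<kappa> X" by (rule cm_scong)
qed

lemma csim_nu_zero: "csim {} (Nu b (Sum Zero)) (Sum Zero)"
  unfolding csim_def
proof (intro allI impI)
  fix \<kappa> X assume cm: "cm (Nu b (Sum Zero)) \<kappa> X"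
  obtain c W Y where W: "com D (insert (bname c) {}) W \<kappa> Y" "alpha (Nu b (Sum Zero)) (Nu c W)"
    by (rule cm_NuE[OF cm finite.emptyI])
  have "alpha (ren b c (Sum Zero)) W" using W(2) by (auto elim: alpha_Nu_inv)
  moreover have "ren b c (Sum Zero) = Sum Zero" by (cases b; cases c) auto
  ultimately have "alpha W (Sum Zero)" by (metis congr_sym)
  then show "cm (Sum Zero) \<kappa> X" using com_alpha[OF W(1)] com_nil by blast
qed

lemma csim_zero: "csim {} (Sum Zero) P"
  unfolding csim_def cm_def using com_nil by blast

lemma csim_sum: "set_mset (summands M) \<subseteq> set_mset (summands N) \<Longrightarrow> csim {} (Sum M) (Sum N)"
  unfolding csim_def cm_sum by blast

text \<open>Prefixes \<open>(\<lambda>)\<close> and \<open>(q)\<close> have no commitments, so both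
  sides commit through \<open>M\<close> alone. The binder that remains around the target is chosen
  fresh for it and is dropped as vacuous.\<close>

lemma csim_delay:
  assumes q: "Inr q \<notin> fn_summ M \<union> fn P"
  shows "csim {} (Sum (Plus (Pre (Delay l) P) M)) (Nu (BStoch q l) (Sum (Plus (Pre (Stoch q) P) M)))"
  unfolding csim_def
proof (intro allI impI)
  fix \<kappa> X assume cm: "cm (Sum (Plus (Pre (Delay l) P) M)) \<kappa> X"
  let ?b = "BStoch q l" and ?S = "Sum (Plus (Pre (Stoch q) P) M)"
  have "\<not> leaf (Delay l) P \<kappa> R" for R by (auto elim: leaf.cases)
  then have M: "cm (Sum M) \<kappa> X" using cm unfolding cm_sum by auto
  obtain r where "r \<notin> Inr -` (fnk \<kappa> \<union> fn X \<union> fn ?S \<union> fn_summ M)"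
    using fresh_chan[of "Inr -` (fnk \<kappa> \<union> fn X \<union> fn ?S \<union> fn_summ M)"] by (auto simp: finite_vimageI)
  then have r: "Inr r \<notin> fnk \<kappa> \<union> fn X \<union> fn ?S \<union> fn_summ M" by auto
  let ?c = "BStoch r l"
  have "alpha (ren ?b ?c (Sum M)) (Sum M)" by (rule alpha_ren_fresh) (use q r in auto)
  then have "cm (ren ?b ?c (Sum M)) \<kappa> X" using cm_alpha[OF M] congr_sym by blast
  then have "cm (ren ?b ?c ?S) \<kappa> X" by (auto simp: cm_sum)
  then have "cm (Nu ?b ?S) \<kappa> (Nu ?c X)"
    by (rule cm_nu[OF _ alpha_ren]) (use r in auto)
  then show "cm (Nu ?b ?S) \<kappa> X" by (rule cm_scong) (rule scong_nu_vacuous, use r in auto)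
qed

lemma csim_delay2:
  assumes q: "Inr q \<notin> fn_summ M \<union> fn P"
  shows "csim {} (Nu (BStoch q l) (Sum (Plus (Pre (Stoch q) P) M))) (Sum (Plus (Pre (Delay l) P) M))"
  unfolding csim_def
proof (intro allI impI)
  let ?b = "BStoch q l" and ?S = "Sum (Plus (Pre (Stoch q) P) M)"
  fix \<kappa> X assume cm: "cm (Nu ?b ?S) \<kappa> X"
  have "finite (fn_summ M)" by simp
  then obtain c W Y where W: "com D (insert (bname c) (fn_summ M)) W \<kappa> Y" "alpha (Nu ?b ?S) (Nu c W)"
    and c: "bname c \<notin> fn_summ M \<union> fnk \<kappa>" and X: "scong D (Nu c Y) X"
    by (rule cm_NuE[OF cm])
  have lk: "like ?b c" and "alpha (ren ?b c ?S) W" using W(2) by (auto elim: alpha_Nu_inv)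
  then have "alpha W (ren ?b c ?S)" by (metis congr_sym)
  then have "cm (ren ?b c ?S) \<kappa> Y" by (rule cm_alpha[OF cmI[OF W(1) congr_refl]])
  moreover have "\<not> leaf (Stoch q) P \<kappa> R" for P q R by (auto elim: leaf.cases)
  ultimately have "cm (ren ?b c (Sum M)) \<kappa> Y" using lk by (cases c) (auto simp: cm_sum)
  moreover have "alpha (ren ?b c (Sum M)) (Sum M)" by (rule alpha_ren_fresh[OF lk]) (use q c in auto)
  ultimately have M: "cm (Sum M) \<kappa> Y" by (rule cm_alpha)
  then obtain Z where Z: "com D {} (Sum M) \<kappa> Z" "scong D Z Y" unfolding cm_def by blast
  have "bname c \<notin> fn Z" using com_fn[OF Z(1)] c resk_subset(1)[of \<kappa>] by auto
  then have "scong D (Nu c Z) Z" by (rule scong_nu_vacuous)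
  then have "scong D Y X" using X Z(2) by (meson congr_nu congr_sym congr_trans)
  then have "cm (Sum M) \<kappa> X" using M cm_scong by blast
  then show "cm (Sum (Plus (Pre (Delay l) P) M)) \<kappa> X" by (auto simp: cm_sum)
qed

text \<open>The hypothesis is about \<open>P\<close>, the commitment about \<open>P\<close> opened
  at \<open>c\<close>. It is carried back to \<open>P\<close> and forth from \<open>P1\<close> by
  the same transposition, an involution that does not move the bound name of the label, so the
  condition on \<open>U\<close> survives.\<close>

lemma csim_nu:
  assumes "csim U P P1" "finite U"
  shows "csim (U \<union> fn P \<union> fn P1 \<union> {bname b}) (Nu b P) (Nu b P1)" (is "csim ?U _ _")
  unfolding csim_def
proof (intro allI impI)
  fix \<kappa> X assume bn: "bnk \<kappa> \<inter> ?U = {}" and cm: "cm (Nu b P) \<kappa> X"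
  have "finite ?U" using assms by simp
  then obtain c W Y where W: "com D (insert (bname c) ?U) W \<kappa> Y" "alpha (Nu b P) (Nu c W)"
    and c: "bname c \<notin> ?U \<union> fnk \<kappa>" and X: "scong D (Nu c Y) X"
    by (rule cm_NuE[OF cm])
  have lk: "like b c" and "alpha (ren b c P) W" using W(2) by (auto elim: alpha_Nu_inv)
  then have "alpha W (ren b c P)" by (metis congr_sym)
  then have cmW: "cm (ren b c P) \<kappa> Y" by (rule cm_alpha[OF cmI[OF W(1) congr_refl]])
  obtain f g where fg: "bij f" "bij g" "map_sum f g = transpose (bname b) (bname c)"
     "\<And>P :: ('x, 'q, 'k) proc. ren b c P = perm f g P"
    using ren_perm[OF lk] by metis
  have inv: "perm f g (perm f g R) = R" for R :: "('x, 'q, 'k) proc"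
    using ren_ren(1)[OF lk, of R] by (simp add: fg(4))
  have ff: "f (f x) = x" for x
  proof -
    have "map_sum f g (map_sum f g (Inl x)) = Inl x" unfolding fg(3) by simp
    then show ?thesis by simp
  qed
  have inv2: "permk f g (permk f g \<kappa>) = \<kappa>" by (cases \<kappa>) (auto simp: ff inv)
  have "bnk (permk f g \<kappa>) = bnk \<kappa>"
  proof -
    have "transpose (bname b) (bname c) n = n" if "n \<in> bnk \<kappa>" for n
      using that bn c resk_subset(2)[of \<kappa>] by (intro transpose_apply_other) auto
    then show ?thesis unfolding bnk_permk fg(3) by simp
  qed
  then have bn2: "bnk (permk f g \<kappa>) \<inter> U = {}" using bn by auto
  have "cm P (permk f g \<kappa>) (perm f g Y)" using cm_perm[OF cmW fg(1,2)] by (simp add: fg(4) inv)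
  then have "cm P1 (permk f g \<kappa>) (perm f g Y)" by (rule csimD[OF assms(1) bn2])
  then have "cm (ren b c P1) \<kappa> Y" using cm_perm[OF _ fg(1,2)] by (fastforce simp: fg(4) inv inv2)
  then have "cm (Nu b P1) \<kappa> (Nu c Y)" by (rule cm_nu[OF _ alpha_ren[OF lk]]) (use c in auto)
  then show "cm (Nu b P1) \<kappa> X" using X by (rule cm_scong)
qed

lemma csim_pre:
  assumes "scong D P P'" shows "csim (fn P \<union> fn P') (Sum (Pre a P)) (Sum (Pre a P'))"
  unfolding csim_def
proof (intro allI impI)
  fix \<kappa> X assume bn: "bnk \<kappa> \<inter> (fn P \<union> fn P') = {}" and "cm (Sum (Pre a P)) \<kappa> X"
  then obtain R where R: "leaf a P \<kappa> R" "scong D R X" by (auto simp: cm_sum)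
  have "\<exists>R'. leaf a P' \<kappa> R' \<and> scong D R' R"
    using R(1)
  proof cases
    case leaf_tau
    then show ?thesis using assms by (meson leaf.leaf_tau congr_sym)
  next
    case (leaf_in z y x)
    have "leaf a P' \<kappa> (ren (BChan y) (BChan z) P')" unfolding leaf_in(1,2)
      by (rule leaf.leaf_in[OF _ congr_refl]) (use bn leaf_in in auto)
    moreover have "scong D (ren (BChan y) (BChan z) P) (ren (BChan y) (BChan z) P')"
      by (rule scong_ren[OF assms]) simp
    ultimately show ?thesis using alpha_scong[OF leaf_in(4)] by (meson congr_sym congr_trans)
  next
    case (leaf_out z y R0 R' x)
    have "leaf a P' \<kappa> (Par P' R')" unfolding leaf_out(1,2) by (rule leaf.leaf_out[OF leaf_out(4)])
    moreover have "scong D (Par P' R') R" unfolding leaf_out(3)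
      by (rule congr_par[OF congr_sym[OF assms] congr_refl])
    ultimately show ?thesis by blast
  qed
  then obtain R' where R': "leaf a P' \<kappa> R'" "scong D R' R" by blast
  have "scong D R' X" by (rule congr_trans[OF R'(2) R(2)])
  then show "cm (Sum (Pre a P')) \<kappa> X" using R'(1) by (auto simp: cm_sum)
qed

lemma cm_plus: "cm (Sum (Plus M N)) \<kappa> X \<longleftrightarrow> cm (Sum M) \<kappa> X \<or> cm (Sum N) \<kappa> X"
  unfolding cm_sum by auto

lemma csim_unfold: "unfolds D A ys B \<Longrightarrow> csim {} (Const A ys) B \<and> csim {} B (Const A ys)"
  unfolding csim_def using cm_const by blast

lemma csim_struct:
  assumes "struct_law D P Q" shows "\<exists>U. finite U \<and> csim U P Q \<and> csim U Q P"
proof -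
  have I: ?thesis if "finite U" "finite V" "csim U P Q" "csim V Q P" for U V
    using that csim_mono[OF that(3), of "U \<union> V"] csim_mono[OF that(4), of "U \<union> V"]
    by (intro exI[of _ "U \<union> V"]) auto
  from assms show ?thesis
  proof cases
    case 1
    then have "alpha P Q" by (rule congr_base)
    then show ?thesis by (intro I[OF finite.emptyI finite.emptyI]) (auto intro: csim_alpha congr_sym)
  next
    case (2 b Q' P')
    show ?thesis unfolding 2(1,2) using I csim_scope[OF 2(3)] csim_scope2[OF 2(3)] unfolding 2(1,2) by (meson finite_fn finite_UnI)
  next
    case (3 b c P')
    show ?thesis unfolding 3(1,2) using I[OF finite.emptyI finite.emptyI] csim_swap[OF 3(3)] csim_swap[OF 3(3)[symmetric]] unfolding 3(1,2) by blast
  next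
    case (8 P1 P2 P3)
    show ?thesis using I csim_par_assoc csim_par_assoc2 unfolding 8 by (meson finite_fn finite_UnI)
  next
    case (11 A ys)
    then show ?thesis using I[OF finite.emptyI finite.emptyI] csim_unfold unfolding 11 by blast
  next
    case (12 q M P' l)
    show ?thesis using I[OF finite.emptyI finite.emptyI] csim_delay[OF 12(3)] csim_delay2[OF 12(3)] unfolding 12(1,2) by blast
  qed (rule I[OF finite.emptyI finite.emptyI];
     auto intro: csim_nu_zero csim_zero csim_sum csim_par_comm csim_par_zero csim_par_zero2; fail)+
qed

lemma csim_scong:
  assumes "scong D P Q" shows "\<exists>U. finite U \<and> csim U P Q \<and> csim U Q P"
  using assms
proof induct
  case (congr_base P Q)
  then show ?case by (rule csim_struct)
next
  case (congr_refl P)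
  then show ?case by (auto simp: csim_def)
next
  case (congr_sym P Q)
  then show ?case by blast
next
  case (congr_trans P Q R)
  then obtain U V where "finite U" "csim U P Q" "csim U Q P" "finite V" "csim V Q R" "csim V R Q" by blast
  then have "csim (U \<union> V) P R" "csim (V \<union> U) R P" by (blast intro: csim_trans)+
  then show ?case using \<open>finite U\<close> \<open>finite V\<close> by (intro exI[of _ "U \<union> V"]) (simp add: Un_commute)
next
  case (congr_par P P' Q Q')
  then obtain U V where U: "finite U" "csim U P P'" "csim U P' P" and V: "finite V" "csim V Q Q'" "csim V Q' Q" by blast
  let ?U = "(U \<union> fn P \<union> fn Q \<union> fn P') \<union> (V \<union> fn Q \<union> fn P' \<union> fn Q')"
  let ?V = "(U \<union> fn P' \<union> fn Q' \<union> fn P) \<union> (V \<union> fn Q' \<union> fn P \<union> fn Q)"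
  have "csim ?U (Par P Q) (Par P' Q')"
    by (rule csim_trans[OF csim_par1[OF U(2,1) congr_par(1)] csim_par2[OF V(2,1) congr_par(3)]])
  moreover have "csim ?V (Par P' Q') (Par P Q)"
    by (rule csim_trans[OF csim_par1[OF U(3,1) congr.congr_sym[OF congr_par(1)]] csim_par2[OF V(3,1) congr.congr_sym[OF congr_par(3)]]])
  ultimately show ?case using U(1) V(1) csim_mono
    by (intro exI[of _ "?U \<union> ?V"]) (auto intro: csim_mono)
next
  case (congr_nu P P' b)
  then obtain U where U: "finite U" "csim U P P'" "csim U P' P" by blast
  show ?case using csim_nu[OF U(2,1), of b] csim_nu[OF U(3,1), of b] U(1)
    by (intro exI[of _ "U \<union> fn P \<union> fn P' \<union> {bname b}"]) (auto simp: Un_ac)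
next
  case (congr_pre P P' a)
  show ?case using csim_pre[OF congr_pre(1), of a] csim_pre[OF congr.congr_sym[OF congr_pre(1)], of a]
    by (intro exI[of _ "fn P \<union> fn P'"]) (auto simp: Un_commute)
next
  case (congr_plus M M' N N')
  then obtain U V where U: "finite U" "csim U (Sum M) (Sum M')" "csim U (Sum M') (Sum M)"
    and V: "finite V" "csim V (Sum N) (Sum N')" "csim V (Sum N') (Sum N)" by blast
  have "csim (U \<union> V) (Sum (Plus M N)) (Sum (Plus M' N'))" "csim (U \<union> V) (Sum (Plus M' N')) (Sum (Plus M N))"
    using U V unfolding csim_def cm_plus by (simp_all add: Int_Un_distrib)
  then show ?case using U(1) V(1) by blast
qed

lemma red_cm: "red D P a P' \<Longrightarrow> a = None \<Longrightarrow> cm P KTau P'"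
proof (induct rule: red.induct)
  case (RTau P M)
  show ?case unfolding cm_sum by (intro exI[of _ Tau] exI[of _ P] conjI leaf_tau congr_refl) simp
next
  case (RCom x z P M y Q N)
  let ?A = "Sum (Plus (Pre (In x z) P) M)" and ?B = "Sum (Plus (Pre (Out x y) Q) N)"
  obtain w where "w \<notin> Inl -` (fn P \<union> fn ?A \<union> fn ?B)"
    using fresh_chan[of "Inl -` (fn P \<union> fn ?A \<union> fn ?B)"] by (auto simp: finite_vimageI)
  then have w: "Inl w \<notin> fn P \<union> fn ?A \<union> fn ?B" by simp
  let ?P = "ren (BChan z) (BChan w) P"
  have "leaf (In x z) P (KRcv x w) ?P" by (rule leaf_in[OF _ congr_refl]) (use w in auto)
  then have A: "cm ?A (KRcv x w) ?P" unfolding cm_sum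
    by (intro exI[of _ "In x z"] exI[of _ P] exI[of _ ?P] conjI congr_refl) simp_all
  have "leaf (Out x y) Q (KSnd x w ?P) (Par Q (subst1 w y ?P))" by (rule leaf_out[OF congr_refl])
  then have B: "cm ?B (KSnd x w ?P) (Par Q (subst1 w y ?P))" unfolding cm_sum
    by (intro exI[of _ "Out x y"] exI[of _ Q] exI[of _ "Par Q (subst1 w y ?P)"] conjI congr_refl) simp_all
  have "cm (Par ?A ?B) KTau (Par Q (subst1 w y ?P))" by (rule cm_comR[OF A B]) (use w in auto)
  moreover have "scong D (Par Q (subst1 w y ?P)) (Par (subst1 z y P) Q)"
  proof -
    have "alpha (subst1 w y ?P) (subst1 z y P)" by (rule alpha_subst1_ren) (use w in auto)
    then show ?thesis by (meson alpha_scong congr_par congr_refl congr_trans scong_par_comm)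
  qed
  ultimately show ?case by (rule cm_scong)
next
  case (RPar P a P' Q)
  then show ?case by (intro cm_par1) auto
next
  case (RNu P a P' b)
  then show ?case by (intro cm_nu[OF _ congr_refl]) auto
next
  case (RCong P Q a Q' P')
  obtain U where "csim U Q P" using csim_scong[OF RCong(1)] by blast
  \<comment> \<open>\<open>KTau\<close> has no bound name, so the condition on \<open>U\<close>
    holds whatever \<open>U\<close> is.\<close>
  then have "cm P KTau Q'" using RCong csimD[of U Q P KTau Q'] by simp
  then show ?case using RCong(4) by (rule cm_scong)
qed simp

end

section \<open>Commitments, labeled transitions and reductions\<close>

lemma core_simps [simp]:
  "Par P Q \<in> core \<longleftrightarrow> P \<in> core \<and> Q \<in> core"
  "Nu (BChan x) P \<in> core \<longleftrightarrow> P \<in> core"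
  "Nu (BStoch q l) P \<notin> core"
  by (auto simp: core_def)

lemma alpha_core: "alpha P Q \<Longrightarrow> P \<in> core \<longleftrightarrow> Q \<in> core"
proof (induct rule: congr.induct)
  case (congr_base P Q)
  then show ?case by cases (auto simp: core_def proc.set_map)
qed (auto simp: core_def)

lemma core_NuE:
  assumes "Nu b P \<in> core" obtains x where "b = BChan x" "P \<in> core"
  using assms by (cases b) auto

section \<open>From commitments to labeled transitions\<close>

lemma step_summand:
  assumes "(a, Q) \<in># summands M" "step D (Sum (Pre a Q)) (Std \<mu>) P'" shows "step D (Sum M) (Std \<mu>) P'"
  using assms(1)
proof (induct M rule: summ.induct[where ?P1.0 = "\<lambda>_. True"])
  case (Plus M N)
  then show ?case by (auto intro: step.SumL step.SumR)
qed (use assms in auto)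

context defs begin

text \<open>The early label fixes the received name \<open>w\<close>, and \<open>Res\<close>
  requires it to differ from every crossed binder; its membership in the avoided set grants
  this.\<close>

lemma rcv_step:
  assumes "com D S P (KRcv x z) R" "P \<in> core" "Inl w \<in> S"
  shows "\<exists>P1. step D P (Std (LIn x w)) P1 \<and> scong D P1 (subst1 z w R)"
  using assms
proof (induct S P "KRcv x z :: ('x, 'q, 'k) act" R rule: com.induct)
  case (com_sum a Q M R S)
  from com_sum(2) obtain y where a: "a = In x y" "Inl z \<notin> fn Q - {Inl y}" "alpha (ren (BChan y) (BChan z) Q) R"
    by cases auto
  have "step D (Sum M) (Std (LIn x w)) (subst1 y w Q)"
    using com_sum(1) unfolding a by (rule step_summand) (rule step.Inp)
  moreover have "alpha (subst1 z w (ren (BChan y) (BChan z) Q)) (subst1 y w Q)"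
    by (rule alpha_subst1_ren[OF a(2)])
  moreover have "alpha (subst1 z w (ren (BChan y) (BChan z) Q)) (subst1 z w R)"
    unfolding subst1_def by (rule alpha_subst[OF a(3)])
  ultimately show ?case by (meson alpha_scong congr_sym congr_trans)
next
  case (com_par1 S P P' Q)
  then obtain P1 where P1: "step D P (Std (LIn x w)) P1" "scong D P1 (subst1 z w P')" by auto
  have "scong D Q (subst1 z w Q)" using com_par1(3) by (intro alpha_scong congr_sym[OF alpha_subst1_fresh]) auto
  then have "scong D (Par P1 Q) (subst1 z w (Par P' Q))" unfolding subst1_par by (rule congr_par[OF P1(2)])
  then show ?case using step.ParL[OF P1(1), of Q] by auto
next
  case (com_par2 S Q Q' P)
  then obtain Q1 where Q1: "step D Q (Std (LIn x w)) Q1" "scong D Q1 (subst1 z w Q')" by auto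
  have "scong D P (subst1 z w P)" using com_par2(3) by (intro alpha_scong congr_sym[OF alpha_subst1_fresh]) auto
  then have "scong D (Par P Q1) (subst1 z w (Par P Q'))" unfolding subst1_par by (rule congr_par[OF _ Q1(2)])
  then show ?case using step.ParR[OF Q1(1), of P] by auto
next
  case (com_nu c S P1 P' b P)
  have "Nu c P1 \<in> core" using alpha_core[OF com_nu(3)] com_nu(5) by simp
  then obtain v where v: "c = BChan v" "P1 \<in> core" by (rule core_NuE)
  then obtain P2 where P2: "step D P1 (Std (LIn x w)) P2" "scong D P2 (subst1 z w P')" using com_nu(2,6) by auto
  have ne: "v \<noteq> x" "v \<noteq> w" "v \<noteq> z" using com_nu(4,6) v by auto
  then have "step D (Nu b P) (Std (LIn x w)) (Nu c P2)"
    unfolding v by (intro step.Alpha[OF com_nu(3)[unfolded v]] step.Res P2) auto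
  moreover have "scong D (Nu c P2) (subst1 z w (Nu c P'))"
    using alpha_subst1_nu[of c z w P'] ne P2(2) v by (auto intro: congr_trans[OF congr_nu alpha_scong[OF congr_sym]])
  ultimately show ?case by blast
next
  case (com_const S B' P' A ys B)
  have "B' \<in> core" using unfolds_core[OF com_const(3)] alpha_core[OF com_const(4)] by simp
  then show ?case using com_const by (meson step.Cons step.Alpha)
qed

lemma fn_subst1: "fn (subst1 z y R) \<subseteq> insert (Inl y) (fn R)" for R :: "('x, 'q, 'k) proc"
  unfolding subst1_def fn_subst by (auto simp: map_sum_def split: sum.splits if_splits)

lemma scong_par_swap: "scong D (Par (Par A B) C) (Par (Par A C) B)"
  by (meson congr_par congr_refl congr_sym congr_trans scong_par_assoc scong_par_comm)

text \<open>In \<open>P'\<close> the instance of \<open>R\<close> sits inside the restrictions of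
  \<open>P\<close>. Crossed binders avoid \<open>R\<close>, so it can be pulled out past all of them
  except one that binds the message: then the output is a bound one, and this restriction is moved
  to the front.\<close>

lemma snd_step:
  assumes "com D S P (KSnd x z R) P'" "P \<in> core" "fn P \<union> fnk (KSnd x z R) \<subseteq> S"
  shows "\<exists>y P1. (step D P (Std (LOut x y)) P1 \<and> scong D P' (Par P1 (subst1 z y R))) \<or>
    (step D P (Std (LBOut x y)) P1 \<and> Inl y \<notin> S \<and> scong D P' (Nu (BChan y) (Par P1 (subst1 z y R))))"
  using assms
proof (induct S P "KSnd x z R" P' rule: com.induct)
  case (com_sum a Q M R' S)
  from com_sum(2) obtain y R'' where R'': "a = Out x y" "R' = Par Q R''" "alpha (subst1 z y R) R''"
    by cases auto
  have "step D (Sum M) (Std (LOut x y)) Q"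
    using com_sum(1) unfolding R'' by (rule step_summand) (rule step.Out)
  moreover have "scong D R' (Par Q (subst1 z y R))"
    unfolding R''(2) by (intro congr_par congr_refl alpha_scong congr_sym[OF R''(3)])
  ultimately show ?case by blast
next
  case (com_par1 S P P' Q)
  then obtain y P1 where "(step D P (Std (LOut x y)) P1 \<and> scong D P' (Par P1 (subst1 z y R))) \<or>
    (step D P (Std (LBOut x y)) P1 \<and> Inl y \<notin> S \<and> scong D P' (Nu (BChan y) (Par P1 (subst1 z y R))))" by auto
  then show ?case
  proof (elim disjE conjE)
    assume 1: "step D P (Std (LOut x y)) P1" "scong D P' (Par P1 (subst1 z y R))"
    have "step D (Par P Q) (Std (LOut x y)) (Par P1 Q)" by (rule step.ParL[OF 1(1)]) simp
    moreover have "scong D (Par P' Q) (Par (Par P1 Q) (subst1 z y R))"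
      by (rule congr_trans[OF congr_par[OF 1(2) congr_refl] scong_par_swap])
    ultimately show ?thesis by blast
  next
    assume 1: "step D P (Std (LBOut x y)) P1" "Inl y \<notin> S" "scong D P' (Nu (BChan y) (Par P1 (subst1 z y R)))"
    have y: "Inl y \<notin> fn Q" using 1(2) com_par1(5) by auto
    have "step D (Par P Q) (Std (LBOut x y)) (Par P1 Q)" by (rule step.ParL[OF 1(1)]) (use y in simp)
    moreover have "scong D (Par P' Q) (Nu (BChan y) (Par (Par P1 Q) (subst1 z y R)))"
      by (rule congr_trans[OF congr_par[OF 1(3) congr_refl] congr_trans[OF scong_scope congr_nu[OF scong_par_swap]]])
        (use y in simp)
    ultimately show ?thesis using 1(2) by blast
  qed
next
  case (com_par2 S Q Q' P)
  then obtain y P1 where "(step D Q (Std (LOut x y)) P1 \<and> scong D Q' (Par P1 (subst1 z y R))) \<or>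
    (step D Q (Std (LBOut x y)) P1 \<and> Inl y \<notin> S \<and> scong D Q' (Nu (BChan y) (Par P1 (subst1 z y R))))" by auto
  then show ?case
  proof (elim disjE conjE)
    assume 1: "step D Q (Std (LOut x y)) P1" "scong D Q' (Par P1 (subst1 z y R))"
    have "step D (Par P Q) (Std (LOut x y)) (Par P P1)" by (rule step.ParR[OF 1(1)]) simp
    moreover have "scong D (Par P Q') (Par (Par P P1) (subst1 z y R))"
      by (rule congr_trans[OF congr_par[OF congr_refl 1(2)] congr_sym[OF scong_par_assoc]])
    ultimately show ?thesis by blast
  next
    assume 1: "step D Q (Std (LBOut x y)) P1" "Inl y \<notin> S" "scong D Q' (Nu (BChan y) (Par P1 (subst1 z y R)))"
    have y: "Inl y \<notin> fn P" using 1(2) com_par2(5) by auto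
    have "step D (Par P Q) (Std (LBOut x y)) (Par P P1)" by (rule step.ParR[OF 1(1)]) (use y in simp)
    moreover have "scong D (Par P Q') (Nu (BChan y) (Par (Par P P1) (subst1 z y R)))"
      by (rule congr_trans[OF congr_par[OF congr_refl 1(3)] congr_trans[OF scong_scope2 congr_nu[OF congr_sym[OF scong_par_assoc]]]])
        (use y in simp)
    ultimately show ?thesis using 1(2) by blast
  qed
next
  case (com_nu c S P1 P' b P)
  have "Nu c P1 \<in> core" using alpha_core[OF com_nu(3)] com_nu(5) by simp
  then obtain v where v: "c = BChan v" "P1 \<in> core" by (rule core_NuE)
  have "fn P1 \<subseteq> insert (bname c) (fn (Nu b P))" by (rule alpha_Nu_fn[OF com_nu(3)])
  then have "fn P1 \<union> fnk (KSnd x z R) \<subseteq> insert (bname c) S" using com_nu(6) by auto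
  then obtain y P2 where IH: "(step D P1 (Std (LOut x y)) P2 \<and> scong D P' (Par P2 (subst1 z y R))) \<or>
    (step D P1 (Std (LBOut x y)) P2 \<and> Inl y \<notin> insert (bname c) S \<and> scong D P' (Nu (BChan y) (Par P2 (subst1 z y R))))"
    using com_nu(2)[OF v(2)] by blast
  have vx: "v \<noteq> x" and vS: "Inl v \<notin> S" and vR: "Inl v \<notin> fn R" using com_nu(4) v by auto
  from IH show ?case
  proof (elim disjE conjE)
    assume 1: "step D P1 (Std (LOut x y)) P2" "scong D P' (Par P2 (subst1 z y R))"
    show ?thesis
    proof (cases "y = v")
      case True
      have "step D (Nu b P) (Std (LBOut x y)) P2"
        by (rule step.Alpha[OF com_nu(3)]) (use 1 vx True v in \<open>auto intro: step.Open\<close>)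
      moreover have "scong D (Nu c P') (Nu (BChan y) (Par P2 (subst1 z y R)))"
        using congr_nu[OF 1(2)] True v by simp
      ultimately show ?thesis using vS True by blast
    next
      case False
      have "step D (Nu b P) (Std (LOut x y)) (Nu c P2)"
        by (rule step.Alpha[OF com_nu(3)]) (use 1 vx False v in \<open>auto intro: step.Res\<close>)
      moreover have "scong D (Nu c P') (Par (Nu c P2) (subst1 z y R))"
        by (rule congr_trans[OF congr_nu[OF 1(2)] congr_sym[OF scong_scope]])
          (use fn_subst1[of z y R] vR False v in auto)
      ultimately show ?thesis by blast
    qed
  next
    assume 1: "step D P1 (Std (LBOut x y)) P2" "Inl y \<notin> insert (bname c) S"
      "scong D P' (Nu (BChan y) (Par P2 (subst1 z y R)))"
    have yv: "y \<noteq> v" using 1(2) v by auto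
    have "step D (Nu b P) (Std (LBOut x y)) (Nu c P2)"
      by (rule step.Alpha[OF com_nu(3)]) (use 1 vx yv v in \<open>auto intro: step.Res\<close>)
    moreover have "scong D (Nu c P') (Nu c (Nu (BChan y) (Par P2 (subst1 z y R))))" by (rule congr_nu[OF 1(3)])
    moreover have "scong D (Nu c (Nu (BChan y) (Par P2 (subst1 z y R)))) (Nu (BChan y) (Nu c (Par P2 (subst1 z y R))))"
      by (rule scong_swap) (use yv v in auto)
    moreover have "scong D (Nu (BChan y) (Nu c (Par P2 (subst1 z y R)))) (Nu (BChan y) (Par (Nu c P2) (subst1 z y R)))"
      by (rule congr_nu[OF congr_sym[OF scong_scope]]) (use fn_subst1[of z y R] vR yv v in auto)
    ultimately show ?thesis using 1(2) by (meson congr_trans insertI2)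
  qed
next
  case (com_const S B' P' A ys B)
  have "B' \<in> core" using unfolds_core[OF com_const(3)] alpha_core[OF com_const(4)] by simp
  moreover have "fn B' \<subseteq> fn (Const A ys)" using unfolds_fn[OF com_const(3)] alpha_fn[OF com_const(4)] by simp
  ultimately obtain y P1 where "(step D B' (Std (LOut x y)) P1 \<and> scong D P' (Par P1 (subst1 z y R))) \<or>
    (step D B' (Std (LBOut x y)) P1 \<and> Inl y \<notin> S \<and> scong D P' (Nu (BChan y) (Par P1 (subst1 z y R))))"
    using com_const(2,6) by blast
  moreover have "step D (Const A ys) (Std \<mu>) P1" if "step D B' (Std \<mu>) P1" for \<mu>
    by (rule step.Cons[OF com_const(3) step.Alpha[OF com_const(4) that]])
  ultimately show ?case by blast
qed

text \<open>The avoided sets are chosen anew for both partners. That of the sender includes the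
  names of \<open>Q\<close>, so that an extruded name is fresh as the closing rules demand; that of
  the receiver consists of the message, which is known only after the sender has been
  analysed.\<close>

lemma comm_step:
  assumes snd: "com D S P (KSnd x z R) P'" and rcv: "com D S Q (KRcv x z) R"
    and core: "P \<in> core" "Q \<in> core"
  obtains y P1 Q1 where "step D P (Std (LOut x y)) P1" "step D Q (Std (LIn x y)) Q1" "scong D P' (Par P1 Q1)"
  | y P1 Q1 where "step D P (Std (LBOut x y)) P1" "step D Q (Std (LIn x y)) Q1" "Inl y \<notin> fn Q"
     "scong D P' (Nu (BChan y) (Par P1 Q1))"
proof -
  let ?T = "fn P \<union> fn Q \<union> fnk (KSnd x z R)"
  obtain P'' where P'': "com D ?T P (KSnd x z R) P''" "alpha P' P''"
    using com_avoid[OF snd, of ?T] by auto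
  have sc: "scong D P' P''" by (rule alpha_scong[OF P''(2)])
  have *: "\<exists>Q1. step D Q (Std (LIn x y)) Q1 \<and> scong D (subst1 z y R) Q1" for y
  proof -
    obtain R' where R': "com D {Inl y} Q (KRcv x z) R'" "alpha R R'"
      using com_avoid[OF rcv, of "{Inl y}"] by auto
    then obtain Q1 where "step D Q (Std (LIn x y)) Q1" "scong D Q1 (subst1 z y R')"
      using rcv_step[OF R'(1) core(2), of y] by auto
    moreover have "scong D (subst1 z y R) (subst1 z y R')"
      unfolding subst1_def by (rule scong_subst[OF alpha_scong[OF R'(2)]])
    ultimately show ?thesis by (meson congr_sym congr_trans)
  qed
  have "fn P \<union> fnk (KSnd x z R) \<subseteq> ?T" by auto
  then obtain y P1 where "(step D P (Std (LOut x y)) P1 \<and> scong D P'' (Par P1 (subst1 z y R))) \<or>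
    (step D P (Std (LBOut x y)) P1 \<and> Inl y \<notin> ?T \<and> scong D P'' (Nu (BChan y) (Par P1 (subst1 z y R))))"
    using snd_step[OF P''(1) core(1)] by blast
  moreover obtain Q1 where Q1: "step D Q (Std (LIn x y)) Q1" "scong D (subst1 z y R) Q1" using * by blast
  ultimately show ?thesis
  proof (elim disjE conjE)
    assume 1: "step D P (Std (LOut x y)) P1" "scong D P'' (Par P1 (subst1 z y R))"
    show ?thesis
      by (rule that(1)[OF 1(1) Q1(1) congr_trans[OF sc congr_trans[OF 1(2) congr_par[OF congr_refl Q1(2)]]]])
  next
    assume 1: "step D P (Std (LBOut x y)) P1" "Inl y \<notin> ?T" "scong D P'' (Nu (BChan y) (Par P1 (subst1 z y R)))"
    show ?thesis
      by (rule that(2)[OF 1(1) Q1(1) _ congr_trans[OF sc congr_trans[OF 1(3) congr_nu[OF congr_par[OF congr_refl Q1(2)]]]]])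
        (use 1 in auto)
  qed
qed

lemma tau_step:
  assumes "com D S P KTau P'" "P \<in> core"
  shows "\<exists>P1. step D P (Std LTau) P1 \<and> scong D P1 P'"
  using assms
proof (induct S P "KTau :: ('x, 'q, 'k) act" P' rule: com.induct)
  case (com_sum a Q M R S)
  from com_sum(2) have "a = Tau" "R = Q" by (auto elim: leaf.cases)
  then have "step D (Sum M) (Std LTau) Q" using step_summand[OF com_sum(1)] step.Tau by blast
  then show ?case using \<open>R = Q\<close> congr_refl by blast
next
  case (com_par1 S P P' Q)
  then obtain P1 where "step D P (Std LTau) P1" "scong D P1 P'" by auto
  then show ?case using step.ParL[of D P LTau P1 Q] congr_par[OF _ congr_refl] by fastforce
next
  case (com_par2 S Q Q' P)
  then obtain Q1 where "step D Q (Std LTau) Q1" "scong D Q1 Q'" by auto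
  then show ?case using step.ParR[of D Q LTau Q1 P] congr_par[OF congr_refl] by fastforce
next
  case (com_comL S P x z R P' Q)
  then have "P \<in> core" "Q \<in> core" by auto
  then show ?case
    by (rule comm_step[OF com_comL(1,2)]) (meson step.ComL step.CloseL congr_sym)+
next
  case (com_comR S P x z R Q Q')
  then have c: "Q \<in> core" "P \<in> core" by auto
  have s: "scong D (Par Q1 P1) (Par P1 Q1)" for P1 Q1 by (rule scong_par_comm)
  from c show ?case
  proof (rule comm_step[OF com_comR(2,1)])
    fix y Q1 P1 assume 1: "step D Q (Std (LOut x y)) Q1" "step D P (Std (LIn x y)) P1" "scong D Q' (Par Q1 P1)"
    have "step D (Par P Q) (Std LTau) (Par P1 Q1)" by (rule step.ComR[OF 1(2,1)])
    then show ?thesis using congr_sym[OF congr_trans[OF 1(3) s]] by blast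
  next
    fix y Q1 P1 assume 1: "step D Q (Std (LBOut x y)) Q1" "step D P (Std (LIn x y)) P1" "Inl y \<notin> fn P"
      "scong D Q' (Nu (BChan y) (Par Q1 P1))"
    have "step D (Par P Q) (Std LTau) (Nu (BChan y) (Par P1 Q1))" by (rule step.CloseR[OF 1(2,1,3)])
    then show ?thesis using congr_sym[OF congr_trans[OF 1(4) congr_nu[OF s]]] by blast
  qed
next
  case (com_nu c S P1 P' b P)
  have "Nu c P1 \<in> core" using alpha_core[OF com_nu(3)] com_nu(5) by simp
  then obtain v where v: "c = BChan v" "P1 \<in> core" by (rule core_NuE)
  then obtain P2 where P2: "step D P1 (Std LTau) P2" "scong D P2 P'" using com_nu(2) by auto
  have "step D (Nu b P) (Std LTau) (Nu c P2)"
    by (rule step.Alpha[OF com_nu(3)]) (use P2 v in \<open>auto intro: step.Res\<close>)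
  then show ?case using congr_nu[OF P2(2)] by blast
next
  case (com_const S B' P' A ys B)
  have "B' \<in> core" using unfolds_core[OF com_const(3)] alpha_core[OF com_const(4)] by simp
  then show ?case using com_const(2) step.Cons[OF com_const(3) step.Alpha[OF com_const(4)]] by blast
qed

lemma red_step:
  assumes "red D P None P'" "P \<in> core" shows "\<exists>P''. step D P (Std LTau) P'' \<and> scong D P'' P'"
  using red_cm[OF assms(1) refl] tau_step[OF _ assms(2)] unfolding cm_def by (meson congr_trans)

end

section \<open>From labeled transitions to reductions: exposed prefixes\<close>

abbreviation news :: "'x list \<Rightarrow> ('x, 'q, 'k) proc \<Rightarrow> ('x, 'q, 'k) proc" where
  "news Z P \<equiv> foldr (\<lambda>x. Nu (BChan x)) Z P"

lemma fn_news: "fn (news Z P) = fn P - Inl ` set Z"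
  by (induct Z) auto

lemma perm_news: "perm f g (news Z P) = news (map f Z) (perm f g P)"
  by (induct Z) auto

context defs begin

text \<open>A bound output is never performed by a prefix alone, hence the last equation; such
  outputs are treated in \<open>matched\<close>.\<close>

fun acts_as :: "('x, 'q) prefix \<Rightarrow> ('x, 'q, 'k) proc \<Rightarrow> 'x std_label \<Rightarrow> ('x, 'q, 'k) proc \<Rightarrow> bool" where
  "acts_as a Q LTau X = (a = Tau \<and> scong D Q X)"
| "acts_as a Q (LOut x y) X = (a = Out x y \<and> scong D Q X)"
| "acts_as a Q (LIn x w) X = (\<exists>y. a = In x y \<and> scong D (subst1 y w Q) X)"
| "acts_as a Q (LBOut x y) X = False"

text \<open>\<open>Alpha\<close> may replace the sum between two other rules, so the induction is on
  the derivation of the transition and not on the sum.\<close>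

lemma step_sum_decomp:
  assumes "step D P \<eta> P'" "P = Sum M" "\<eta> = Std \<mu>"
  shows "\<exists>a Q N. scong D (Sum M) (Sum (Plus (Pre a Q) N)) \<and> acts_as a Q \<mu> P'"
proof -
  have single: "scong D (Sum (Pre a P)) (Sum (Plus (Pre a P) Zero))" for a P
    by (rule congr_sym[OF scong_plus_zero])
  show ?thesis using assms
  proof (induct arbitrary: M \<mu> rule: step.induct)
    case (Tau P)
    then show ?case using single[of "Tau" P]
      by (intro exI[of _ "Tau"] exI[of _ P] exI[of _ Zero]) (auto simp: congr_refl)
  next
    case (Out x y P)
    then show ?case using single[of "Out x y" P]
      by (intro exI[of _ "Out x y"] exI[of _ P] exI[of _ Zero]) (auto simp: congr_refl)
  next
    case (Inp x y P w)
    then show ?case using single[of "In x y" P]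
      by (intro exI[of _ "In x y"] exI[of _ P] exI[of _ Zero]) (auto simp: congr_refl)
  next
    case (SumL M1 \<nu> P' N1)
    then obtain a Q N where 1: "scong D (Sum M1) (Sum (Plus (Pre a Q) N))" "acts_as a Q \<mu> P'" by blast
    have "scong D (Sum (Plus M1 N1)) (Sum (Plus (Plus (Pre a Q) N) N1))"
      by (rule congr_plus[OF 1(1) congr_refl])
    then have "scong D (Sum (Plus M1 N1)) (Sum (Plus (Pre a Q) (Plus N N1)))"
      by (rule congr_trans[OF _ scong_plus_assoc])
    then show ?case using 1(2) SumL by blast
  next
    case (SumR N1 \<nu> P' M1)
    then obtain a Q N where 1: "scong D (Sum N1) (Sum (Plus (Pre a Q) N))" "acts_as a Q \<mu> P'" by blast
    have "scong D (Sum (Plus M1 N1)) (Sum (Plus N1 M1))" by (rule scong_plus_comm)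
    also have "scong D (Sum (Plus N1 M1)) (Sum (Plus (Plus (Pre a Q) N) M1))"
      by (rule congr_plus[OF 1(1) congr_refl])
    also have "scong D (Sum (Plus (Plus (Pre a Q) N) M1)) (Sum (Plus (Pre a Q) (Plus N M1)))"
      by (rule scong_plus_assoc)
    finally show ?case using 1(2) SumR by blast
  next
    case (Alpha P Q \<nu> P')
    obtain N where N: "Q = Sum N" using Alpha(1,4) alpha_Sum_inv by blast
    then obtain a Q' N' where 1: "scong D (Sum N) (Sum (Plus (Pre a Q') N'))" "acts_as a Q' \<mu> P'" using Alpha by blast
    have "scong D (Sum M) (Sum (Plus (Pre a Q') N'))"
      using alpha_scong[OF Alpha(1)] 1(1) Alpha(4) N by (auto intro: congr_trans)
    then show ?case using 1(2) by blast
  qed auto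
qed

text \<open>
  The restricted names in front of the exposed prefix can be chosen away from any finite set \<open>S\<close>;
  this is what lets two exposed prefixes be brought together.
\<close>

definition exposes :: "('x, 'q, 'k) proc \<Rightarrow> 'x std_label \<Rightarrow> ('x, 'q, 'k) proc \<Rightarrow> bool" where
  "exposes P \<mu> P' \<longleftrightarrow> (\<forall>S :: ('x + 'q) set. finite S \<longrightarrow> (\<exists>Z a Q N R X. Inl ` set Z \<inter> (S \<union> Inl ` n_label (Std \<mu>)) = {} \<and>
     scong D P (news Z (Par (Sum (Plus (Pre a Q) N)) R)) \<and> acts_as a Q \<mu> X \<and> scong D P' (news Z (Par X R))))"

lemma exposesE:
  fixes S :: "('x + 'q) set"
  assumes "exposes P \<mu> P'" "finite S"
  obtains Z a Q N R X where "Inl ` set Z \<inter> (S \<union> Inl ` n_label (Std \<mu>)) = {}"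
    "scong D P (news Z (Par (Sum (Plus (Pre a Q) N)) R))" "acts_as a Q \<mu> X" "scong D P' (news Z (Par X R))"
  using assms(1)[unfolded exposes_def, rule_format, OF assms(2)] that by (elim exE conjE) blast

lemma exposes_scong: "exposes P \<mu> P' \<Longrightarrow> scong D Q P \<Longrightarrow> scong D Q' P' \<Longrightarrow> exposes Q \<mu> Q'"
  unfolding exposes_def by (meson congr_trans)

lemma news_scong: "scong D P Q \<Longrightarrow> scong D (news Z P) (news Z Q)"
  by (induct Z) (auto intro: congr_nu)

lemma news_par: "Inl ` set Z \<inter> fn Q = {} \<Longrightarrow> scong D (Par (news Z P) Q) (news Z (Par P Q))"
proof (induct Z)
  case (Cons x Z)
  then have "scong D (Par (Nu (BChan x) (news Z P)) Q) (Nu (BChan x) (Par (news Z P) Q))"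
    by (intro scong_scope) auto
  moreover have "scong D (Nu (BChan x) (Par (news Z P) Q)) (Nu (BChan x) (news Z (Par P Q)))"
    using Cons by (intro congr_nu) auto
  ultimately show ?case by (auto intro: congr_trans)
qed (auto intro: congr_refl)

lemma red_news: "red D P None P' \<Longrightarrow> red D (news Z P) None (news Z P')"
  by (induct Z) (auto intro: red.RNu)

lemma exposes_sum:
  assumes "step D (Sum M) (Std \<mu>) P'" shows "exposes (Sum M) \<mu> P'"
proof -
  obtain a Q N where 1: "scong D (Sum M) (Sum (Plus (Pre a Q) N))" "acts_as a Q \<mu> P'"
    using step_sum_decomp[OF assms] by blast
  have "scong D (Sum M) (Par (Sum (Plus (Pre a Q) N)) (Sum Zero))"
    by (rule congr_trans[OF 1(1) congr_sym[OF scong_par_zero]])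
  then show ?thesis unfolding exposes_def
    by (intro allI impI exI[of _ "[]"] exI[of _ a] exI[of _ Q] exI[of _ N] exI[of _ "Sum Zero"] exI[of _ P'])
      (auto simp: 1(2) intro: congr_sym[OF scong_par_zero])
qed

lemma exposes_par1:
  assumes "exposes P \<mu> P'" shows "exposes (Par P Q) \<mu> (Par P' Q)"
  unfolding exposes_def
proof (intro allI impI)
  fix S :: "('x + 'q) set" assume "finite S"
  then have "finite (S \<union> fn Q)" by simp
  then obtain Z a P0 N R X where Z: "Inl ` set Z \<inter> (S \<union> fn Q \<union> Inl ` n_label (Std \<mu>)) = {}"
    "scong D P (news Z (Par (Sum (Plus (Pre a P0) N)) R))" "acts_as a P0 \<mu> X" "scong D P' (news Z (Par X R))"
    by (rule exposesE[OF assms])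
  have ZQ: "Inl ` set Z \<inter> fn Q = {}" using Z(1) by blast
  have *: "scong D (Par P0 Q) (news Z (Par A (Par R Q)))" if "scong D P0 (news Z (Par A R))" for P0 A
    by (rule congr_trans[OF congr_par[OF that congr_refl]
        congr_trans[OF news_par[OF ZQ] news_scong[OF scong_par_assoc]]])
  show "\<exists>Z a Q' N R X. Inl ` set Z \<inter> (S \<union> Inl ` n_label (Std \<mu>)) = {} \<and>
     scong D (Par P Q) (news Z (Par (Sum (Plus (Pre a Q') N)) R)) \<and> acts_as a Q' \<mu> X \<and>
     scong D (Par P' Q) (news Z (Par X R))"
    using Z(1,3) *[OF Z(2)] *[OF Z(4)]
    by (intro exI[of _ Z] exI[of _ a] exI[of _ P0] exI[of _ N] exI[of _ "Par R Q"] exI[of _ X]) auto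
qed

text \<open>\<open>x\<close> joins the restricted names but may lie in the set \<open>S\<close> that
  these must avoid. It is renamed to a fresh \<open>z\<close>, and the transposition is carried
  through the exposed prefix and its action; it fixes the label, which contains neither
  name.\<close>

lemma exposes_nu:
  assumes "exposes P \<mu> P'" "x \<notin> n_label (Std \<mu>)" shows "exposes (Nu (BChan x) P) \<mu> (Nu (BChan x) P')"
  unfolding exposes_def
proof (intro allI impI)
  fix S :: "('x + 'q) set" assume S: "finite S"
  then have "finite (S \<union> {Inl x})" by simp
  then obtain Z a P0 N R X where Z: "Inl ` set Z \<inter> (S \<union> {Inl x} \<union> Inl ` n_label (Std \<mu>)) = {}"
    "scong D P (news Z (Par (Sum (Plus (Pre a P0) N)) R))" "acts_as a P0 \<mu> X" "scong D P' (news Z (Par X R))"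
    by (rule exposesE[OF assms(1)])
  let ?A = "Par (Sum (Plus (Pre a P0) N)) R"
  have "finite (n_label (Std \<mu>))" by (cases \<mu>) auto
  with S have "finite (Inl -` (S \<union> fn ?A \<union> fn (Par X R) \<union> fn P0 \<union> {Inl x} \<union> Inl ` n_label (Std \<mu>) \<union> Inl ` set Z))"
    by (intro finite_vimageI finite_UnI finite_imageI finite_fn) auto
  then obtain z where "z \<notin> Inl -` (S \<union> fn ?A \<union> fn (Par X R) \<union> fn P0 \<union> {Inl x} \<union> Inl ` n_label (Std \<mu>) \<union> Inl ` set Z)"
    using fresh_chan by blast
  then have z: "Inl z \<notin> S" "Inl z \<notin> fn ?A" "Inl z \<notin> fn (Par X R)" "z \<noteq> x" "z \<notin> n_label (Std \<mu>)" "z \<notin> set Z"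
    by auto
  let ?f = "transpose x z" and ?p = "perm (transpose x z) (id :: 'q \<Rightarrow> 'q)"
  have bij: "bij ?f" "bij (id :: 'q \<Rightarrow> 'q)" by (simp_all add: bij_transpose)
  have mZ: "map ?f Z = Z" using Z(1) z by (intro map_idI transpose_apply_other) auto
  have *: "scong D (Nu (BChan x) B) (news (z # Z) (?p B'))" if "scong D B (news Z B')" "Inl z \<notin> fn B'" for B B'
  proof -
    have "scong D (Nu (BChan x) B) (Nu (BChan x) (news Z B'))" by (rule congr_nu[OF that(1)])
    also have "scong D (Nu (BChan x) (news Z B')) (Nu (BChan z) (ren (BChan x) (BChan z) (news Z B')))"
      by (rule alpha_scong[OF alpha_ren]) (use that(2) in \<open>auto simp: fn_news\<close>)
    also have "ren (BChan x) (BChan z) (news Z B') = news Z (?p B')" by (simp add: perm_news mZ)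
    finally show ?thesis by simp
  qed
  have nl: "?f v = v" if "v \<in> n_label (Std \<mu>)" for v
    using that assms(2) z by (intro transpose_apply_other) auto
  have acts_as: "acts_as (map_prefix ?f id a) (?p P0) \<mu> (?p X)"
  proof (cases \<mu>)
    case (LIn u w)
    then obtain y where y: "a = In u y" "scong D (subst1 y w P0) X" using Z(3) by auto
    have "?f u = u" "?f w = w" using nl LIn by auto
    have "alpha (?p (subst1 y w P0)) (subst1 (?f y) w (?p P0))" unfolding subst1_def
      by (rule alpha_perm_subst[OF bij]) (use \<open>?f w = w\<close> bij in \<open>auto simp: bij_is_inj inj_eq\<close>)
    moreover have "scong D (?p (subst1 y w P0)) (?p X)" by (rule scong_perm[OF y(2) bij])
    ultimately have "scong D (subst1 (?f y) w (?p P0)) (?p X)" by (meson alpha_scong congr_sym congr_trans)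
    then show ?thesis using LIn y(1) \<open>?f u = u\<close> by auto
  next
    case (LOut u w)
    then show ?thesis using Z(3) nl scong_perm[OF _ bij] by auto
  qed (use Z(3) scong_perm[OF _ bij] in auto)
  have p: "?p (Par (Sum (Plus (Pre a P0) N)) R) = Par (Sum (Plus (Pre (map_prefix ?f id a) (?p P0)) (perm_summ ?f id N))) (?p R)"
    "?p (Par X R) = Par (?p X) (?p R)" by simp_all
  show "\<exists>Z a Q' N R Y. Inl ` set Z \<inter> (S \<union> Inl ` n_label (Std \<mu>)) = {} \<and>
     scong D (Nu (BChan x) P) (news Z (Par (Sum (Plus (Pre a Q') N)) R)) \<and> acts_as a Q' \<mu> Y \<and>
     scong D (Nu (BChan x) P') (news Z (Par Y R))"
    using *[OF Z(2) z(2)] *[OF Z(4) z(3)] acts_as Z(1) z unfolding p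
    by (intro exI[of _ "z # Z"] exI[of _ "map_prefix ?f id a"] exI[of _ "?p P0"] exI[of _ "perm_summ ?f id N"]
       exI[of _ "?p R"] exI[of _ "?p X"]) auto
qed

lemma scong_par_interchange: "scong D (Par (Par A R) (Par B T)) (Par (Par B A) (Par R T))"
proof -
  have "scong D (Par (Par A R) (Par B T)) (Par (Par (Par A R) B) T)" by (rule congr_sym[OF scong_par_assoc])
  also have "scong D (Par (Par (Par A R) B) T) (Par (Par (Par A B) R) T)" by (rule congr_par[OF scong_par_swap congr_refl])
  also have "scong D (Par (Par (Par A B) R) T) (Par (Par A B) (Par R T))" by (rule scong_par_assoc)
  also have "scong D (Par (Par A B) (Par R T)) (Par (Par B A) (Par R T))" by (rule congr_par[OF scong_par_comm congr_refl])
  finally show ?thesis .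
qed

lemma news_par2: "Inl ` set Z \<inter> fn Q = {} \<Longrightarrow> scong D (Par Q (news Z P)) (news Z (Par Q P))"
  by (rule congr_trans[OF scong_par_comm congr_trans[OF news_par news_scong[OF scong_par_comm]]])

text \<open>The restrictions \<open>Z\<close> are chosen away from \<open>Q\<close> and
  \<open>Q'\<close>; only then is it known what \<open>W\<close> has to avoid, namely the components
  exposed in \<open>P\<close>. All restrictions can then be moved out, and the input is brought to
  the front as \<open>RCom\<close> expects it.\<close>

lemma exposes_com:
  assumes "exposes P (LOut x y) P'" "exposes Q (LIn x y) Q'" shows "red D (Par P Q) None (Par P' Q')"
proof -
  have "finite (fn Q \<union> fn Q')" by simp
  then obtain Z a P0 N R X where Z: "Inl ` set Z \<inter> ((fn Q \<union> fn Q') \<union> Inl ` n_label (Std (LOut x y))) = {}"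
    "scong D P (news Z (Par (Sum (Plus (Pre a P0) N)) R))" "acts_as a P0 (LOut x y) X" "scong D P' (news Z (Par X R))"
    by (rule exposesE[OF assms(1)])
  let ?A = "Sum (Plus (Pre a P0) N)"
  have "finite (fn (Par ?A R) \<union> fn (Par X R))" by (intro finite_UnI finite_fn)
  then obtain W b Q0 M T Y where W: "Inl ` set W \<inter> ((fn (Par ?A R) \<union> fn (Par X R)) \<union> Inl ` n_label (Std (LIn x y))) = {}"
    "scong D Q (news W (Par (Sum (Plus (Pre b Q0) M)) T))" "acts_as b Q0 (LIn x y) Y" "scong D Q' (news W (Par Y T))"
    by (rule exposesE[OF assms(2)])
  let ?B = "Sum (Plus (Pre b Q0) M)"
  have lift: "scong D (Par P1 Q1) (news Z (news W (Par (Par B A) (Par R T))))"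
    if "scong D P1 (news Z (Par A R))" "scong D Q1 (news W (Par B T))"
      "Inl ` set Z \<inter> fn Q1 = {}" "Inl ` set W \<inter> fn (Par A R) = {}" for P1 Q1 A B
  proof -
    have "scong D (Par P1 Q1) (Par (news Z (Par A R)) Q1)" by (rule congr_par[OF that(1) congr_refl])
    also have "scong D (Par (news Z (Par A R)) Q1) (news Z (Par (Par A R) Q1))" by (rule news_par[OF that(3)])
    also have "scong D (news Z (Par (Par A R) Q1)) (news Z (Par (Par A R) (news W (Par B T))))"
      by (rule news_scong[OF congr_par[OF congr_refl that(2)]])
    also have "scong D (news Z (Par (Par A R) (news W (Par B T)))) (news Z (news W (Par (Par A R) (Par B T))))"
      by (rule news_scong[OF news_par2[OF that(4)]])
    also have "scong D (news Z (news W (Par (Par A R) (Par B T)))) (news Z (news W (Par (Par B A) (Par R T))))"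
      by (rule news_scong[OF news_scong[OF scong_par_interchange]])
    finally show ?thesis .
  qed
  obtain z where a: "a = Out x y" "scong D P0 X" and b: "b = In x z" "scong D (subst1 z y Q0) Y"
    using Z(3) W(3) by auto
  have "red D (Par ?B ?A) None (Par (subst1 z y Q0) P0)" unfolding a b by (rule red.RCom)
  then have "red D (Par ?B ?A) None (Par Y X)"
    by (rule red.RCong[OF congr_refl _ congr_par[OF b(2) a(2)]])
  then have r: "red D (news Z (news W (Par (Par ?B ?A) (Par R T)))) None (news Z (news W (Par (Par Y X) (Par R T))))"
    by (intro red_news red.RPar)
  have "scong D (Par P Q) (news Z (news W (Par (Par ?B ?A) (Par R T))))"
    by (rule lift[OF Z(2) W(2)]) (use Z(1) W(1) in blast)+
  moreover have "scong D (Par P' Q') (news Z (news W (Par (Par Y X) (Par R T))))"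
    by (rule lift[OF Z(4) W(4)]) (use Z(1) W(1) in blast)+
  ultimately show ?thesis using red.RCong[OF _ r congr_sym] by blast
qed

text \<open>A bound output of \<open>P\<close> is a free output of the body of a restriction congruent to \<open>P\<close>.\<close>

primrec matched :: "('x, 'q, 'k) proc \<Rightarrow> 'x std_label \<Rightarrow> ('x, 'q, 'k) proc \<Rightarrow> bool" where
  "matched P LTau P' = red D P None P'"
| "matched P (LOut x y) P' = exposes P (LOut x y) P'"
| "matched P (LIn x y) P' = exposes P (LIn x y) P'"
| "matched P (LBOut x y) P' = (\<exists>P0. scong D P (Nu (BChan y) P0) \<and> exposes P0 (LOut x y) P')"

lemma matched_scong: "matched P \<mu> P' \<Longrightarrow> scong D Q P \<Longrightarrow> matched Q \<mu> P'"
  by (cases \<mu>) (auto intro: exposes_scong red.RCong congr_trans congr_refl)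

lemma matched_sum:
  assumes "step D (Sum M) (Std \<mu>) P'" shows "matched (Sum M) \<mu> P'"
proof -
  obtain a Q N where 1: "scong D (Sum M) (Sum (Plus (Pre a Q) N))" "acts_as a Q \<mu> P'"
    using step_sum_decomp[OF assms] by blast
  show ?thesis
  proof (cases \<mu>)
    case LTau
    then show ?thesis using 1 by (auto intro: red.RCong red.RTau)
  qed (use exposes_sum[OF assms] 1 in auto)
qed

lemma matched_par1: "matched P \<mu> P' \<Longrightarrow> Inl ` bn_label \<mu> \<inter> fn Q = {} \<Longrightarrow> matched (Par P Q) \<mu> (Par P' Q)"
proof (cases \<mu>)
  case (LBOut x y)
  assume "matched P \<mu> P'" "Inl ` bn_label \<mu> \<inter> fn Q = {}"
  then obtain P0 where P0: "scong D P (Nu (BChan y) P0)" "exposes P0 (LOut x y) P'" "Inl y \<notin> fn Q"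
    using LBOut by auto
  have "scong D (Par P Q) (Nu (BChan y) (Par P0 Q))"
    by (rule congr_trans[OF congr_par[OF P0(1) congr_refl] scong_scope]) (use P0 in simp)
  then show ?thesis using LBOut exposes_par1[OF P0(2)] by auto
qed (auto intro: red.RPar exposes_par1)

lemma matched_scong2: "matched P \<mu> P' \<Longrightarrow> scong D P' Q' \<Longrightarrow> matched P \<mu> Q'"
  by (cases \<mu>) (auto intro: red.RCong congr_refl; meson exposes_scong congr_refl congr_sym)+

lemma matched_par2: "matched Q \<mu> Q' \<Longrightarrow> Inl ` bn_label \<mu> \<inter> fn P = {} \<Longrightarrow> matched (Par P Q) \<mu> (Par P Q')"
  by (rule matched_scong2[OF matched_scong[OF matched_par1 scong_par_comm] scong_par_comm])

lemma matched_nu: "matched P \<mu> P' \<Longrightarrow> x \<notin> n_label (Std \<mu>) \<Longrightarrow> matched (Nu (BChan x) P) \<mu> (Nu (BChan x) P')"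
proof (cases \<mu>)
  case (LBOut u y)
  assume "matched P \<mu> P'" "x \<notin> n_label (Std \<mu>)"
  then obtain P0 where P0: "scong D P (Nu (BChan y) P0)" "exposes P0 (LOut u y) P'" "x \<noteq> y" "x \<noteq> u"
    using LBOut by auto
  have "scong D (Nu (BChan x) P) (Nu (BChan y) (Nu (BChan x) P0))"
    by (rule congr_trans[OF congr_nu[OF P0(1)] scong_swap]) (use P0 in simp)
  moreover have "exposes (Nu (BChan x) P0) (LOut u y) (Nu (BChan x) P')"
    by (rule exposes_nu[OF P0(2)]) (use P0 in simp)
  ultimately show ?thesis using LBOut by auto
qed (auto intro: red.RNu exposes_nu)

text \<open>Extending the scope of the output over \<open>Q\<close> turns the bound communication
  into a free one under a restriction.\<close>

lemma exposes_close:
  assumes "matched P (LBOut x y) P'" "exposes Q (LIn x y) Q'" "Inl y \<notin> fn Q"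
  shows "red D (Par P Q) None (Nu (BChan y) (Par P' Q'))"
proof -
  obtain P0 where P0: "scong D P (Nu (BChan y) P0)" "exposes P0 (LOut x y) P'" using assms(1) by auto
  have "red D (Nu (BChan y) (Par P0 Q)) None (Nu (BChan y) (Par P' Q'))"
    by (rule red.RNu[OF exposes_com[OF P0(2) assms(2)]]) simp
  moreover have "scong D (Par P Q) (Nu (BChan y) (Par P0 Q))"
    by (rule congr_trans[OF congr_par[OF P0(1) congr_refl] scong_scope]) (use assms in simp)
  ultimately show ?thesis by (rule red.RCong[OF _ _ congr_refl, rotated])
qed

lemma step_matched: "step D P \<eta> P' \<Longrightarrow> \<eta> = Std \<mu> \<Longrightarrow> matched P \<mu> P'"
proof (induct arbitrary: \<mu> rule: step.induct)
  case (ParL P \<nu> P' Q)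
  then show ?case by (intro matched_par1) auto
next
  case (ParR Q \<nu> Q' P)
  then show ?case by (intro matched_par2) auto
next
  case (ComL P x y P' Q Q')
  then show ?case using exposes_com by auto
next
  case (ComR P x y P' Q Q')
  then have "red D (Par Q P) None (Par Q' P')" using exposes_com by auto
  then show ?case using ComR(5) by (auto intro: red.RCong scong_par_comm)
next
  case (CloseL P x y P' Q Q')
  then show ?case using exposes_close by auto
next
  case (CloseR P x y P' Q Q')
  then have "red D (Par Q P) None (Nu (BChan y) (Par Q' P'))" by (intro exposes_close) auto
  then show ?case using CloseR(6) by (auto intro: red.RCong scong_par_comm congr_nu)
next
  case (Res P \<eta> P' x)
  then show ?case by (intro matched_nu) auto
next
  case (Open P x y P')
  then have "exposes P (LOut x y) P'" by auto
  then show ?case using Open(4) congr_refl[of "struct_law D" "Nu (BChan y) P"] by auto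
next
  case (Cons A ys B \<eta> P')
  then show ?case by (intro matched_scong[OF _ scong_unfold]) auto
next
  case (Alpha P Q \<nu> P')
  then have "matched Q \<mu> P'" by auto
  then show ?case by (rule matched_scong[OF _ alpha_scong[OF Alpha(1)]])
qed (auto intro: matched_sum step.Tau step.Out step.Inp step.SumL step.SumR simp del: matched.simps)

lemma step_red: "step D P (Std LTau) P' \<Longrightarrow> red D P None P'"
  using step_matched[of P "Std LTau" P' LTau] by simp

lemma harmony_tau:
  assumes "P \<in> core"
  shows "red D P None P' \<longleftrightarrow> (\<exists>P''. step D P (Std LTau) P'' \<and> scong D P'' P')"
  using red_step[OF _ assms] step_red red.RCong[OF congr_refl] by blast

end

section \<open>Stochastic derivatives\<close>

primrec msum :: "('x, 'q, 'k) summ \<Rightarrow> (('q + rate) \<times> ('x, 'q, 'k) proc) multiset" where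
  "msum Zero = {#}"
| "msum (Pre a P) = (case a of Stoch q \<Rightarrow> {#(Inl q, P)#} | Delay l \<Rightarrow> {#(Inr l, P)#} | _ \<Rightarrow> {#})"
| "msum (Plus M N) = msum M + msum N"

text \<open>Passing the binder of \<open>q\<close> is the moment at which a derivative waiting for
  \<open>q\<close> gets its rate.\<close>

fun rlab :: "('x, 'q) nu_binder \<Rightarrow> 'q + rate \<Rightarrow> 'q + rate" where
  "rlab (BChan x) k = k"
| "rlab (BStoch q l) k = (if k = Inl q then Inr l else k)"

fun lperm :: "('q \<Rightarrow> 'q) \<Rightarrow> 'q + rate \<Rightarrow> 'q + rate" where
  "lperm g (Inl q) = Inl (g q)"
| "lperm g (Inr l) = Inr l"

text \<open>
  The stochastic derivatives of a term, with multiplicity: those labeled \<open>Inl q\<close> wait for a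
  binder of \<open>q\<close>, those labeled \<open>Inr l\<close> can fire at rate \<open>l\<close>.
\<close>

inductive mder :: "('x, 'q, 'k) defs \<Rightarrow> ('x, 'q, 'k) proc \<Rightarrow> (('q + rate) \<times> ('x, 'q, 'k) proc) multiset \<Rightarrow> bool"
  for D where
  mder_sum: "mder D (Sum M) (msum M)"
| mder_par: "mder D P m \<Longrightarrow> mder D Q n \<Longrightarrow> mder D (Par P Q)
    (image_mset (map_prod id (\<lambda>X. Par X Q)) m + image_mset (map_prod id (Par P)) n)"
| mder_nu: "mder D P m \<Longrightarrow> mder D (Nu b P) (image_mset (map_prod (rlab b) (Nu b)) m)"
| mder_const: "mder D B' m \<Longrightarrow> unfolds D A ys B \<Longrightarrow> alpha B B' \<Longrightarrow> mder D (Const A ys) m"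
| mder_stuck: "(\<And>B. \<not> unfolds D A ys B) \<Longrightarrow> mder D (Const A ys) {#}"

inductive_cases mder_SumE: "mder D (Sum M) m"
inductive_cases mder_ParE: "mder D (Par P Q) m"
inductive_cases mder_NuE: "mder D (Nu b P) m"
inductive_cases mder_ConstE: "mder D (Const A ys) m"

lemma mder_Sum_iff [simp]: "mder D (Sum M) m \<longleftrightarrow> m = msum M"
  by (auto elim: mder_SumE intro: mder_sum)

lemma msum_fn: "(k, X) \<in># msum M \<Longrightarrow> fn X \<subseteq> fn_summ M \<and> (\<forall>q. k = Inl q \<longrightarrow> Inr q \<in> fn_summ M)"
  by (induct M rule: summ.induct[where ?P1.0 = "\<lambda>_. True"]) (auto split: prefix.splits)

lemma msum_perm: "msum (perm_summ f g M) = image_mset (map_prod (lperm g) (perm f g)) (msum M)"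
proof (induct M rule: summ.induct[where ?P1.0 = "\<lambda>_. True"])
  case (Pre a P)
  then show ?case by (cases a) auto
qed auto

lemma rlab_perm:
  assumes "inj g" shows "rlab (map_nu_binder f g b) (lperm g k) = lperm g (rlab b k)"
proof (cases b)
  case (BStoch q l)
  then show ?thesis using assms by (cases k) (auto simp: inj_eq)
qed simp

text \<open>The case of constants explains why \<open>mder_const\<close> admits an alpha-variant of
  the body: unfolding the renamed constant gives the renamed body only up to alpha.\<close>

lemma mder_perm:
  fixes P :: "('x :: infinite, 'q :: infinite, 'k) proc"
  assumes "wf_defs D" "mder D P m" "bij f" "bij g"
  shows "mder D (perm f g P) (image_mset (map_prod (lperm g) (perm f g)) m)"
  using assms(2)
proof induct
  case (mder_sum M)
  then show ?case by (simp add: msum_perm)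
next
  case (mder_par P m Q n)
  show ?case using mder.mder_par[OF mder_par(2,4)]
    by (simp add: multiset.map_comp comp_def map_prod_def case_prod_unfold)
next
  case (mder_nu P m b)
  have "rlab (map_nu_binder f g b) (lperm g k) = lperm g (rlab b k)" for k
    by (rule rlab_perm) (use assms in \<open>simp add: bij_is_inj\<close>)
  then show ?case using mder.mder_nu[OF mder_nu(2), of "map_nu_binder f g b"]
    by (simp add: multiset.map_comp comp_def map_prod_def case_prod_unfold)
next
  case (mder_const B' m A ys B)
  interpret defs D by unfold_locales (rule assms)
  obtain B1 where B1: "unfolds D A (map f ys) B1" "alpha (perm f g B) B1"
    using unfolds_perm[OF mder_const(3) assms(3,4)] by blast
  have "alpha B1 (perm f g B')"
    by (rule congr_trans[OF congr_sym[OF B1(2)] alpha_perm[OF mder_const(4) assms(3,4)]])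
  then show ?case using mder.mder_const[OF mder_const(2) B1(1)] by simp
next
  case (mder_stuck A ys)
  then have "\<not> unfolds D A (map f ys) B" for B by (auto simp: unfolds_def)
  then show ?case by (auto intro: mder.mder_stuck)
qed

context defs begin

lemma mder_fn: "mder D P m \<Longrightarrow> (k, X) \<in># m \<Longrightarrow> fn X \<subseteq> fn P \<and> (\<forall>q. k = Inl q \<longrightarrow> Inr q \<in> fn P)"
proof (induct arbitrary: k X rule: mder.induct)
  case (mder_sum M)
  then show ?case using msum_fn by simp
next
  case (mder_nu P m b)
  then obtain k' X' where X': "(k', X') \<in># m" "k = rlab b k'" "X = Nu b X'" by auto
  then show ?case using mder_nu(2)[OF X'(1)] by (cases b) (auto split: if_splits)
next
  case (mder_const B' m A ys B)
  have "fn B' \<subseteq> fn (Const A ys)" using unfolds_fn[OF mder_const(3)] alpha_fn[OF mder_const(4)] by simp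
  then show ?case using mder_const(2)[OF mder_const(5)] by blast
qed fastforce+

section \<open>Derivatives up to structural congruence\<close>

abbreviation cls :: "('x, 'q, 'k) proc \<Rightarrow> ('x, 'q, 'k) proc set" where
  "cls \<equiv> scong_class D"

lemma cls_eq [simp]: "cls P = cls Q \<longleftrightarrow> scong D P Q"
proof
  assume "cls P = cls Q"
  then have "Q \<in> cls P" by (simp add: scong_class_def congr_refl)
  then show "scong D P Q" by (simp add: scong_class_def)
next
  assume "scong D P Q"
  then show "cls P = cls Q" unfolding scong_class_def
    by (intro Collect_cong iffI) (meson congr_sym congr_trans)+
qed

text \<open>The union makes this total; for an operation that respects the congruence it is the
  induced map on classes. With \<open>h = Nu (BStoch q l)\<close> it is
  \<open>nu_class D q l\<close>.\<close>

definition clift :: "(('x, 'q, 'k) proc \<Rightarrow> ('x, 'q, 'k) proc) \<Rightarrow> ('x, 'q, 'k) proc set \<Rightarrow> ('x, 'q, 'k) proc set" where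
  "clift h e = (\<Union>P\<in>e. cls (h P))"

lemma clift_cls:
  assumes "\<And>P Q. scong D P Q \<Longrightarrow> scong D (h P) (h Q)" shows "clift h (cls P) = cls (h P)"
proof
  show "clift h (cls P) \<subseteq> cls (h P)"
    unfolding clift_def scong_class_def using assms by (auto intro: congr_trans)
  show "cls (h P) \<subseteq> clift h (cls P)"
    unfolding clift_def scong_class_def using congr_refl by blast
qed

definition cl :: "(('q + rate) \<times> ('x, 'q, 'k) proc) multiset \<Rightarrow> (('q + rate) \<times> ('x, 'q, 'k) proc set) multiset" where
  "cl m = image_mset (map_prod id cls) m"

lemma cl_plus [simp]: "cl (m + n) = cl m + cl n" by (simp add: cl_def)

lemma cl_image:
  assumes "\<And>P Q. scong D P Q \<Longrightarrow> scong D (h P) (h Q)"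
  shows "cl (image_mset (map_prod f h) m) = image_mset (map_prod f (clift h)) (cl m)"
  unfolding cl_def by (simp add: multiset.map_comp clift_cls[OF assms] comp_def map_prod_def case_prod_unfold)

lemma cl_image_cong:
  assumes "\<And>k X. (k, X) \<in># m \<Longrightarrow> f k = f' k \<and> scong D (h X) (h' X)"
  shows "cl (image_mset (map_prod f h) m) = cl (image_mset (map_prod f' h') m)"
  unfolding cl_def multiset.map_comp by (rule image_mset_cong) (use assms in auto)

lemma msum_alpha:
  assumes "alpha (Sum M) (Sum N)"
  shows "cl (msum M) = cl (msum N)"
  using assms
proof (induct M arbitrary: N rule: summ.induct[where ?P1.0 = "\<lambda>_. True"])
  case Zero
  have "db_summ (Zero :: ('x, 'q, 'k) summ) 0 (Inl :: _ \<Rightarrow> ('x + 'q) + nat) = db_summ N 0 Inl"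
    using Zero by (simp add: alpha_iff_db)
  then have "N = Zero" by (cases N) (auto split: prefix.splits)
  then show ?case by simp
next
  case (Plus M1 M2)
  have "db_summ (Plus M1 M2) 0 (Inl :: _ \<Rightarrow> ('x + 'q) + nat) = db_summ N 0 Inl"
    using Plus(3) by (simp add: alpha_iff_db)
  then obtain N1 N2 where N: "N = Plus N1 N2" by (cases N) (auto split: prefix.splits)
  have "alpha (Sum M1) (Sum N1)" "alpha (Sum M2) (Sum N2)"
    using Plus(3) unfolding N by (simp_all add: alpha_iff_db)
  then show ?case using Plus(1)[of N1] Plus(2)[of N2] unfolding N by simp
next
  case (Pre a' Q)
  have "db_summ (Pre a' Q) 0 (Inl :: _ \<Rightarrow> ('x + 'q) + nat) = db_summ N 0 Inl"
    using Pre(2) by (simp add: alpha_iff_db)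
  then obtain b P' where N: "N = Pre b P'" by (cases N) (auto split: prefix.splits)
  then show ?case using alpha_Pre_inv[OF Pre(2)[unfolded N]]
    by (cases a') (auto simp: cl_def intro: alpha_scong)
qed simp_all

lemma mder_alpha: "mder D P m \<Longrightarrow> alpha P Q \<Longrightarrow> \<exists>n. mder D Q n \<and> cl n = cl m"
proof (induct arbitrary: Q rule: mder.induct)
  case (mder_sum M)
  obtain N where "Q = Sum N" using alpha_Sum_inv[OF mder_sum] .
  then show ?case using msum_alpha mder_sum by auto
next
  case (mder_par P1 m P2 n)
  obtain Q1 Q2 where Q: "Q = Par Q1 Q2" "alpha P1 Q1" "alpha P2 Q2" using alpha_Par_inv[OF mder_par(5)] .
  obtain m' where m': "mder D Q1 m'" "cl m' = cl m" using mder_par(2)[OF Q(2)] by blast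
  obtain n' where n': "mder D Q2 n'" "cl n' = cl n" using mder_par(4)[OF Q(3)] by blast
  have "cl (image_mset (map_prod id (\<lambda>X. Par X Q2)) m') = cl (image_mset (map_prod id (\<lambda>X. Par X P2)) m')"
    by (rule cl_image_cong) (auto intro: congr_par congr_refl congr_sym[OF alpha_scong[OF Q(3)]])
  also have "\<dots> = cl (image_mset (map_prod id (\<lambda>X. Par X P2)) m)"
    by (subst (1 2) cl_image) (auto intro: congr_par congr_refl simp: m')
  finally have 1: "cl (image_mset (map_prod id (\<lambda>X. Par X Q2)) m') = cl (image_mset (map_prod id (\<lambda>X. Par X P2)) m)" .
  have "cl (image_mset (map_prod id (Par Q1)) n') = cl (image_mset (map_prod id (Par P1)) n')"
    by (rule cl_image_cong) (auto intro: congr_par congr_refl congr_sym[OF alpha_scong[OF Q(2)]])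
  also have "\<dots> = cl (image_mset (map_prod id (Par P1)) n)"
    by (subst (1 2) cl_image) (auto intro: congr_par congr_refl simp: n')
  finally show ?case using mder.mder_par[OF m'(1) n'(1)] 1 Q(1) by (intro exI conjI) (auto)
next
  case (mder_nu P m b)
  obtain c Q' where Q: "Q = Nu c Q'" "like b c" "bname c \<notin> fn (Nu b P)" "alpha (ren b c P) Q'"
    using alpha_Nu_inv[OF mder_nu(3)] .
  obtain f g where fg: "bij f" "bij g" "map_sum f g = transpose (bname b) (bname c)"
     "\<And>P :: ('x, 'q, 'k) proc. ren b c P = perm f g P"
    using ren_perm[OF Q(2)] by metis
  \<comment> \<open>The induction hypothesis is about alpha-variants of \<open>P\<close>, so
    \<open>Q'\<close> is renamed back to one, and the multiset obtained is renamed forth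
    again.\<close>
  have "ren b c (ren b c P) = P" by (rule ren_ren(1)[OF Q(2)])
  then have "alpha P (ren b c Q')" using alpha_ren_cong[OF Q(4,2)] by simp
  then obtain n where n: "mder D (ren b c Q') n" "cl n = cl m" using mder_nu(2) by blast
  let ?n = "image_mset (map_prod (lperm g) (ren b c)) n"
  have "mder D (ren b c (ren b c Q')) ?n"
    using mder_perm[OF wf n(1) fg(1,2)] by (simp add: fg(4)[abs_def] fg(4))
  then have Q'n: "mder D Q' ?n" by (simp add: ren_ren(1)[OF Q(2)])
  have eq: "cl ?n = cl (image_mset (map_prod (lperm g) (ren b c)) m)"
    by (subst (1 2) cl_image) (auto intro: scong_ren Q(2) simp: n)
  have "cl (image_mset (map_prod (rlab c) (Nu c)) ?n) = image_mset (map_prod (rlab c) (clift (Nu c))) (cl ?n)"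
    by (rule cl_image) (rule congr_nu)
  also have "\<dots> = cl (image_mset (map_prod (rlab c) (Nu c)) (image_mset (map_prod (lperm g) (ren b c)) m))"
    unfolding eq by (rule cl_image[symmetric]) (rule congr_nu)
  also have "\<dots> = cl (image_mset (map_prod (rlab c \<circ> lperm g) (\<lambda>X. Nu c (ren b c X))) m)"
    by (simp add: multiset.map_comp comp_def map_prod_def case_prod_unfold)
  also have "\<dots> = cl (image_mset (map_prod (rlab b) (Nu b)) m)"
  proof (rule cl_image_cong)
    fix k X assume kX: "(k, X) \<in># m"
    have X: "fn X \<subseteq> fn P" "\<And>q. k = Inl q \<Longrightarrow> Inr q \<in> fn P" using mder_fn[OF mder_nu(1) kX] by auto
    have "alpha (Nu b X) (Nu c (ren b c X))" by (rule alpha_ren[OF Q(2)]) (use X Q(3) in auto)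
    then have "scong D (Nu c (ren b c X)) (Nu b X)" by (rule congr_sym[OF alpha_scong])
    \<comment> \<open>A waiting label \<open>Inl s\<close> has \<open>s\<close> free in
      \<open>P\<close>, so \<open>s\<close> is not the name of \<open>c\<close> unless the binders
      coincide. Hence \<open>c\<close> rates after the renaming just what \<open>b\<close> rates
      before it.\<close>
    moreover have "(rlab c \<circ> lperm g) k = rlab b k"
    proof (cases k)
      case (Inl s)
      have "Inr (g s) = transpose (bname b) (bname c) (Inr s)" unfolding fg(3)[symmetric] by simp
      moreover have "Inr s \<noteq> bname c \<or> b = c" using X(2)[OF Inl] Q(2,3) like_bname_eq by fastforce
      ultimately show ?thesis using Inl Q(2)
        by (cases b; cases c) (auto simp: transpose_def split: if_splits)
    qed (cases b; cases c; simp)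
    ultimately show "(rlab c \<circ> lperm g) k = rlab b k \<and> scong D (Nu c (ren b c X)) (Nu b X)" by blast
  qed
  finally show ?case using mder.mder_nu[OF Q'n, of c] Q(1) by blast
next
  case (mder_const B' m A ys B)
  have "Q = Const A ys" by (rule alpha_Const_inv[OF mder_const(5)])
  then show ?case using mder.mder_const[OF mder_const(1,3,4)] by blast
next
  case (mder_stuck A ys)
  have "Q = Const A ys" by (rule alpha_Const_inv[OF mder_stuck(2)])
  then show ?case using mder.mder_stuck[OF mder_stuck(1)] by blast
qed

end

text \<open>
  By weak guardedness, unfolding the unguarded constants terminates, which yields the
  induction principle \<open>unf_induct\<close> below.
\<close>

primrec unguarded_consts :: "('x, 'q, 'k) proc \<Rightarrow> 'k set" where
  "unguarded_consts (Sum M) = {}"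
| "unguarded_consts (Par P Q) = unguarded_consts P \<union> unguarded_consts Q"
| "unguarded_consts (Nu b P) = unguarded_consts P"
| "unguarded_consts (Const A ys) = {A}"

lemma unguarded_consts_subst [simp]:
  fixes P :: "('x, 'q, 'k) proc"
  shows "unguarded_consts (subst s P) = unguarded_consts P"
proof (induct P arbitrary: s rule: proc.induct[where ?P2.0 = "\<lambda>_. True"])
  case (Nu b P)
  then show ?case by (cases b) (auto simp: Let_def)
qed auto

lemma unguarded_consts_unfolds: "unfolds D A ys B \<Longrightarrow> unguarded_consts B = unguarded_consts (snd (D A))"
  by (auto simp: unfolds_def instantiate_def)

lemma guarded_unguarded_consts: "guarded P \<Longrightarrow> unguarded_consts P = {}"
  by (induct P rule: proc.induct[where ?P2.0 = "\<lambda>_. True"]) auto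

text \<open>The accessible part of the relation of occurring unguarded in a body; its rule induction
  is what \<open>unf_induct\<close> rests on.\<close>

inductive grounded :: "('x, 'q, 'k) defs \<Rightarrow> 'k \<Rightarrow> bool" for D where
  "(\<And>A'. A' \<in> unguarded_consts (snd (D A)) \<Longrightarrow> grounded D A') \<Longrightarrow> grounded D A"

text \<open>What replaces a constant has the unguarded constants of its body, whatever the
  arguments, so if these are grounded then the constant is. Replacements inside sums leave the
  unguarded constants alone.\<close>

lemma replace1_grounded:
  "replace1 D P P' \<Longrightarrow> unguarded_consts P' \<subseteq> Collect (grounded D) \<Longrightarrow> unguarded_consts P \<subseteq> Collect (grounded D)"
  "replace1_summ D M M' \<Longrightarrow> True"
  by (induct rule: replace1_replace1_summ.inducts) (auto simp: unguarded_consts_unfolds intro: grounded.intros)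

lemma weakly_guarded_grounded: "weakly_guarded D P \<Longrightarrow> unguarded_consts P \<subseteq> Collect (grounded D)"
  unfolding weakly_guarded_def
proof (elim exE conjE)
  fix P' assume "(replace1 D)\<^sup>*\<^sup>* P P'" "guarded P'"
  then show ?thesis
    by (induct rule: converse_rtranclp_induct) (auto simp: guarded_unguarded_consts dest: replace1_grounded(1))
qed

lemma image_map_prod_comp:
  "image_mset (map_prod f h) (image_mset (map_prod f' h') m) = image_mset (map_prod (\<lambda>k. f (f' k)) (\<lambda>X. h (h' X))) m"
  by (simp add: multiset.map_comp comp_def map_prod_def case_prod_unfold)

section \<open>Markovian transitions as a set\<close>

inductive_cases mstep_ZeroE: "step D (Sum Zero) (Mark l i) P'"
inductive_cases mstep_PreE: "step D (Sum (Pre a P)) (Mark l i) P'"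
inductive_cases mstep_PlusE: "step D (Sum (Plus M N)) (Mark l i) P'"
inductive_cases mstep_ParE: "step D (Par P Q) (Mark l i) P'"
inductive_cases mstep_NuE: "step D (Nu b P) (Mark l i) P'"
inductive_cases mstep_ConstE: "step D (Const A ys) (Mark l i) P'"

definition marks :: "('x, 'q, 'k) defs \<Rightarrow> ('x, 'q, 'k) proc \<Rightarrow> (rate \<times> pos list \<times> ('x, 'q, 'k) proc) set" where
  "marks D P = {(l, i, P'). step D P (Mark l i) P'}"

lemma marks_Zero: "marks D (Sum Zero) = {}"
  by (auto simp: marks_def elim: mstep_ZeroE)

lemma marks_Pre: "marks D (Sum (Pre a P)) = (case a of Delay l \<Rightarrow> {(l, [], P)} | _ \<Rightarrow> {})"
  by (auto simp: marks_def elim!: mstep_PreE intro: step.MDelay split: prefix.splits)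

lemma marks_Plus: "marks D (Sum (Plus M N)) =
    (\<lambda>(l, i, X). (l, Plus0 # i, X)) ` marks D (Sum M) \<union> (\<lambda>(l, i, X). (l, Plus1 # i, X)) ` marks D (Sum N)"
  by (auto simp: marks_def image_iff elim!: mstep_PlusE intro: step.MSum0 step.MSum1)

lemma marks_Par: "marks D (Par P Q) =
    (\<lambda>(l, i, X). (l, Par0 # i, Par X Q)) ` marks D P \<union> (\<lambda>(l, i, X). (l, Par1 # i, Par P X)) ` marks D Q"
  by (auto simp: marks_def image_iff elim!: mstep_ParE intro: step.MPar0 step.MPar1)

lemma marks_Nu: "marks D (Nu (BChan x) P) = (\<lambda>(l, i, X). (l, i, Nu (BChan x) X)) ` marks D P"
  by (auto simp: marks_def image_iff elim!: mstep_NuE intro: step.Res)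

lemma mset_set_image_Un:
  assumes "finite A" "finite B" "inj_on f A" "inj_on g B" "f ` A \<inter> g ` B = {}"
  shows "mset_set (f ` A \<union> g ` B) = image_mset f (mset_set A) + image_mset g (mset_set B)"
  using assms by (simp add: mset_set_Union image_mset_mset_set)

lemma summands_msum:
  "(Inl q, X) \<in># msum M \<Longrightarrow> (Stoch q, X) \<in># summands M"
  "(Inr l, X) \<in># msum M \<Longrightarrow> (Delay l, X) \<in># summands M"
  by (induct M rule: summ.induct[where ?P1.0 = "\<lambda>_. True"]) (auto split: prefix.splits)

context defs begin

lemma scong_extract:
  assumes "(a, Q) \<in># summands M" shows "\<exists>N. scong D (Sum M) (Sum (Plus (Pre a Q) N))"
  using assms
proof (induct M rule: summ.induct[where ?P1.0 = "\<lambda>_. True"])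
  case (Pre b P)
  then show ?case using congr_sym[OF scong_plus_zero[of D "Pre b P"]] by auto
next
  case (Plus M1 M2)
  have *: "\<exists>N. scong D (Sum (Plus M1 M2)) (Sum (Plus (Pre a Q) N))"
    if A: "scong D (Sum (Plus M1 M2)) (Sum (Plus M N))" and B: "(\<exists>N. scong D (Sum M) (Sum (Plus (Pre a Q) N)))" for M N
  proof -
    obtain N' where "scong D (Sum M) (Sum (Plus (Pre a Q) N'))" using B by blast
    then have "scong D (Sum (Plus M N)) (Sum (Plus (Plus (Pre a Q) N') N))" by (rule congr_plus[OF _ congr_refl])
    then show ?thesis using congr_trans[OF A congr_trans[OF _ scong_plus_assoc]] by blast
  qed
  from Plus(3) consider "(a, Q) \<in># summands M1" | "(a, Q) \<in># summands M2" by auto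
  then show ?case
    using Plus(1) Plus(2) *[OF congr_refl] *[OF scong_plus_comm] by cases blast+
qed auto

text \<open>The choice of alpha-variants in unfoldings can give one term several multisets, so the
  comparison is a transfer: to each multiset of \<open>P\<close> there is one of \<open>Q\<close>
  with the same classes.\<close>

definition msim :: "('x, 'q, 'k) proc \<Rightarrow> ('x, 'q, 'k) proc \<Rightarrow> bool" where
  "msim P Q \<longleftrightarrow> (\<forall>m. mder D P m \<longrightarrow> (\<exists>n. mder D Q n \<and> cl n = cl m))"

lemma msimD: assumes "msim P Q" "mder D P m" obtains n where "mder D Q n" "cl n = cl m"
  using assms unfolding msim_def by blast

lemma msim_par:
  assumes "msim P P'" "msim Q Q'" "scong D P P'" "scong D Q Q'" shows "msim (Par P Q) (Par P' Q')"
  unfolding msim_def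
proof (intro allI impI)
  fix M assume "mder D (Par P Q) M"
  then obtain m n where M: "M = image_mset (map_prod id (\<lambda>X. Par X Q)) m + image_mset (map_prod id (Par P)) n"
    and mn: "mder D P m" "mder D Q n" by (auto elim: mder_ParE)
  obtain m' where m': "mder D P' m'" "cl m' = cl m" using msimD[OF assms(1) mn(1)] .
  obtain n' where n': "mder D Q' n'" "cl n' = cl n" using msimD[OF assms(2) mn(2)] .
  have "cl (image_mset (map_prod id (\<lambda>X. Par X Q')) m') = cl (image_mset (map_prod id (\<lambda>X. Par X Q)) m')"
    by (rule cl_image_cong) (auto intro: congr_par congr_refl congr_sym[OF assms(4)])
  also have "\<dots> = cl (image_mset (map_prod id (\<lambda>X. Par X Q)) m)"
    by (subst (1 2) cl_image) (auto intro: congr_par congr_refl simp: m')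
  finally have 1: "cl (image_mset (map_prod id (\<lambda>X. Par X Q')) m') = cl (image_mset (map_prod id (\<lambda>X. Par X Q)) m)" .
  have "cl (image_mset (map_prod id (Par P')) n') = cl (image_mset (map_prod id (Par P)) n')"
    by (rule cl_image_cong) (auto intro: congr_par congr_refl congr_sym[OF assms(3)])
  also have "\<dots> = cl (image_mset (map_prod id (Par P)) n)"
    by (subst (1 2) cl_image) (auto intro: congr_par congr_refl simp: n')
  finally show "\<exists>n. mder D (Par P' Q') n \<and> cl n = cl M"
    using mder.mder_par[OF m'(1) n'(1)] 1 M by (intro exI conjI) (auto)
qed

lemma msim_nu: assumes "msim P P'" shows "msim (Nu b P) (Nu b P')"
  unfolding msim_def
proof (intro allI impI)
  fix M assume "mder D (Nu b P) M"
  then obtain m where M: "M = image_mset (map_prod (rlab b) (Nu b)) m" and m: "mder D P m" by (auto elim: mder_NuE)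
  obtain n where n: "mder D P' n" "cl n = cl m" using msimD[OF assms m] .
  have "cl (image_mset (map_prod (rlab b) (Nu b)) n) = cl M"
    unfolding M by (subst (1 2) cl_image) (auto intro: congr_nu simp: n)
  then show "\<exists>n. mder D (Nu b P') n \<and> cl n = cl M" using mder.mder_nu[OF n(1)] by blast
qed

lemma msim_sum: "msim (Sum M) (Sum N) \<longleftrightarrow> cl (msum N) = cl (msum M)"
  by (simp add: msim_def)

text \<open>The name of \<open>b\<close> is not free in \<open>Q\<close>. So no derivative of
  \<open>Q\<close> waits for it, its label passes the binder unchanged, and its target still
  satisfies the condition of the scope law.\<close>

lemma mder_scope:
  assumes "bname b \<notin> fn Q" "mder D P m" "mder D Q n"
  shows "cl (image_mset (map_prod id (\<lambda>X. Par X Q)) (image_mset (map_prod (rlab b) (Nu b)) m) + image_mset (map_prod id (Par (Nu b P))) n)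
   = cl (image_mset (map_prod (rlab b) (Nu b)) (image_mset (map_prod id (\<lambda>X. Par X Q)) m + image_mset (map_prod id (Par P)) n))"
proof -
  have "cl (image_mset (map_prod (\<lambda>k. id (rlab b k)) (\<lambda>X. Par (Nu b X) Q)) m) =
     cl (image_mset (map_prod (\<lambda>k. rlab b (id k)) (\<lambda>X. Nu b (Par X Q))) m)"
    by (rule cl_image_cong) (simp add: scong_scope assms)
  moreover have "cl (image_mset (map_prod id (Par (Nu b P))) n) =
     cl (image_mset (map_prod (\<lambda>k. rlab b (id k)) (\<lambda>X. Nu b (Par P X))) n)"
  proof (rule cl_image_cong)
    fix k X assume kX: "(k, X) \<in># n"
    then have f: "fn X \<subseteq> fn Q" "\<And>q. k = Inl q \<Longrightarrow> Inr q \<in> fn Q" using mder_fn[OF assms(3)] by blast+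
    have "scong D (Par (Nu b P) X) (Nu b (Par P X))" by (rule scong_scope) (use f assms in auto)
    moreover have "rlab b k = k" using f(2) assms(1) by (cases b) auto
    ultimately show "id k = rlab b (id k) \<and> scong D (Par (Nu b P) X) (Nu b (Par P X))" by simp
  qed
  ultimately show ?thesis by (simp only: image_mset_union image_map_prod_comp cl_plus)
qed

lemma msim_struct: assumes "struct_law D P Q" shows "msim P Q \<and> msim Q P"
  using assms
proof cases
  case 1
  have "alpha P Q" using 1 by (rule congr_base)
  then show ?thesis unfolding msim_def using mder_alpha congr_sym by meson
next
  case (2 b Q' P')
  have "msim (Par (Nu b P') Q') (Nu b (Par P' Q'))" unfolding msim_def
  proof (intro allI impI)
    fix M assume "mder D (Par (Nu b P') Q') M"
    then obtain m n where "mder D P' m" "mder D Q' n"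
      and "M = image_mset (map_prod id (\<lambda>X. Par X Q')) (image_mset (map_prod (rlab b) (Nu b)) m) + image_mset (map_prod id (Par (Nu b P'))) n"
      by (auto elim!: mder_ParE mder_NuE)
    then show "\<exists>n. mder D (Nu b (Par P' Q')) n \<and> cl n = cl M"
      using mder_scope[OF 2(3)] mder.mder_nu[OF mder.mder_par] by metis
  qed
  moreover have "msim (Nu b (Par P' Q')) (Par (Nu b P') Q')" unfolding msim_def
  proof (intro allI impI)
    fix M assume "mder D (Nu b (Par P' Q')) M"
    then obtain m n where "mder D P' m" "mder D Q' n"
      and "M = image_mset (map_prod (rlab b) (Nu b)) (image_mset (map_prod id (\<lambda>X. Par X Q')) m + image_mset (map_prod id (Par P')) n)"
      by (auto elim!: mder_ParE mder_NuE)
    then show "\<exists>n. mder D (Par (Nu b P') Q') n \<and> cl n = cl M"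
      using mder_scope[OF 2(3)] mder.mder_par[OF mder.mder_nu] by metis
  qed
  ultimately show ?thesis unfolding 2 by blast
next
  case (3 b c P')
  have *: "msim (Nu b (Nu c P')) (Nu c (Nu b P'))" if "bname b \<noteq> bname c" for b c unfolding msim_def
  proof (intro allI impI)
    fix M assume "mder D (Nu b (Nu c P')) M"
    then obtain m where m: "mder D P' m"
      and M: "M = image_mset (map_prod (rlab b) (Nu b)) (image_mset (map_prod (rlab c) (Nu c)) m)"
      by (auto elim!: mder_NuE)
    have r: "rlab c (rlab b k) = rlab b (rlab c k)" for k using that by (cases b; cases c) auto
    have "cl (image_mset (map_prod (\<lambda>k. rlab c (rlab b k)) (\<lambda>X. Nu c (Nu b X))) m) =
        cl (image_mset (map_prod (\<lambda>k. rlab b (rlab c k)) (\<lambda>X. Nu b (Nu c X))) m)"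
      by (rule cl_image_cong) (use that in \<open>simp add: r scong_swap\<close>)
    then show "\<exists>n. mder D (Nu c (Nu b P')) n \<and> cl n = cl M"
      using mder.mder_nu[OF mder.mder_nu[OF m]] unfolding M image_map_prod_comp by metis
  qed
  show ?thesis unfolding 3(1,2) using *[OF 3(3)] *[OF 3(3)[symmetric]] by blast
next
  case (4 b)
  have "mder D (Nu b (Sum Zero)) m \<longleftrightarrow> m = {#}" for m
    using mder.mder_nu[OF mder.mder_sum[of D Zero]] by (auto elim!: mder_NuE)
  then show ?thesis unfolding 4 msim_def by simp
next
  case (8 P1 P2 P3)
  have eq: "cl (image_mset (map_prod id (\<lambda>X. Par X P3)) (image_mset (map_prod id (\<lambda>X. Par X P2)) m1 + image_mset (map_prod id (Par P1)) m2)
      + image_mset (map_prod id (Par (Par P1 P2))) m3)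
    = cl (image_mset (map_prod id (\<lambda>X. Par X (Par P2 P3))) m1 + image_mset (map_prod id (Par P1))
       (image_mset (map_prod id (\<lambda>X. Par X P3)) m2 + image_mset (map_prod id (Par P2)) m3))" for m1 m2 m3
    unfolding image_mset_union image_map_prod_comp cl_plus id_apply add.assoc
    by (intro arg_cong2[where f = "(+)"] cl_image_cong) (simp_all add: scong_par_assoc)
  have "msim (Par (Par P1 P2) P3) (Par P1 (Par P2 P3))" unfolding msim_def
  proof (intro allI impI)
    fix M assume "mder D (Par (Par P1 P2) P3) M"
    then obtain m1 m2 m3 where "mder D P1 m1" "mder D P2 m2" "mder D P3 m3"
      "M = image_mset (map_prod id (\<lambda>X. Par X P3)) (image_mset (map_prod id (\<lambda>X. Par X P2)) m1 + image_mset (map_prod id (Par P1)) m2)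
      + image_mset (map_prod id (Par (Par P1 P2))) m3" by (elim mder_ParE) blast
    then show "\<exists>n. mder D (Par P1 (Par P2 P3)) n \<and> cl n = cl M"
      using eq[of m1 m2 m3] mder.mder_par[OF _ mder.mder_par] by metis
  qed
  moreover have "msim (Par P1 (Par P2 P3)) (Par (Par P1 P2) P3)" unfolding msim_def
  proof (intro allI impI)
    fix M assume "mder D (Par P1 (Par P2 P3)) M"
    then obtain m1 m2 m3 where "mder D P1 m1" "mder D P2 m2" "mder D P3 m3"
      "M = image_mset (map_prod id (\<lambda>X. Par X (Par P2 P3))) m1 + image_mset (map_prod id (Par P1))
       (image_mset (map_prod id (\<lambda>X. Par X P3)) m2 + image_mset (map_prod id (Par P2)) m3)" by (elim mder_ParE) blast
    then show "\<exists>n. mder D (Par (Par P1 P2) P3) n \<and> cl n = cl M"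
      using eq[of m1 m2 m3] mder.mder_par[OF mder.mder_par] by metis
  qed
  ultimately show ?thesis unfolding 8 by blast
next
  case (9 P1 P2)
  have *: "msim (Par P1 P2) (Par P2 P1)" for P1 P2 unfolding msim_def
  proof (intro allI impI)
    fix M assume "mder D (Par P1 P2) M"
    then obtain m1 m2 where m: "mder D P1 m1" "mder D P2 m2"
      "M = image_mset (map_prod id (\<lambda>X. Par X P2)) m1 + image_mset (map_prod id (Par P1)) m2" by (elim mder_ParE) blast
    have "cl (image_mset (map_prod id (\<lambda>X. Par X P2)) m1) = cl (image_mset (map_prod id (Par P2)) m1)"
      by (rule cl_image_cong) (simp add: scong_par_comm)
    moreover have "cl (image_mset (map_prod id (\<lambda>X. Par X P1)) m2) = cl (image_mset (map_prod id (Par P1)) m2)"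
      by (rule cl_image_cong) (simp add: scong_par_comm)
    ultimately show "\<exists>n. mder D (Par P2 P1) n \<and> cl n = cl M"
      using mder.mder_par[OF m(2,1)] unfolding m(3) by (intro exI conjI) (auto simp: add.commute)
  qed
  show ?thesis unfolding 9 using * by blast
next
  case 10
  have "cl (image_mset (map_prod id (\<lambda>X. Par X (Sum Zero))) m) = cl (image_mset (map_prod id id) m)" for m
    by (rule cl_image_cong) (simp add: scong_par_zero)
  then have eq: "cl (image_mset (map_prod id (\<lambda>X. Par X (Sum Zero))) m + image_mset (map_prod id (Par Q)) {#}) = cl m" for m
    by (simp add: map_prod.id)
  show ?thesis unfolding 10 msim_def
  proof (intro conjI allI impI)
    fix M assume "mder D (Par Q (Sum Zero)) M"
    then show "\<exists>n. mder D Q n \<and> cl n = cl M" using eq by (auto elim!: mder_ParE)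
  next
    fix m assume "mder D Q m"
    then show "\<exists>n. mder D (Par Q (Sum Zero)) n \<and> cl n = cl m"
      using eq[of m] mder.mder_par[of D Q m "Sum Zero" "{#}"] by auto
  qed
next
  case (11 A ys)
  show ?thesis unfolding 11(1) msim_def
  proof (intro conjI allI impI)
    fix m assume "mder D (Const A ys) m"
    then show "\<exists>n. mder D Q n \<and> cl n = cl m"
    proof cases
      case (mder_const B' B)
      then have "alpha Q B'" using unfolds_det[OF 11(2)] by blast
      then show ?thesis by (rule mder_alpha[OF mder_const(1) congr_sym])
    next
      case mder_stuck
      then show ?thesis using 11(2) by blast
    qed
  next
    fix m assume "mder D Q m"
    then show "\<exists>n. mder D (Const A ys) n \<and> cl n = cl m" using mder.mder_const[OF _ 11(2) congr_refl] by blast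
  qed
next
  case (12 q M P' l)
  let ?b = "BStoch q l :: ('x, 'q) nu_binder"
  \<comment> \<open>No derivative of \<open>M\<close> waits for the fresh \<open>q\<close>, so the
    new binder changes neither the labels from \<open>M\<close> nor, up to congruence, their
    targets. The derivative of \<open>(q)\<close> gets at the binder the rate that
    \<open>(\<lambda>)\<close> had.\<close>
  have "cl (image_mset (map_prod id id) (msum M)) = cl (image_mset (map_prod (rlab ?b) (Nu ?b)) (msum M))"
  proof (rule cl_image_cong)
    fix k X assume "(k, X) \<in># msum M"
    then have f: "fn X \<subseteq> fn_summ M" "\<And>q. k = Inl q \<Longrightarrow> Inr q \<in> fn_summ M" using msum_fn by blast+
    have "scong D X (Nu ?b X)" by (rule congr_sym[OF scong_nu_vacuous]) (use f 12 in auto)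
    moreover have "rlab ?b k = k" using f(2) 12(3) by auto
    ultimately show "id k = rlab ?b k \<and> scong D (id X) (Nu ?b X)" by simp
  qed
  moreover have "cls P' = cls (Nu ?b P')" unfolding cls_eq
    by (rule congr_sym[OF scong_nu_vacuous]) (use 12 in auto)
  ultimately have eq: "cl (msum (Plus (Pre (Delay l) P') M)) =
      cl (image_mset (map_prod (rlab ?b) (Nu ?b)) (msum (Plus (Pre (Stoch q) P') M)))"
    by (simp add: map_prod.id cl_def del: cls_eq)
  show ?thesis unfolding 12(1,2) msim_def
  proof (intro conjI allI impI)
    fix m assume "mder D (Sum (Plus (Pre (Delay l) P') M)) m"
    then have m: "m = msum (Plus (Pre (Delay l) P') M)" by (simp only: mder_Sum_iff)
    show "\<exists>n. mder D (Nu ?b (Sum (Plus (Pre (Stoch q) P') M))) n \<and> cl n = cl m"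
      unfolding m by (rule exI, rule conjI, rule mder.mder_nu, rule mder.mder_sum, rule eq[symmetric])
  next
    fix m assume "mder D (Nu ?b (Sum (Plus (Pre (Stoch q) P') M))) m"
    then have m: "m = image_mset (map_prod (rlab ?b) (Nu ?b)) (msum (Plus (Pre (Stoch q) P') M))"
      by (elim mder_NuE) (simp only: mder_Sum_iff)
    show "\<exists>n. mder D (Sum (Plus (Pre (Delay l) P') M)) n \<and> cl n = cl m"
      unfolding m by (rule exI, rule conjI, rule mder.mder_sum, rule eq)
  qed
qed (simp_all add: msim_sum ac_simps)

lemma msim_scong: "scong D P Q \<Longrightarrow> msim P Q \<and> msim Q P"
proof (induct rule: congr.induct)
  case (congr_base P Q)
  then show ?case by (rule msim_struct)
next
  case (congr_refl P)
  then show ?case by (auto simp: msim_def)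
next
  case (congr_trans P Q R)
  then show ?case unfolding msim_def by metis
next
  case (congr_par P P' Q Q')
  then show ?case using msim_par congr_sym by blast
next
  case (congr_nu P P' b)
  then show ?case using msim_nu by blast
next
  case (congr_pre P P' a)
  then show ?case by (cases a) (auto simp: msim_sum cl_def intro: congr_sym)
next
  case (congr_plus M M' N N')
  then show ?case unfolding msim_sum msum.simps cl_plus by metis
next
  case (congr_sym P Q)
  then show ?case by blast
qed

lemma mder_scong: assumes "mder D P m" "scong D P Q" obtains n where "mder D Q n" "cl n = cl m"
  using msim_scong[OF assms(2)] assms(1) unfolding msim_def by blast

lemma grounded_all: "grounded D A"
proof -
  obtain xs B where "D A = (xs, B)" by fastforce
  then have "weakly_guarded D (snd (D A))" using wf unfolding wf_defs_def by auto
  then have "unguarded_consts (snd (D A)) \<subseteq> Collect (grounded D)" by (rule weakly_guarded_grounded)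
  then have "grounded D A'" if "A' \<in> unguarded_consts (snd (D A))" for A' using that by auto
  then show ?thesis by (rule grounded.intros)
qed

lemma unf_induct [case_names Sum Par Nu Const Stuck]:
  assumes sum: "\<And>M. \<Phi> (Sum M)"
    and par: "\<And>P Q. \<Phi> P \<Longrightarrow> \<Phi> Q \<Longrightarrow> \<Phi> (Par P Q)"
    and nu: "\<And>b P. \<Phi> P \<Longrightarrow> \<Phi> (Nu b P)"
    and const: "\<And>A ys B. unfolds D A ys B \<Longrightarrow> \<Phi> B \<Longrightarrow> \<Phi> (Const A ys)"
    and stuck: "\<And>A ys. (\<And>B. \<not> unfolds D A ys B) \<Longrightarrow> \<Phi> (Const A ys)"
  shows "\<Phi> P"
proof -
  \<comment> \<open>Only the unguarded constants are asked for, since \<open>sum\<close> covers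
    whatever stands under a prefix.\<close>
  have struct: "\<Phi> P" if "\<And>A ys. A \<in> unguarded_consts P \<Longrightarrow> \<Phi> (Const A ys)" for P
    using that by (induct P rule: proc.induct[where ?P2.0 = "\<lambda>_. True"]) (auto intro: sum par nu)
  have "\<Phi> (Const A ys)" for A ys
    using grounded_all[of A]
  proof (induct arbitrary: ys)
    case (1 A)
    show ?case
    proof (cases "\<exists>B. unfolds D A ys B")
      case True
      then obtain B where B: "unfolds D A ys B" by blast
      have "\<Phi> B" by (rule struct) (use 1 unguarded_consts_unfolds[OF B] in auto)
      with B show ?thesis by (rule const)
    qed (use stuck in blast)
  qed
  then show ?thesis by (rule struct)
qed

lemma mder_total: "\<exists>m. mder D P m"
proof (induct P rule: unf_induct)
  case (Const A ys B)
  then obtain m where "mder D B m" by blast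
  then have "mder D (Const A ys) m" by (rule mder.mder_const[OF _ Const(1) congr_refl])
  then show ?case ..
qed (blast intro: mder.mder_sum mder.mder_par mder.mder_nu mder.mder_stuck)+

text \<open>Forgetting the position string can identify different transitions; this is where
  multiplicities come from.\<close>

definition mcl :: "rate \<times> pos list \<times> ('x, 'q, 'k) proc \<Rightarrow> ('q + rate) \<times> ('x, 'q, 'k) proc set" where
  "mcl = (\<lambda>(l, i, X). (Inr l, cls X))"

lemma marks_Sum:
  "Sum M \<in> core \<Longrightarrow> finite (marks D (Sum M)) \<and> cl (msum M) = image_mset mcl (mset_set (marks D (Sum M)))"
proof (induct M rule: summ.induct[where ?P1.0 = "\<lambda>_. True"])
  case Zero
  then show ?case by (simp add: marks_Zero cl_def)
next
  case (Pre a P)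
  then show ?case by (cases a) (auto simp: marks_Pre cl_def mcl_def core_def)
next
  case (Plus M N)
  then have f: "finite (marks D (Sum M))" "finite (marks D (Sum N))" by (auto simp: core_def)
  \<comment> \<open>The leading letters keep the two images disjoint, so no transition is lost in
    the union.\<close>
  have "mset_set (marks D (Sum (Plus M N))) = image_mset (\<lambda>(l, i, X). (l, Plus0 # i, X)) (mset_set (marks D (Sum M))) +
    image_mset (\<lambda>(l, i, X). (l, Plus1 # i, X)) (mset_set (marks D (Sum N)))"
    unfolding marks_Plus by (rule mset_set_image_Un[OF f]) (auto simp: inj_on_def)
  then have "image_mset mcl (mset_set (marks D (Sum (Plus M N)))) =
     image_mset mcl (mset_set (marks D (Sum M))) + image_mset mcl (mset_set (marks D (Sum N)))"
    by (simp add: multiset.map_comp comp_def mcl_def case_prod_unfold)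
  then show ?case using Plus f by (simp add: marks_Plus core_def)
qed simp_all

text \<open>In \<open>core\<close> only channel binders are passed, which change no label. The
  position string records the side taken at each sum and parallel composition, so equal derivatives
  from two sides stay two transitions; unfolding a constant adds no letter, and the constant has
  exactly the transitions of its body.\<close>

lemma mder_marks:
  "P \<in> core \<Longrightarrow> mder D P m \<Longrightarrow> finite (marks D P) \<and> cl m = image_mset mcl (mset_set (marks D P))"
proof (induct P arbitrary: m rule: unf_induct)
  case (Sum M)
  then show ?case using marks_Sum by simp
next
  case (Par P Q)
  from Par(4) obtain m1 m2 where m: "m = image_mset (map_prod id (\<lambda>X. Par X Q)) m1 + image_mset (map_prod id (Par P)) m2"
    "mder D P m1" "mder D Q m2" by (elim mder_ParE) blast
  have 1: "finite (marks D P)" "cl m1 = image_mset mcl (mset_set (marks D P))"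
    and 2: "finite (marks D Q)" "cl m2 = image_mset mcl (mset_set (marks D Q))"
    using Par m by auto
  have c1: "clift (\<lambda>X. Par X Q) (cls X) = cls (Par X Q)" for X
    by (rule clift_cls) (intro congr_par congr_refl)
  have c2: "clift (Par P) (cls X) = cls (Par P X)" for X
    by (rule clift_cls) (intro congr_par congr_refl)
  have "mset_set (marks D (Par P Q)) = image_mset (\<lambda>(l, i, X). (l, Par0 # i, Par X Q)) (mset_set (marks D P)) +
    image_mset (\<lambda>(l, i, X). (l, Par1 # i, Par P X)) (mset_set (marks D Q))"
    unfolding marks_Par by (rule mset_set_image_Un[OF 1(1) 2(1)]) (auto simp: inj_on_def)
  then have "image_mset mcl (mset_set (marks D (Par P Q))) =
     image_mset (map_prod id (clift (\<lambda>X. Par X Q))) (cl m1) + image_mset (map_prod id (clift (Par P))) (cl m2)"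
    unfolding 1(2) 2(2) by (simp add: multiset.map_comp comp_def mcl_def case_prod_unfold c1 c2)
  also have "\<dots> = cl m"
    unfolding m(1) cl_plus by (intro arg_cong2[where f = "(+)"] cl_image[symmetric] congr_par congr_refl)
  finally show ?case using 1(1) 2(1) by (simp add: marks_Par)
next
  case (Nu b P)
  obtain x where b: "b = BChan x" "P \<in> core" using core_NuE[OF Nu(2)] by blast
  from Nu(3) obtain m1 where m: "m = image_mset (map_prod (rlab b) (Nu b)) m1" "mder D P m1" by (elim mder_NuE) blast
  have 1: "finite (marks D P)" "cl m1 = image_mset mcl (mset_set (marks D P))" using Nu(1)[OF b(2) m(2)] by auto
  have c1: "clift (Nu b) (cls X) = cls (Nu b X)" for X
    by (rule clift_cls) (intro congr_nu)
  have "inj_on (\<lambda>(l, i, X). (l, i, Nu b X)) (marks D P)" by (auto simp: inj_on_def)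
  then have "mset_set (marks D (Nu b P)) = image_mset (\<lambda>(l, i, X). (l, i, Nu b X)) (mset_set (marks D P))"
    unfolding b marks_Nu by (simp add: image_mset_mset_set b)
  then have "image_mset mcl (mset_set (marks D (Nu b P))) = image_mset (map_prod (rlab b) (clift (Nu b))) (cl m1)"
    unfolding 1(2) by (simp add: multiset.map_comp comp_def mcl_def case_prod_unfold c1[unfolded b(1)] b)
  also have "\<dots> = cl m" unfolding m(1) by (intro cl_image[symmetric] congr_nu)
  finally show ?case using 1(1) by (simp add: marks_Nu b)
next
  case (Const A ys B)
  have "marks D (Const A ys) = marks D B"
    unfolding marks_def using Const(1) by (auto elim!: mstep_ConstE dest: unfolds_det intro: step.Cons)
  moreover have "msim (Const A ys) B" using msim_scong[OF scong_unfold[OF Const(1)]] by blast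
  then obtain n where "mder D B n" "cl n = cl m" using Const(4) by (rule msimD)
  ultimately show ?case using Const(2)[OF unfolds_core[OF Const(1)]] by metis
next
  case (Stuck A ys)
  have "marks D (Const A ys) = {}" unfolding marks_def using Stuck(1) by (auto elim!: mstep_ConstE)
  moreover have "m = {#}" using Stuck(1,3) by (auto elim: mder_ConstE)
  ultimately show ?case by (simp add: cl_def)
qed

text \<open>\<open>RCong\<close> changes the target within its class, hence a membership of classes;
  the converse \<open>label_red\<close> can name the target itself.\<close>

lemma red_label: "red D P a P' \<Longrightarrow> a = Some q \<Longrightarrow> mder D P m \<Longrightarrow> (Inl q, cls P') \<in># cl m"
proof (induct arbitrary: m rule: red.induct)
  case (RStoch q' P M)
  then show ?case by (simp add: cl_def)
next
  case (RPar P a P' Q)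
  from RPar(4) obtain m1 m2 where m: "m = image_mset (map_prod id (\<lambda>X. Par X Q)) m1 + image_mset (map_prod id (Par P)) m2"
    "mder D P m1" "mder D Q m2" by (elim mder_ParE) blast
  have "(Inl q, cls P') \<in># cl m1" using RPar(2,3) m(2) by blast
  then have "(Inl q, clift (\<lambda>X. Par X Q) (cls P')) \<in># image_mset (map_prod id (clift (\<lambda>X. Par X Q))) (cl m1)"
    by (auto intro!: image_eqI[of _ _ "(Inl q, cls P')"])
  also have "clift (\<lambda>X. Par X Q) (cls P') = cls (Par P' Q)" by (rule clift_cls) (intro congr_par congr_refl)
  also have "image_mset (map_prod id (clift (\<lambda>X. Par X Q))) (cl m1) = cl (image_mset (map_prod id (\<lambda>X. Par X Q)) m1)"
    by (rule cl_image[symmetric]) (intro congr_par congr_refl)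
  finally show ?case unfolding m(1) by simp
next
  case (RNu P a P' b)
  from RNu(5) obtain m1 where m: "m = image_mset (map_prod (rlab b) (Nu b)) m1" "mder D P m1" by (elim mder_NuE) blast
  have "(Inl q, cls P') \<in># cl m1" using RNu(2,4) m(2) by blast
  then have "(rlab b (Inl q), clift (Nu b) (cls P')) \<in># image_mset (map_prod (rlab b) (clift (Nu b))) (cl m1)"
    by (auto intro!: image_eqI[of _ _ "(Inl q, cls P')"])
  also have "clift (Nu b) (cls P') = cls (Nu b P')" by (rule clift_cls) (intro congr_nu)
  also have "image_mset (map_prod (rlab b) (clift (Nu b))) (cl m1) = cl m"
    unfolding m(1) by (rule cl_image[symmetric]) (intro congr_nu)
  also have "rlab b (Inl q) = Inl q" using RNu(3,4) by (cases b) auto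
  finally show ?case .
next
  case (RCong P Q a Q' P')
  obtain n where "mder D Q n" "cl n = cl m" using RCong(6,1) by (rule mder_scong)
  then have "(Inl q, cls Q') \<in># cl m" using RCong(3,5) by metis
  moreover have "cls Q' = cls P'" using RCong(4) by simp
  ultimately show ?case by (simp del: cls_eq)
qed simp_all

lemma red_par2: "red D Q a Q' \<Longrightarrow> red D (Par P Q) a (Par P Q')"
  by (rule red.RCong[OF scong_par_comm red.RPar scong_par_comm])

lemma label_red: "mder D P m \<Longrightarrow> (Inl q, X) \<in># m \<Longrightarrow> red D P (Some q) X"
proof (induct arbitrary: X rule: mder.induct)
  case (mder_sum M)
  then obtain N where "scong D (Sum M) (Sum (Plus (Pre (Stoch q) X) N))"
    using scong_extract[OF summands_msum(1)] by blast
  then show ?case by (rule red.RCong[OF _ red.RStoch congr_refl])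
next
  case (mder_par P m Q n)
  then show ?case by (auto intro: red.RPar red_par2)
next
  case (mder_nu P m b)
  then obtain k X' where k: "(k, X') \<in># m" "rlab b k = Inl q" "X = Nu b X'" by auto
  then have "k = Inl q" "bname b \<noteq> Inr q" by (cases b; auto split: if_splits)+
  then show ?case using mder_nu(2)[of X'] k by (auto intro: red.RNu)
next
  case (mder_const B' m A ys B)
  have "scong D (Const A ys) B'" by (rule congr_trans[OF scong_unfold[OF mder_const(3)] alpha_scong[OF mder_const(4)]])
  then show ?case using mder_const(2,5) by (blast intro: red.RCong congr_refl)
qed simp

text \<open>Any one derivative with a rate can be brought under an outermost stochastic binder: a
  prefix \<open>(\<lambda>)\<close> is expanded by the delay law, and a binder already present is
  renamed. The set \<open>S\<close> keeps the name fresh for the context through which the binder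
  then moves out.\<close>

lemma delay_red:
  fixes S :: "('x + 'q) set"
  shows "mder D P m \<Longrightarrow> (Inr l, X) \<in># m \<Longrightarrow> finite S \<Longrightarrow>
  \<exists>q Q Q'. Inr q \<notin> S \<and> scong D P (Nu (BStoch q l) Q) \<and> red D Q (Some q) Q'"
proof (induct arbitrary: X S rule: mder.induct)
  case (mder_sum M)
  obtain N where N: "scong D (Sum M) (Sum (Plus (Pre (Delay l) X) N))"
    using scong_extract[OF summands_msum(2)] mder_sum by blast
  have "finite (Inr -` (S \<union> fn_summ N \<union> fn X))" using mder_sum by (simp add: finite_vimageI)
  then obtain q where "q \<notin> Inr -` (S \<union> fn_summ N \<union> fn X)" using fresh_chan by blast
  then have q: "Inr q \<notin> S" "Inr q \<notin> fn_summ N \<union> fn X" by auto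
  show ?case
    by (rule exI, rule exI, rule exI, rule conjI[OF q(1)], rule conjI[OF congr_trans[OF N scong_delay[OF q(2)]]],
      rule red.RStoch)
next
  case (mder_par P m Q n)
  from mder_par(5) consider X' where "(Inr l, X') \<in># m" | X' where "(Inr l, X') \<in># n" by auto
  then show ?case
  proof cases
    case 1
    have "finite (S \<union> fn Q)" using mder_par by simp
    then obtain q R R' where q: "Inr q \<notin> S \<union> fn Q" "scong D P (Nu (BStoch q l) R)" "red D R (Some q) R'"
      using mder_par(2)[OF 1] by blast
    have "scong D (Par P Q) (Nu (BStoch q l) (Par R Q))"
      by (rule congr_trans[OF congr_par[OF q(2) congr_refl] scong_scope]) (use q in simp)
    then show ?thesis using q red.RPar by blast
  next
    case 2
    have "finite (S \<union> fn P)" using mder_par by simp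
    then obtain q R R' where q: "Inr q \<notin> S \<union> fn P" "scong D Q (Nu (BStoch q l) R)" "red D R (Some q) R'"
      using mder_par(4)[OF 2] by blast
    have "scong D (Par P Q) (Nu (BStoch q l) (Par P R))"
      by (rule congr_trans[OF congr_par[OF congr_refl q(2)] scong_scope2]) (use q in simp)
    then show ?thesis using q red_par2 by blast
  qed
next
  case (mder_nu P m b)
  then obtain k X' where k: "(k, X') \<in># m" "rlab b k = Inr l" by auto
  show ?case
  proof (cases k)
    case (Inr l')
    then have k': "(Inr l, X') \<in># m" using k by (cases b) auto
    have "finite (S \<union> {bname b})" using mder_nu by simp
    then obtain q R R' where q: "Inr q \<notin> S \<union> {bname b}" "scong D P (Nu (BStoch q l) R)" "red D R (Some q) R'"
      using mder_nu(2)[OF k'] by blast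
    have "scong D (Nu b P) (Nu (BStoch q l) (Nu b R))"
      by (rule congr_trans[OF congr_nu[OF q(2)] scong_swap]) (use q in auto)
    moreover have "red D (Nu b R) (Some q) (Nu b R')" by (rule red.RNu[OF q(3)]) (use q in auto)
    ultimately show ?thesis using q by blast
  next
    \<comment> \<open>The derivative gets its rate at this very binder, which only has to be renamed
      away from \<open>S\<close>.\<close>
    case (Inl q)
    then have b: "b = BStoch q l" using k by (cases b) (auto split: if_splits)
    have "finite (Inr -` (S \<union> fn P))" using mder_nu by (simp add: finite_vimageI)
    then obtain r where "r \<notin> Inr -` (S \<union> fn P)" using fresh_chan by blast
    then have r: "Inr r \<notin> S" "Inr r \<notin> fn P" by auto
    let ?c = "BStoch r l"
    have "alpha (Nu b P) (Nu ?c (ren b ?c P))" by (rule alpha_ren) (use r b in auto)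
    moreover have "mder D (perm id (transpose q r) P) (image_mset (map_prod (lperm (transpose q r)) (perm id (transpose q r))) m)"
      by (rule mder_perm[OF wf mder_nu(1)]) (simp_all add: bij_transpose)
    moreover have "(Inl r, perm id (transpose q r) X') \<in># image_mset (map_prod (lperm (transpose q r)) (perm id (transpose q r))) m"
      using k(1) Inl by (auto intro!: image_eqI[of _ _ "(Inl q, X')"])
    ultimately show ?thesis using label_red r(1) alpha_scong b by (metis ren.simps(2))
  qed
next
  case (mder_const B' m A ys B)
  have "scong D (Const A ys) B'" by (rule congr_trans[OF scong_unfold[OF mder_const(3)] alpha_scong[OF mder_const(4)]])
  then show ?case using mder_const(2,5,6) by (blast intro: congr_trans)
qed simp

end

section \<open>Rated and waiting derivatives\<close>

definition rates :: "(('q + rate) \<times> 'c) multiset \<Rightarrow> (rate \<times> 'c) multiset" where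
  "rates M = image_mset (map_prod projr id) {#z \<in># M. \<not> isl (fst z)#}"

definition waits :: "'q \<Rightarrow> (('q + rate) \<times> 'c) multiset \<Rightarrow> 'c multiset" where
  "waits q M = image_mset snd {#z \<in># M. fst z = Inl q#}"

lemma waits_plus [simp]: "waits q (M + N) = waits q M + waits q N" by (simp add: waits_def)

lemma rates_nu:
  "rates (image_mset (map_prod (rlab (BStoch q l)) h) M) =
    image_mset (map_prod id h) (rates M) + image_mset (\<lambda>e. (l, h e)) (waits q M)"
  by (induct M) (auto simp: rates_def waits_def)

lemma size_waits_map: "size (waits q (image_mset (map_prod id h) M)) = size (waits q M)"
  by (induct M) (auto simp: waits_def)

lemma size_waits_nu: "bname b \<noteq> Inr q \<Longrightarrow> size (waits q (image_mset (map_prod (rlab b) h) M)) = size (waits q M)"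
  by (induct M) (cases b; auto simp: waits_def)+

lemma size_waits_perm: "bij g \<Longrightarrow> size (waits q (image_mset (map_prod (lperm (inv g)) h) M)) = size (waits (g q) M)"
proof (induct M)
  case (add z M)
  have "lperm (inv g) k = Inl q \<longleftrightarrow> k = Inl (g q)" for k
    using add(2) by (cases k) (auto simp: bij_is_inj bij_is_surj surj_f_inv_f)
  then show ?case using add by (cases z) (auto simp: waits_def)
qed (simp add: waits_def)

lemma mem_rates: "(l, e) \<in># rates M \<longleftrightarrow> (Inr l, e) \<in># M"
proof -
  have "(l, e) = map_prod projr id z \<and> z \<in># M \<and> \<not> isl (fst z) \<longleftrightarrow> z = (Inr l, e) \<and> z \<in># M" for z :: "('b + rate) \<times> 'a"
    by (cases z; cases "fst z") auto
  then show ?thesis unfolding rates_def by (auto simp: image_iff)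
qed

lemma mem_waits: "e \<in># waits q M \<longleftrightarrow> (Inl q, e) \<in># M"
  by (force simp: waits_def image_iff)

section \<open>Stochastic transitions\<close>

text \<open>
  Every active stochastic binder binds at most one active occurrence of its name.  Constants are
  harmless since their definitions lie in \<open>core\<close>.
\<close>

primrec good :: "('x, 'q, 'k) defs \<Rightarrow> ('x, 'q, 'k) proc \<Rightarrow> bool" where
  "good D (Sum M) = True"
| "good D (Par P Q) = (good D P \<and> good D Q)"
| "good D (Nu b P) = (good D P \<and> (\<forall>q l m. b = BStoch q l \<longrightarrow> mder D P m \<longrightarrow> size (waits q m) \<le> 1))"
| "good D (Const A ys) = True"

lemma core_good: "P \<in> core \<Longrightarrow> good D P"
proof (induct P rule: proc.induct[where ?P2.0 = "\<lambda>_. True"])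
  case (Nu b P)
  then show ?case by (cases b) auto
qed auto

context defs begin

text \<open>The condition at a binder of the permuted term concerns every multiset of the permuted
  scope; the inverse permutation pulls it back to a multiset of the original scope.\<close>

lemma good_perm:
  assumes "good D P" "bij f" "bij g" shows "good D (perm f g P)"
  using assms(1)
proof (induct P rule: proc.induct[where ?P2.0 = "\<lambda>_. True"])
  case (Nu b P)
  have "size (waits r m) \<le> 1" if b: "map_nu_binder f g b = BStoch r l" and m: "mder D (perm f g P) m" for r l m
  proof -
    obtain q where q: "b = BStoch q l" "r = g q" using b by (cases b) auto
    let ?m = "image_mset (map_prod (lperm (inv g)) (perm (inv f) (inv g))) m"
    have "mder D (perm (inv f) (inv g) (perm f g P)) ?m"
      by (rule mder_perm[OF wf m]) (use assms in \<open>simp_all add: bij_imp_bij_inv\<close>)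
    moreover have "inv f \<circ> f = id" "inv g \<circ> g = id" using assms by (simp_all add: bij_is_inj)
    then have "perm (inv f) (inv g) (perm f g P) = P" by (simp only: perm_comp perm_id)
    ultimately have "mder D P ?m" by simp
    then have "size (waits q ?m) \<le> 1" using Nu(2) q by auto
    then show ?thesis by (simp add: size_waits_perm[OF assms(3)] q)
  qed
  then show ?case using Nu by auto
qed auto

lemma good_alpha_law: "alpha_law P Q \<Longrightarrow> good D P = good D Q"
proof (induct rule: alpha_law.induct)
  case (1 y P x)
  have t: "transpose x y \<circ> transpose x y = id" by (simp add: fun_eq_iff)
  have "good D (perm (transpose x y) id P) = good D P"
    using good_perm[of P "transpose x y" id] good_perm[of "perm (transpose x y) id P" "transpose x y" id]
    by (auto simp: bij_transpose perm_comp t)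
  then show ?case by (simp add: perm_def)
next
  case (2 r P q l)
  have t: "transpose q r \<circ> transpose q r = id" by (simp add: fun_eq_iff)
  have e: "perm id (transpose q r) (Nu (BStoch q l) P) = Nu (BStoch r l) (perm id (transpose q r) P)" by simp
  have "good D (Nu (BStoch q l) P) = good D (Nu (BStoch r l) (perm id (transpose q r) P))"
  proof
    assume "good D (Nu (BStoch q l) P)"
    then show "good D (Nu (BStoch r l) (perm id (transpose q r) P))"
      using good_perm[of "Nu (BStoch q l) P" id "transpose q r"] unfolding e by (simp only: bij_id bij_transpose)
  next
    assume "good D (Nu (BStoch r l) (perm id (transpose q r) P))"
    then have "good D (perm id (transpose q r) (Nu (BStoch r l) (perm id (transpose q r) P)))"
      by (rule good_perm) (simp_all add: bij_transpose)
    moreover have "perm id (transpose q r) (Nu (BStoch r l) (perm id (transpose q r) P)) = Nu (BStoch q l) P"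
      by (simp add: perm_comp t)
    ultimately show "good D (Nu (BStoch q l) P)" by (simp only:)
  qed
  then show ?case by (simp only: perm_def)
next
  case (3 z P x y)
  then show ?case by simp
qed

lemma size_waits_cl: "size (waits q (cl m)) = size (waits q m)"
  unfolding cl_def by (rule size_waits_map)

lemma waits_fresh:
  assumes "mder D P m" "Inr q \<notin> fn P" shows "waits q m = {#}"
proof -
  have "(Inl q, X) \<notin># m" for X using mder_fn[OF assms(1)] assms(2) by blast
  then have "X \<notin># waits q m" for X by (simp add: mem_waits)
  then show ?thesis by (metis multiset_nonemptyE)
qed

lemma waits_nu_ok:
  assumes "bname c \<noteq> Inr q"
  shows "(\<forall>m. mder D (Nu c P) m \<longrightarrow> size (waits q m) \<le> 1) \<longleftrightarrow> (\<forall>m. mder D P m \<longrightarrow> size (waits q m) \<le> 1)"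
  using size_waits_nu[OF assms] by (metis mder_NuE mder.mder_nu)

lemma waits_par_ok:
  assumes "Inr q \<notin> fn Q"
  shows "(\<forall>m. mder D (Par P Q) m \<longrightarrow> size (waits q m) \<le> 1) \<longleftrightarrow> (\<forall>m. mder D P m \<longrightarrow> size (waits q m) \<le> 1)"
proof -
  have e: "size (waits q (image_mset (map_prod id (\<lambda>X. Par X Q)) m + image_mset (map_prod id (Par P)) n)) = size (waits q m)"
    if "mder D Q n" for m n
    using waits_fresh[OF that assms] by (simp add: size_waits_map)
  show ?thesis
  proof (intro iffI allI impI)
    fix m assume A: "\<forall>m. mder D (Par P Q) m \<longrightarrow> size (waits q m) \<le> 1" and m: "mder D P m"
    \<comment> \<open>Totality of \<open>mder\<close> enters here: a multiset of \<open>P\<close>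
      extends to one of \<open>Par P Q\<close> only if \<open>Q\<close> has one.\<close>
    obtain n where n: "mder D Q n" using mder_total by blast
    show "size (waits q m) \<le> 1" using A mder.mder_par[OF m n] e[OF n] by metis
  next
    fix m assume A: "\<forall>m. mder D P m \<longrightarrow> size (waits q m) \<le> 1" and m: "mder D (Par P Q) m"
    from m obtain m1 m2 where "m = image_mset (map_prod id (\<lambda>X. Par X Q)) m1 + image_mset (map_prod id (Par P)) m2"
      "mder D P m1" "mder D Q m2" by (elim mder_ParE) blast
    then show "size (waits q m) \<le> 1" using A e by metis
  qed
qed

lemma good_struct: assumes "struct_law D P Q" shows "good D P = good D Q"
  using assms
proof cases
  case 1
  then show ?thesis by (rule good_alpha_law)
next
  case (2 b Q' P')
  then show ?thesis using waits_par_ok[of _ Q' P'] by (cases b) auto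
next
  case (3 b c P')
  then show ?thesis using waits_nu_ok[of b] waits_nu_ok[of c] by (cases b; cases c) auto
next
  case (11 A ys)
  then show ?thesis using core_good[OF unfolds_core[OF 11(2)]] by simp
next
  case (12 q M P' l)
  \<comment> \<open>Since \<open>q\<close> is fresh for \<open>M\<close>, the delay law creates a
    binder with exactly one waiting derivative.\<close>
  have "waits q (msum M) = {#}" by (rule waits_fresh[OF mder.mder_sum]) (use 12 in simp)
  then show ?thesis using 12 by (simp add: waits_def)
qed (auto simp: waits_def)

lemma good_scong: "scong D P Q \<Longrightarrow> good D P = good D Q"
proof (induct rule: congr.induct)
  case (congr_base P Q)
  then show ?case by (rule good_struct)
next
  case (congr_nu P P' b)
  have "(\<forall>m. mder D P m \<longrightarrow> size (waits q m) \<le> 1) \<longleftrightarrow> (\<forall>m. mder D P' m \<longrightarrow> size (waits q m) \<le> 1)" for q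
    using mder_scong[OF _ congr_nu(1)] mder_scong[OF _ congr_sym[OF congr_nu(1)]] size_waits_cl by metis
  then show ?case using congr_nu(2) by (cases b) auto
qed simp_all

section \<open>Transitions to rate distributions\<close>

abbreviation rcl :: "(('q + rate) \<times> ('x, 'q, 'k) proc) multiset \<Rightarrow> ('x, 'q, 'k) rate_dist" where
  "rcl m \<equiv> rates (cl m)"

abbreviation nub :: "'q \<Rightarrow> rate \<Rightarrow> (('q + rate) \<times> ('x, 'q, 'k) proc) multiset \<Rightarrow> (('q + rate) \<times> ('x, 'q, 'k) proc) multiset" where
  "nub q l m \<equiv> image_mset (map_prod (rlab (BStoch q l :: ('x, 'q) nu_binder)) (Nu (BStoch q l))) m"

text \<open>If just one derivative waits for \<open>q\<close>, this is the distribution in the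
  conclusion of \<open>Sto1\<close>; if moreover nothing below the binder has a rate, it is that of
  \<open>Sto2\<close>.\<close>

lemma rcl_nu:
  "rcl (nub q l m) =
    nu_dist D q l (rcl m) + image_mset (\<lambda>e. (l, nu_class D q l e)) (waits q (cl m))"
proof -
  have c: "clift (Nu (BStoch q l)) = nu_class D q l" by (simp add: clift_def nu_class_def fun_eq_iff)
  have "cl (nub q l m) =
      image_mset (map_prod (rlab (BStoch q l :: ('x, 'q) nu_binder)) (clift (Nu (BStoch q l)))) (cl m)"
    by (rule cl_image) (rule congr_nu)
  then have "rcl (nub q l m) = image_mset (map_prod id (nu_class D q l)) (rcl m) + image_mset (\<lambda>e. (l, nu_class D q l e)) (waits q (cl m))"
    unfolding c by (simp only: rates_nu)
  then show ?thesis by (simp add: nu_dist_def map_prod_def)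
qed

lemma nu_class_cls: "nu_class D q l (cls P) = cls (Nu (BStoch q l) P)"
  using clift_cls[of "Nu (BStoch q l)" P] congr_nu unfolding clift_def nu_class_def by blast

text \<open>In \<open>Sto1\<close> and in \<open>Sto2\<close> a derivative waiting for
  \<open>q\<close> meets its binder and so contributes a rate. The argument is the same for every
  reading \<open>N\<close> of the negative premise, which is what will make that reading
  unique.\<close>

lemma sto_fires:
  assumes "sto_rules D N P \<sigma>" "mder D P m" shows "rcl m \<noteq> {#}"
  using assms
proof (induct arbitrary: m)
  case (Sto1 P \<sigma> q P' l)
  from Sto1(4) obtain m1 where m: "m = nub q l m1" "mder D P m1"
    by (elim mder_NuE) blast
  have "(Inl q, cls P') \<in># cl m1" by (rule red_label[OF Sto1(3) refl m(2)])
  then have "waits q (cl m1) \<noteq> {#}" by (metis mem_waits empty_not_add_mset multi_member_split)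
  then show ?case unfolding m(1) rcl_nu by simp
next
  case (Sto2 P q P' l)
  from Sto2(3) obtain m1 where m: "m = nub q l m1" "mder D P m1"
    by (elim mder_NuE) blast
  have "(Inl q, cls P') \<in># cl m1" by (rule red_label[OF Sto2(2) refl m(2)])
  then have "waits q (cl m1) \<noteq> {#}" by (metis mem_waits empty_not_add_mset multi_member_split)
  then show ?case unfolding m(1) rcl_nu by simp
next
  case (StoCong P Q \<sigma>)
  obtain n where "mder D Q n" "cl n = cl m" using StoCong(4,1) by (rule mder_scong)
  then show ?case using StoCong(3) by metis
qed

text \<open>The measure counts derivatives with a rate. One of them is put under an outermost
  binder; below that binder it is merely waiting, so fewer rates remain there. Only when none
  remains is \<open>N\<close> asked for, and then \<open>Sto2\<close> applies.\<close>

lemma fires_sto: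
  assumes N: "\<And>P m. mder D P m \<Longrightarrow> rcl m = {#} \<Longrightarrow> N P"
  shows "mder D P m \<Longrightarrow> rcl m \<noteq> {#} \<Longrightarrow> \<exists>\<sigma>. sto_rules D N P \<sigma>"
proof (induct "size (rcl m)" arbitrary: P m rule: less_induct)
  case less
  obtain l e where "(l, e) \<in># rcl m" using less(3) by (metis multiset_nonemptyE surj_pair)
  then obtain X where X: "(Inr l, X) \<in># m" by (auto simp: mem_rates cl_def)
  obtain q Q Q' where Q: "scong D P (Nu (BStoch q l) Q)" "red D Q (Some q) Q'"
    using delay_red[OF less(2) X finite.emptyI] by blast
  obtain n where n: "mder D (Nu (BStoch q l) Q) n" "cl n = cl m" using less(2) Q(1) by (rule mder_scong)
  from n(1) obtain m1 where m1: "n = nub q l m1" "mder D Q m1"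
    by (elim mder_NuE) blast
  have "\<exists>\<sigma>. sto_rules D N (Nu (BStoch q l) Q) \<sigma>"
  proof (cases "rcl m1 = {#}")
    case True
    then have "N Q" by (rule N[OF m1(2)])
    then show ?thesis using sto_rules.Sto2[OF _ Q(2)] by blast
  next
    case False
    have "(Inl q, cls Q') \<in># cl m1" by (rule red_label[OF Q(2) refl m1(2)])
    then have "waits q (cl m1) \<noteq> {#}" by (metis mem_waits empty_not_add_mset multi_member_split)
    then have "size (rcl m1) < size (rcl m)"
      unfolding n(2)[symmetric] m1(1) rcl_nu by (simp add: nu_dist_def nonempty_has_size)
    then obtain \<sigma> where "sto_rules D N Q \<sigma>" using less(1)[OF _ m1(2) False] by blast
    then show ?thesis using sto_rules.Sto1[OF _ Q(2)] by blast
  qed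
  then show ?case using sto_rules.StoCong[OF Q(1)] by blast
qed

text \<open>The meaning that the negative premise must have, expressed without reference to
  stochastic transitions.\<close>

definition quiet :: "('x, 'q, 'k) proc \<Rightarrow> bool" where
  "quiet P \<longleftrightarrow> (\<exists>m. mder D P m \<and> rcl m = {#})"

lemma sto_quiet:
  assumes "\<And>P m. mder D P m \<Longrightarrow> rcl m = {#} \<Longrightarrow> N P"
  shows "(\<exists>\<sigma>. sto_rules D N P \<sigma>) \<longleftrightarrow> \<not> quiet P"
proof
  assume "\<exists>\<sigma>. sto_rules D N P \<sigma>"
  then show "\<not> quiet P" using sto_fires unfolding quiet_def by blast
next
  assume q: "\<not> quiet P"
  obtain m where m: "mder D P m" using mder_total by blast
  then have "rcl m \<noteq> {#}" using q unfolding quiet_def by blast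
  with m show "\<exists>\<sigma>. sto_rules D N P \<sigma>" by (rule fires_sto[rotated]) (rule assms)
qed

text \<open>Existence: with the premise read as \<open>quiet\<close>, transitions exist exactly
  where \<open>quiet\<close> fails, so the reading agrees with itself. Uniqueness: in a solution
  \<open>R\<close> a term without rates has no transition, by \<open>sto_fires\<close>; so the
  negative premise of \<open>R\<close> holds wherever \<open>quiet\<close> does, and
  \<open>sto_quiet\<close> makes the two equal.\<close>

lemma sto_eq: "sto D = sto_rules D quiet"
  unfolding sto_def
proof (rule the_equality)
  have "(\<lambda>P. \<not> (\<exists>\<sigma>. sto_rules D quiet P \<sigma>)) = quiet"
    using sto_quiet[of quiet] quiet_def by (intro ext) blast
  then show "sto_rules D quiet = sto_rules D (\<lambda>P. \<not> (\<exists>\<sigma>. sto_rules D quiet P \<sigma>))" by simp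
next
  fix R assume R: "R = sto_rules D (\<lambda>P. \<not> (\<exists>\<sigma>. R P \<sigma>))"
  let ?N = "\<lambda>P. \<not> (\<exists>\<sigma>. R P \<sigma>)"
  have "?N P" if "mder D P m" "rcl m = {#}" for P m
  proof
    assume "\<exists>\<sigma>. R P \<sigma>"
    then have "\<exists>\<sigma>. sto_rules D ?N P \<sigma>" by (rule arg_cong[where f = "\<lambda>R. \<exists>\<sigma>. R P \<sigma>", OF R, THEN iffD1])
    then show False using sto_fires that by blast
  qed
  then have *: "(\<exists>\<sigma>. sto_rules D ?N P \<sigma>) \<longleftrightarrow> \<not> quiet P" for P by (rule sto_quiet)
  have "(\<exists>\<sigma>. R P \<sigma>) \<longleftrightarrow> \<not> quiet P" for P
    by (rule trans[OF arg_cong[where f = "\<lambda>R. \<exists>\<sigma>. R P \<sigma>", OF R] *])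
  then have "?N = quiet" by (intro ext) simp
  then show "R = sto_rules D quiet" by (rule trans[OF R arg_cong[where f = "sto_rules D"]])
qed

lemma ex_sto: "mder D P m \<Longrightarrow> (\<exists>\<sigma>. sto D P \<sigma>) \<longleftrightarrow> rcl m \<noteq> {#}"
proof -
  assume m: "mder D P m"
  have "\<exists>\<sigma>. sto_rules D quiet P \<sigma>" if "rcl m \<noteq> {#}"
    by (rule fires_sto[OF _ m that]) (auto simp: quiet_def)
  then show ?thesis unfolding sto_eq using sto_fires[OF _ m] by blast
qed

lemma waits_single:
  assumes "size M \<le> 1" "e \<in># M" shows "M = {#e#}"
  using assms by (cases M) (auto simp: size_eq_0_iff_empty)

text \<open>In a good term the \<open>P'\<close> picked by a rule is, up to congruence, the only
  derivative waiting for \<open>q\<close>. So the rule collects all that the binder contributes, and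
  by \<open>rcl_nu\<close> the distribution is complete.\<close>

lemma sto_char: "sto_rules D quiet P \<sigma> \<Longrightarrow> good D P \<Longrightarrow> mder D P m \<Longrightarrow> \<sigma> = rcl m"
proof (induct arbitrary: m rule: sto_rules.induct)
  case (Sto1 P \<sigma> q P' l)
  from Sto1(5) obtain m1 where m: "m = nub q l m1" "mder D P m1"
    by (elim mder_NuE) blast
  have "size (waits q m1) \<le> 1" using Sto1(4) m(2) by auto
  moreover have "cls P' \<in># waits q (cl m1)" unfolding mem_waits by (rule red_label[OF Sto1(3) refl m(2)])
  ultimately have w: "waits q (cl m1) = {#cls P'#}" by (intro waits_single) (simp_all add: size_waits_cl)
  have "\<sigma> = rcl m1" using Sto1(2,4) m(2) by simp
  then show ?case unfolding m(1) rcl_nu w by (simp add: nu_class_cls)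
next
  case (Sto2 P q P' l)
  from Sto2(4) obtain m1 where m: "m = nub q l m1" "mder D P m1"
    by (elim mder_NuE) blast
  have "size (waits q m1) \<le> 1" using Sto2(3) m(2) by auto
  moreover have "cls P' \<in># waits q (cl m1)" unfolding mem_waits by (rule red_label[OF Sto2(2) refl m(2)])
  ultimately have w: "waits q (cl m1) = {#cls P'#}" by (intro waits_single) (simp_all add: size_waits_cl)
  \<comment> \<open>\<open>quiet\<close> provides some multiset without rates, which may differ from
    \<open>m1\<close>. The two are compared through the existence of a transition, which
    \<open>ex_sto\<close> ties to each of them.\<close>
  have "\<not> (\<exists>\<sigma>. sto D P \<sigma>)"
  proof -
    obtain m0 where "mder D P m0" "rcl m0 = {#}" using Sto2(1) unfolding quiet_def by blast
    then show ?thesis using ex_sto by blast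
  qed
  then have "rcl m1 = {#}" using ex_sto[OF m(2)] by blast
  then show ?case unfolding m(1) rcl_nu w by (simp add: nu_class_cls nu_dist_def)
next
  case (StoCong P Q \<sigma>)
  obtain n where "mder D Q n" "cl n = cl m" using StoCong(5,1) by (rule mder_scong)
  then show ?case using StoCong(3) StoCong(4) good_scong[OF StoCong(1)] by metis
qed

section \<open>Comparing the two sums\<close>

lemma rcl_marks:
  assumes "P \<in> core" "mder D P m"
  shows "rcl m = image_mset (\<lambda>(l, i, X). (l, cls X)) (mset_set (marks D P))"
proof -
  have "rates (image_mset mcl A) = image_mset (\<lambda>(l, i, X). (l, cls X)) A" for A
    by (induct A) (auto simp: rates_def mcl_def)
  then show ?thesis using mder_marks[OF assms] by simp
qed

text \<open>Multiplicities in the image are sizes of fibres: grouping the transitions by their pair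
  of rate and class turns one sum into the other.\<close>

lemma sum_count_image:
  fixes v :: "'b \<Rightarrow> real"
  assumes "finite A"
  shows "(\<Sum>y\<in>{y. y \<in># image_mset f (mset_set A) \<and> R y}. v y * real (count (image_mset f (mset_set A)) y)) =
    (\<Sum>x\<in>{x \<in> A. R (f x)}. v (f x))"
proof -
  let ?A = "{x \<in> A. R (f x)}" and ?Y = "{y. y \<in># image_mset f (mset_set A) \<and> R y}"
  have "(\<Sum>x\<in>?A. v (f x)) = (\<Sum>y\<in>?Y. \<Sum>x\<in>{x \<in> ?A. f x = y}. v (f x))"
    by (rule sum.group[symmetric]) (use assms in auto)
  also have "\<dots> = (\<Sum>y\<in>?Y. v y * real (count (image_mset f (mset_set A)) y))"
  proof (rule sum.cong[OF refl])
    fix y assume "y \<in> ?Y"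
    then have "{x \<in> ?A. f x = y} = {x \<in> A. f x = y}" by auto
    moreover have "count (image_mset f (mset_set A)) y = card {x \<in> A. f x = y}"
      using assms by (simp add: count_image_mset' flip: card_eq_sum) (auto intro!: arg_cong[where f = card])
    ultimately show "(\<Sum>x\<in>{x \<in> ?A. f x = y}. v (f x)) = v y * real (count (image_mset f (mset_set A)) y)"
      by simp
  qed
  finally show ?thesis by simp
qed

lemma harmony_rates:
  assumes P: "P \<in> core"
  shows "((\<exists>\<sigma>. sto D P \<sigma>) \<longleftrightarrow> (\<exists>l i P'. step D P (Mark l i) P')) \<and>
    (\<forall>\<sigma>. sto D P \<sigma> \<longrightarrow>
      finite {(l, i, P''). step D P (Mark l i) P'' \<and> scong D P'' P'} \<and>
      (\<Sum>(l, e) \<in> {(l, e). (l, e) \<in># \<sigma> \<and> e = scong_class D P'}. rate_val l * real (count \<sigma> (l, e))) =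
      (\<Sum>(l, i, P'') \<in> {(l, i, P''). step D P (Mark l i) P'' \<and> scong D P'' P'}. rate_val l))"
proof -
  obtain m where m: "mder D P m" using mder_total by blast
  have fin: "finite (marks D P)" using mder_marks[OF P m] by blast
  have r: "rcl m = image_mset (\<lambda>(l, i, X). (l, cls X)) (mset_set (marks D P))" by (rule rcl_marks[OF P m])
  have "(\<exists>\<sigma>. sto D P \<sigma>) \<longleftrightarrow> marks D P \<noteq> {}"
    unfolding ex_sto[OF m] r using fin by (simp add: mset_set_empty_iff)
  then have 1: "(\<exists>\<sigma>. sto D P \<sigma>) \<longleftrightarrow> (\<exists>l i P'. step D P (Mark l i) P')" by (auto simp: marks_def)
  \<comment> \<open>The transitions are selected by a property of their image, which is the form
    that \<open>sum_count_image\<close> needs.\<close>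
  have eq: "{(l, i, P''). step D P (Mark l i) P'' \<and> scong D P'' P'} =
      {x \<in> marks D P. snd ((\<lambda>(l, i, X). (l, cls X)) x) = cls P'}"
  proof (rule set_eqI)
    fix z :: "rate \<times> pos list \<times> ('x, 'q, 'k) proc"
    obtain l i X where z: "z = (l, i, X)" by (cases z) auto
    show "z \<in> {(l, i, P''). step D P (Mark l i) P'' \<and> scong D P'' P'} \<longleftrightarrow>
      z \<in> {x \<in> marks D P. snd ((\<lambda>(l, i, X). (l, cls X)) x) = cls P'}"
      by (simp add: z marks_def)
  qed
  have 2: "finite {(l, i, P''). step D P (Mark l i) P'' \<and> scong D P'' P'}" unfolding eq using fin by simp
  have 3: "(\<Sum>(l, e) \<in> {(l, e). (l, e) \<in># \<sigma> \<and> e = scong_class D P'}. rate_val l * real (count \<sigma> (l, e))) =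
      (\<Sum>(l, i, P'') \<in> {(l, i, P''). step D P (Mark l i) P'' \<and> scong D P'' P'}. rate_val l)" if "sto D P \<sigma>" for \<sigma>
  proof -
    have "\<sigma> = rcl m" using that sto_char[OF _ core_good[OF P] m] unfolding sto_eq by blast
    then have s: "\<sigma> = image_mset (\<lambda>(l, i, X). (l, cls X)) (mset_set (marks D P))" by (simp only: r)
    have "{(l, e). (l, e) \<in># \<sigma> \<and> e = cls P'} = {y. y \<in># \<sigma> \<and> snd y = cls P'}"
      by (rule set_eqI) (simp add: case_prod_unfold)
    then have "(\<Sum>(l, e) \<in> {(l, e). (l, e) \<in># \<sigma> \<and> e = cls P'}. rate_val l * real (count \<sigma> (l, e))) =
      (\<Sum>y \<in> {y. y \<in># \<sigma> \<and> snd y = cls P'}. rate_val (fst y) * real (count \<sigma> y))"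
      by (simp add: case_prod_unfold)
    also have "\<dots> = (\<Sum>x \<in> {x \<in> marks D P. snd ((\<lambda>(l, i, X). (l, cls X)) x) = cls P'}.
        rate_val (fst ((\<lambda>(l, i, X). (l, cls X)) x)))"
      unfolding s by (rule sum_count_image[OF fin])
    finally show ?thesis unfolding eq by (simp add: case_prod_unfold)
  qed
  from 1 2 3 show ?thesis by blast
qed

end

theorem theorem10:
  fixes D :: "('x::infinite, 'q::infinite, 'k) defs"
    and P :: "('x, 'q, 'k) proc"
  assumes "wf_defs D" and "P \<in> core"
  shows "(\<forall>P'. red D P None P' \<longleftrightarrow> (\<exists>P''. step D P (Std LTau) P'' \<and> scong D P'' P')) \<and>
    ((\<exists>\<sigma>. sto D P \<sigma>) \<longleftrightarrow> (\<exists>l i P'. step D P (Mark l i) P')) \<and>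
    (\<forall>\<sigma>. sto D P \<sigma> \<longrightarrow> (\<forall>P' \<in> core.
      finite {(l, i, P''). step D P (Mark l i) P'' \<and> scong D P'' P'} \<and>
      (\<Sum>(l, e) \<in> {(l, e). (l, e) \<in># \<sigma> \<and> e = scong_class D P'}.
          rate_val l * real (count \<sigma> (l, e))) =
      (\<Sum>(l, i, P'') \<in> {(l, i, P''). step D P (Mark l i) P'' \<and> scong D P'' P'}.
          rate_val l)))"
proof -
  interpret defs D by unfold_locales (rule assms(1))
  show ?thesis using harmony_tau[OF assms(2)] harmony_rates[OF assms(2)] by blast
qed

end
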